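(* Let $\Omega\subset\mathbf R^2$ be a bounded domain with smooth boundary such that $|\Omega|=|B_1|=\pi$, where $|\Omega|$ denotes the area of $\Omega$ and $B_1$ is the unit ball in $\mathbf R^2$. Then $$E_{8\pi}(\Omega)\ge E_{8\pi}(B_1),$$ and equality holds if and only if $\Omega=B_1$.
   Context: For a bounded smooth domain $\Omega\subset\mathbf R^2$ and $u\in H^1_0(\Omega)$ define $$I_{8\pi}(u,\Omega)=\frac{1}{16\pi}\int_\Omega|\nabla u|^2-\ln\left(\frac{1}{|\Omega|}\int_\Omega e^u\right),$$ and $E_{8\pi}(\Omega)=\inf_{u\in H^1_0(\Omega)}I_{8\pi}(u,\Omega)$.
   Formalization: The equality case is stated as "Ω is a disc of radius 1 with some centre" instead of "Ω = B_1", since the functional is translation invariant and every translate of B_1 also gives equality. *)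

theory Defs
  imports "HOL-Analysis.Analysis"
begin

type_synonym R2 = "real ^ 2"

inductive higher_pd :: "R2 set \<Rightarrow> (R2 \<Rightarrow> real) \<Rightarrow> (R2 \<Rightarrow> real) \<Rightarrow> bool"
  for S :: "R2 set" where
  refl: "higher_pd S f f"
| step: "higher_pd S f g \<Longrightarrow>
          (\<forall>x\<in>S. ((\<lambda>t. g (x + t *\<^sub>R axis i 1)) has_real_derivative h x) (at 0)) \<Longrightarrow>
          higher_pd S f h"

definition smooth_on :: "R2 set \<Rightarrow> (R2 \<Rightarrow> real) \<Rightarrow> bool" where
  "smooth_on S f \<longleftrightarrow>
     (\<forall>g. higher_pd S f g \<longrightarrow>
        continuous_on S g \<and>
        (\<forall>i. \<forall>x\<in>S. (\<lambda>t. g (x + t *\<^sub>R axis i 1)) differentiable (at 0)))"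

definition smooth_bounded_domain :: "R2 set \<Rightarrow> bool" where
  "smooth_bounded_domain \<Omega> \<longleftrightarrow>
     open \<Omega> \<and> connected \<Omega> \<and> bounded \<Omega> \<and> \<Omega> \<noteq> {} \<and>
     (\<forall>p\<in>frontier \<Omega>. \<exists>U \<rho>. open U \<and> p \<in> U \<and> smooth_on U \<rho> \<and>
        \<Omega> \<inter> U = {x\<in>U. \<rho> x < 0} \<and>
        (\<forall>x\<in>U. \<not> (\<rho> has_derivative (\<lambda>v. 0)) (at x)))"

definition grad :: "(R2 \<Rightarrow> real) \<Rightarrow> R2 \<Rightarrow> R2" where
  "grad \<phi> x = (\<chi> i. deriv (\<lambda>t. \<phi> (x + t *\<^sub>R axis i 1)) 0)"

definition test_fun :: "R2 set \<Rightarrow> (R2 \<Rightarrow> real) \<Rightarrow> bool" where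
  "test_fun \<Omega> \<phi> \<longleftrightarrow> smooth_on UNIV \<phi> \<and>
     compact (closure {x. \<phi> x \<noteq> 0}) \<and> closure {x. \<phi> x \<noteq> 0} \<subseteq> \<Omega>"

text \<open>\<open>H10 \<Omega> u g\<close>: u belongs to H^1_0(Omega) (closure of the test functions in the
  H^1 norm; u and g are extended by 0 outside Omega) and g is its weak gradient.\<close>
definition H10 :: "R2 set \<Rightarrow> (R2 \<Rightarrow> real) \<Rightarrow> (R2 \<Rightarrow> R2) \<Rightarrow> bool" where
  "H10 \<Omega> u g \<longleftrightarrow>
     u \<in> borel_measurable lebesgue \<and> g \<in> borel_measurable lebesgue \<and>
     (\<exists>\<phi>. (\<forall>n. test_fun \<Omega> (\<phi> n)) \<and>
        (\<lambda>n. \<integral>\<^sup>+ x. ennreal ((\<phi> n x - u x)\<^sup>2) \<partial>lebesgue) \<longlonglongrightarrow> 0 \<and>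
        (\<lambda>n. \<integral>\<^sup>+ x. ennreal ((norm (grad (\<phi> n) x - g x))\<^sup>2) \<partial>lebesgue) \<longlonglongrightarrow> 0)"

definition I8pi :: "R2 set \<Rightarrow> (R2 \<Rightarrow> real) \<Rightarrow> (R2 \<Rightarrow> R2) \<Rightarrow> real" where
  "I8pi \<Omega> u g =
     1 / (16 * pi) * (LINT x:\<Omega>|lebesgue. (norm (g x))\<^sup>2)
     - ln (1 / measure lebesgue \<Omega> * (LINT x:\<Omega>|lebesgue. exp (u x)))"

definition E8pi :: "R2 set \<Rightarrow> real" where
  "E8pi \<Omega> = Inf {I8pi \<Omega> u g | u g. H10 \<Omega> u g}"

end

theory Submission
  imports Defs "HOL-Probability.Probability"
begin

text \<open>
  For a test function \<open>u\<close> put \<open>m(t) = |{u \<ge> t}|\<close> and let \<open>q(t)\<close> be \<open>\<integral> e\<^sup>u\<close> over \<open>{u \<ge> t}\<close> divided by \<open>e\<^sup>t m(t)\<close>.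
  The isoperimetric inequality and Cauchy--Schwarz give
  \<open>4\<pi> (s - t)\<^sup>2 m(s) \<le> (m(t) - m(s)) \<integral> |\<nabla>u|\<^sup>2\<close> with the integral over \<open>{t \<le> u < s}\<close>. Refining the levels, one
  obtains that \<open>ln q + 1/q - 1\<close> decreases from level to level by at most the energy divided by \<open>16\<pi>\<close>, so
  \<open>ln A \<le> 1 - 1/A + (\<integral> |\<nabla>u|\<^sup>2) / 16\<pi>\<close> for the mean value \<open>A\<close> of \<open>e\<^sup>u\<close>. Hence the infimum over every domain of area \<open>\<pi>\<close> is at
  least \<open>-1\<close>, and truncated Liouville bubbles show that it equals \<open>-1\<close> for the disc.

  The isoperimetric inequality is proved by calibration with the Knothe map onto a disc. If \<open>\<Omega>\<close> is not a disc, the Knothe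
  map along one of the two coordinate axes has flux greater than \<open>2\<pi>\<close> out of \<open>\<Omega>\<close>: otherwise all horizontal and vertical
  slices of \<open>\<Omega>\<close> would be as long as those of a disc, so \<open>\<Omega>\<close> would have the second moment of the disc, and only the
  disc minimises the second moment for given area. This field improves the isoperimetric constant of all sets which nearly
  fill \<open>\<Omega>\<close>, and therefore raises the infimum above \<open>-1\<close>.\<close>

section \<open>A discrete energy inequality for level sets\<close>

text \<open>The constant \<open>16 * pi\<close> is 4 times \<open>4 * pi\<close>: the 4 comes from
  completing a square for one step between two levels, the \<open>4 * pi\<close> from the
  isoperimetric inequality. So a factor \<gamma> gained in the isoperimetric constant on a range of
  levels divides the energy charged to that range by \<gamma>.

  The equality case cannot be read off an extremal function, since the bubbles only approach -1. For
  a domain that is not a disc one needs a gap \<delta> which depends on the domain alone and holds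
  for all test functions at once; such a gap survives the passage to \<open>H10\<close> and to the
  infimum. Hence the gain is required, with fixed constants, for every set that nearly fills
  \<Omega>.

  Level sets of test functions may be irregular, so no perimeter occurs. Its place is taken by the
  integral of \<open>norm (p v)\<close> for a C1 function which is at least 1 on the set, and the
  coarea formula is replaced by cutoffs between two levels.\<close>

text \<open>For a radial function on a disc let \<open>q\<close> be the ratio of \<open>\<integral> e\<^sup>u\<close> over a superlevel disc
  \<open>{u > t}\<close> to \<open>e\<^sup>t\<close> times its area. The function below is the potential of \<open>q\<close> for which the Dirichlet energy
  exceeds the change of potential by a perfect square.\<close>

definition excess :: "real \<Rightarrow> real" where
  "excess q = ln q + 1 / q - 1"

lemma excess_mono:
  assumes "1 \<le> a" "a \<le> b" shows "excess a \<le> excess b"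
proof -
  have "ln (a / b) \<le> a / b - 1" using assms by (intro ln_le_minus_one) auto
  hence "ln b - ln a \<ge> 1 - a / b" using assms by (simp add: ln_div)
  moreover have "1 - a / b + 1 / b - 1 / a = (b - a) * (a - 1) / (a * b)"
    using assms by (simp add: field_simps)
  moreover have "(b - a) * (a - 1) / (a * b) \<ge> 0" using assms by auto
  ultimately show ?thesis unfolding excess_def by linarith
qed

text \<open>As a function of \<open>ln q\<close> the potential has derivative
  \<open>1 - 1 / q\<close> and second derivative \<open>1 / q\<close>, which is at most 1; Taylor
  expansion gives both correction terms.\<close>

lemma excess_exp_le:
  assumes "q \<ge> 1" "e \<ge> 0"
  shows "excess (exp e * q) \<le> excess q + e * (1 - 1 / q) + e\<^sup>2 / 2"
proof -
  have "exp (-e) \<le> 1 - e + e\<^sup>2 / 2"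
  proof -
    have "\<exists>t. \<bar>t\<bar> \<le> \<bar>-e\<bar> \<and> exp (-e) = (\<Sum>m<3. (-e) ^ m / fact m) + exp t / fact 3 * (-e) ^ 3"
      by (rule Maclaurin_exp_le)
    then obtain t where "exp (-e) = (\<Sum>m<3. (-e) ^ m / fact m) + exp t / fact 3 * (-e) ^ 3" by blast
    moreover have "exp t / fact 3 * (-e) ^ 3 \<le> 0" using assms by (simp add: mult_nonneg_nonneg)
    moreover have "(\<Sum>m<3. (-e) ^ m / fact m) = 1 - e + e\<^sup>2 / 2" by (simp add: eval_nat_numeral)
    ultimately show ?thesis by linarith
  qed
  hence "exp (-e) / q \<le> (1 - e + e\<^sup>2/2) / q" using assms by (simp add: divide_right_mono)
  also have "\<dots> = 1/q - e / q + e\<^sup>2/2/q" by (simp add: add_divide_distrib diff_divide_distrib)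
  also have "e\<^sup>2/2/q \<le> e\<^sup>2/2" using assms mult_right_mono[of 1 q "e\<^sup>2"] by (simp add: field_simps)
  finally have *: "exp (-e) / q \<le> 1/q - e / q + e\<^sup>2/2" by simp
  have "excess (exp e * q) = e + ln q + exp (-e) / q - 1"
    using assms by (simp add: excess_def ln_mult exp_minus field_simps)
  thus ?thesis using * by (simp add: excess_def algebra_simps)
qed

text \<open>With \<open>y = 1 - 1 / r\<close> the left side is the fall of \<open>excess\<close>
  from \<open>r * (1 + x * y)\<close> to \<open>r\<close>. Both sides vanish at
  \<open>x = 0\<close>, and the derivative of the difference has the sign of
  \<open>(1 + x)^2 - (1 + x * y)^2\<close>, which is nonnegative as \<open>y\<close> is below
  1.\<close>

lemma excess_drop:
  assumes y: "0 \<le> y" "y < 1" and x: "x \<ge> (0::real)"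
  shows "ln (1 + x * y) - (1 - y) * x * y / (1 + x * y) \<ge> y\<^sup>2 * ln (1 + x)"
proof -
  define f where "f = (\<lambda>x. ln (1 + x * y) - (1 - y) * x * y / (1 + x * y) - y\<^sup>2 * ln (1 + x))"
  have "f 0 \<le> f x"
  proof (rule DERIV_nonneg_imp_nondecreasing[OF x])
    fix z :: real assume z: "0 \<le> z" "z \<le> x"
    have p: "1 + z * y > 0" "1 + z > 0" using z y by (auto simp: add_pos_nonneg)
    let ?D = "y / (1 + z * y) - ((1 - y) * y) / (1 + z * y)\<^sup>2 - y\<^sup>2 / (1 + z)"
    have D: "(f has_real_derivative ?D) (at z)"
      unfolding f_def
      by (rule derivative_eq_intros refl | use p in force)+ (use p in \<open>simp add: field_simps power2_eq_square\<close>)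
    have "?D = y\<^sup>2 * ((1+z)\<^sup>2 - (1 + z * y)\<^sup>2) / ((1 + z * y)\<^sup>2 * (1+z))"
      using p by (simp add: divide_simps) (simp add: algebra_simps power2_eq_square)
    moreover have "(1 + z * y)\<^sup>2 \<le> (1+z)\<^sup>2" using y z by (intro power_mono) (auto simp: mult_left_le)
    ultimately have "?D \<ge> 0" using p by auto
    thus "\<exists>y. (f has_real_derivative y) (at z) \<and> 0 \<le> y" using D by blast
  qed
  thus ?thesis by (simp add: f_def)
qed

text \<open>The loss \<open>e\<^sup>2\<close> is of second order in the step \<open>e\<close> between two levels, so it disappears when the
  steps are refined.\<close>

lemma excess_step:
  assumes q: "q \<ge> 1" and x: "x > 0" and e: "e \<ge> 0"
    and q': "1 \<le> q'" "q' \<le> exp e * ((q + x) / (1 + x))"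
  shows "excess q' \<le> excess q + e\<^sup>2 / (4 * x) + e\<^sup>2"
proof -
  \<comment> \<open>A set with mean \<open>q\<close> is enlarged by the relative area
    \<open>x\<close>, on which the value is 1 in units of the higher level. \<open>r\<close> is the
    new mean, still in these units; the factor \<open>exp e\<close> changes to the lower level.
    \<open>y\<close> is the derivative of \<open>excess\<close> in \<open>ln r\<close>.\<close>
  define r where "r = (q + x) / (1 + x)"
  define y where "y = 1 - 1 / r"
  have r: "r \<ge> 1" using q x by (simp add: r_def field_simps)
  have y: "0 \<le> y" "y < 1" using r by (auto simp: y_def)
  have qr: "q = r * (1 + x * y)"
  proof -
    have "r * (1 + x * y) = r + x * (r - 1)" using r by (simp add: y_def field_simps)
    also have "\<dots> = r * (1 + x) - x" by (simp add: algebra_simps)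
    also have "r * (1 + x) = q + x" using x by (simp add: r_def)
    finally show ?thesis by simp
  qed
  have pos: "1 + x * y > 0" using x y by (simp add: add_pos_nonneg)
  have ry: "1 / r = 1 - y" by (simp add: y_def)
  have "excess q - excess r = ln (1 + x * y) + (1 / q - 1 / r)"
    using r pos by (simp add: excess_def qr ln_mult)
  also have "1 / q - 1 / r = (1 - y) * (1 / (1 + x * y) - 1)"
    using r pos by (simp add: qr ry[symmetric] algebra_simps)
  also have "1 / (1 + x * y) - 1 = - (x * y) / (1 + x * y)" using pos by (simp add: field_simps)
  finally have "excess q - excess r \<ge> y\<^sup>2 * ln (1 + x)"
    using excess_drop[OF y, of x] x by (simp add: algebra_simps)
  moreover have "excess q' \<le> excess r + e * y + e\<^sup>2/2"
    using excess_mono[OF q'] excess_exp_le[OF r e] by (simp add: r_def y_def)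
  moreover have "e * y - y\<^sup>2 * ln (1 + x) \<le> e\<^sup>2 / (4 * x) + e\<^sup>2 / 4"
  proof -
    let ?l = "ln (1 + x)"
    have l: "?l \<ge> x / (1 + x)"
    proof -
      have "ln (1 / (1 + x)) \<le> 1 / (1+x) - 1" using x by (intro ln_le_minus_one) auto
      thus ?thesis using x by (simp add: ln_div field_simps)
    qed
    hence lp: "?l > 0" using x by (smt (verit) divide_pos_pos)
    \<comment> \<open>The square is completed to maximise over \<open>y\<close>. Afterwards
      \<open>1 / ln (1 + x) \<le> 1 + 1 / x\<close> separates the part that will be paid by the
      energy from a loss of second order in \<open>e\<close>.\<close>
    have "e * y - y\<^sup>2 * ?l = e\<^sup>2 / (4 * ?l) - ?l * (y - e / (2 * ?l))\<^sup>2"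
      using lp by (simp add: field_simps power2_eq_square)
    also have "\<dots> \<le> e\<^sup>2 / (4 * ?l)" using lp by simp
    also have "\<dots> = (1 / ?l) * (e\<^sup>2 / 4)" by simp
    also have "\<dots> \<le> (1 / (x / (1 + x))) * (e\<^sup>2 / 4)"
      by (rule mult_right_mono, rule divide_left_mono) (use l lp x in auto)
    also have "\<dots> = e\<^sup>2 / (4 * x) + e\<^sup>2 / 4" using x by (simp add: field_simps)
    finally show ?thesis .
  qed
  moreover have "e\<^sup>2 \<ge> 0" by simp
  ultimately show ?thesis by linarith
qed

text \<open>\<open>m\<close>, \<open>F\<close> and \<open>G\<close> stand for the area of a
  superlevel set, the integral of the exponential over it and the Dirichlet energy in it; \<gamma>
  is the gain in the isoperimetric constant. Since \<open>m\<close> may jump, the differential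
  inequality in the level is replaced by a sum over n equal steps, whose total loss
  \<open>(S - T)^2 / n\<close> tends to 0.\<close>

lemma excess_band:
  fixes m F G :: "real \<Rightarrow> real"
  assumes TS: "T < S" and g: "\<gamma> > 0" and mS: "m S > 0"
    and F1: "\<And>t. T \<le> t \<Longrightarrow> t \<le> S \<Longrightarrow> exp t * m t \<le> F t"
    and mm: "\<And>t s. T \<le> t \<Longrightarrow> t < s \<Longrightarrow> s \<le> S \<Longrightarrow> m s \<le> m t"
    and FF: "\<And>t s. T \<le> t \<Longrightarrow> t < s \<Longrightarrow> s \<le> S \<Longrightarrow> F t \<le> F s + exp s * (m t - m s)"
    and GG: "\<And>t s. T \<le> t \<Longrightarrow> t < s \<Longrightarrow> s \<le> S \<Longrightarrow> 4 * pi * \<gamma> * (s - t)\<^sup>2 * m s \<le> (G t - G s) * (m t - m s)"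
  shows "excess (F T / (exp T * m T)) \<le> excess (F S / (exp S * m S)) + (G T - G S) / (16 * pi * \<gamma>)"
proof -
  define Q where "Q t = excess (F t / (exp t * m t)) - G t / (16 * pi * \<gamma>)" for t
  have mpos: "m t > 0" if "T \<le> t" "t \<le> S" for t
    using mm[of t S] mS that by (cases "t = S") auto
  have step: "Q t \<le> Q s + (s - t)\<^sup>2" if ts: "T \<le> t" "t < s" "s \<le> S" for t s
  proof -
    define x where "x = (m t - m s) / m s"
    define q where "q = F s / (exp s * m s)"
    define q' where "q' = F t / (exp t * m t)"
    have ms: "m s > 0" and mt: "m t > 0" using mpos ts by auto
    have mt': "m t = (1 + x) * m s" using ms by (simp add: x_def field_simps)
    have pos: "4 * pi * \<gamma> * (s - t)\<^sup>2 * m s > 0" using g ms ts by simp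
    \<comment> \<open>The left side of \<open>GG\<close> is positive, so the area must drop strictly
      between two levels.\<close>
    have "m t \<noteq> m s" using GG[OF ts] pos by auto
    hence x: "x > 0" using mm[OF ts] ms by (simp add: x_def)
    have q: "q \<ge> 1" using F1[of s] ts ms by (simp add: q_def)
    have q'1: "q' \<ge> 1" using F1[of t] ts mt by (simp add: q'_def)
    have "q' \<le> (F s + exp s * (m t - m s)) / (exp t * m t)"
      unfolding q'_def using FF[OF ts] mt by (simp add: divide_right_mono)
    also have "\<dots> = exp (s - t) * ((q + x) / (1 + x))"

    proof -
      have "F s + exp s * (m t - m s) = exp s * m s * (q + x)"
      proof -
        have "m t - m s = m s * x" using ms by (simp add: x_def)
        thus ?thesis using ms by (simp add: q_def algebra_simps)
      qed
      thus ?thesis using ms x by (simp add: mt' exp_diff)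
    qed
    finally have "excess q' \<le> excess q + (s - t)\<^sup>2 / (4 * x) + (s - t)\<^sup>2"
      using excess_step[OF q x _ q'1, of "s - t"] ts by simp
    moreover have "(s - t)\<^sup>2 / (4 * x) \<le> (G t - G s) / (16 * pi * \<gamma>)"
    proof -
      have "4 * pi * \<gamma> * (s - t)\<^sup>2 \<le> (G t - G s) * x"
        using GG[OF ts] ms by (simp add: x_def field_simps)
      thus ?thesis using x g by (simp add: field_simps)
    qed
    ultimately show ?thesis by (simp add: Q_def q_def q'_def diff_divide_distrib)
  qed
  have chain: "Q T \<le> Q (T + real k * e) + real k * e\<^sup>2" if "e > 0" "T + real k * e \<le> S" for k e
    using that(2)
  proof (induction k)
    case (Suc k)
    have "T + real k * e \<le> S" using Suc.prems that(1) by (simp add: algebra_simps)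
    note IH = Suc.IH[OF this]
    have "Q (T + real k * e) \<le> Q (T + real (Suc k) * e) + e\<^sup>2"
      using step[of "T + real k * e" "T + real (Suc k) * e"] Suc.prems that(1) by (simp add: algebra_simps)
    thus ?case using IH by (simp add: algebra_simps)
  qed simp
  have bound: "Q T \<le> Q S + (S - T)\<^sup>2 / real n" if "n > 0" for n :: nat
  proof -
    have "real n * ((S - T) / real n)\<^sup>2 = (S - T)\<^sup>2 / real n" "T + real n * ((S - T) / real n) = S"
      using that by (simp_all add: power2_eq_square)
    thus ?thesis using chain[of "(S - T) / real n" n] TS that by simp
  qed
  have "(\<lambda>n. Q S + (S - T)\<^sup>2 / real n) \<longlonglongrightarrow> Q S + 0"
    by (intro tendsto_intros lim_const_over_n)
  hence "Q T \<le> Q S"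
    using bound by (intro Lim_bounded2[where N=1]) auto
  thus ?thesis by (simp add: Q_def diff_divide_distrib)
qed

section \<open>Primitives and circular segments\<close>

definition prim :: "(real \<Rightarrow> real) \<Rightarrow> real \<Rightarrow> real" where
  "prim u x = (LINT t|lborel. indicator {..x} t * u t)"

lemma integrable_cont_supp:
  fixes u :: "'a::euclidean_space \<Rightarrow> real"
  assumes "continuous_on UNIV u" "compact K" "\<And>x. x \<notin> K \<Longrightarrow> u x = 0"
  shows "integrable lborel u"
proof -
  have "integrable lborel (\<lambda>x. indicator K x *\<^sub>R u x)"
    using assms by (intro borel_integrable_compact) (auto intro: continuous_on_subset)
  also have "(\<lambda>x. indicator K x *\<^sub>R u x) = u" using assms(3) by (auto simp: indicator_def fun_eq_iff)
  finally show ?thesis .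
qed

lemma integrable_cont_supp1:
  fixes u :: "real \<Rightarrow> real"
  assumes "continuous_on UNIV u" "\<And>x. \<bar>x\<bar> \<ge> L \<Longrightarrow> u x = 0"
  shows "integrable lborel u"
  by (rule integrable_cont_supp[OF assms(1), of "{-L..L}"]) (use assms(2) in auto)

lemma has_real_derivative_prim:
  assumes c: "continuous_on UNIV u" and s: "\<And>x. \<bar>x\<bar> \<ge> L \<Longrightarrow> u x = 0"
  shows "(prim u has_real_derivative u x) (at x)"
proof -
  define K where "K = \<bar>L\<bar> + \<bar>x\<bar> + 1"
  have c': "continuous_on {-K..b} u" for b using c continuous_on_subset by blast
  have eq: "prim u t = integral {-K..t} u" for t
  proof -
    have "prim u t = (LINT t:{-K..t}|lborel. u t)"
      unfolding prim_def set_lebesgue_integral_def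
      by (intro Bochner_Integration.integral_cong) (auto simp: indicator_def s K_def)
    also have "\<dots> = integral {-K..t} u"
      by (rule set_borel_integral_eq_integral(2)) (rule borel_integrable_atLeastAtMost'[OF c'])
    finally show ?thesis .
  qed
  have x: "x \<in> {-K<..<K}" by (auto simp: K_def)
  have "((\<lambda>t. integral {-K..t} u) has_real_derivative u x) (at x within {-K..K})"
    using x by (intro integral_has_real_derivative c') auto
  hence "((\<lambda>t. integral {-K..t} u) has_real_derivative u x) (at x)"
    using x by (simp add: at_within_Icc_at)
  thus ?thesis by (simp add: eq[abs_def])
qed

lemma prim_bounds:
  assumes c: "continuous_on UNIV u" and s: "\<And>x. \<bar>x\<bar> \<ge> L \<Longrightarrow> u x = 0" and nn: "\<And>x. u x \<ge> 0"
  shows "0 \<le> prim u x" "prim u x \<le> (LINT t|lborel. u t)"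
proof -
  have i: "integrable lborel u" by (rule integrable_cont_supp1[OF c s])
  show "0 \<le> prim u x" unfolding prim_def using nn by (intro integral_nonneg_AE) auto
  have "integrable lborel (\<lambda>t. indicator {..x} t *\<^sub>R u t)"
    by (rule integrable_mult_indicator[OF _ i]) simp
  thus "prim u x \<le> (LINT t|lborel. u t)" unfolding prim_def
    by (intro integral_mono i) (auto simp: indicator_def nn)
qed

lemma ibp_line:
  fixes A u :: "real \<Rightarrow> real"
  assumes A: "\<And>x. (A has_real_derivative A' x) (at x)" "continuous_on UNIV A'"
    and u: "\<And>x. (u has_real_derivative u' x) (at x)" "continuous_on UNIV u'"
    and s: "\<And>x. \<bar>x\<bar> \<ge> L \<Longrightarrow> u x = 0" "\<And>x. \<bar>x\<bar> \<ge> L \<Longrightarrow> u' x = 0"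
  shows "(LINT x|lborel. A x * u' x) = - (LINT x|lborel. A' x * u x)"
proof -
  have cA: "continuous_on UNIV A" and cu: "continuous_on UNIV u"
    using DERIV_isCont[OF A(1)] DERIV_isCont[OF u(1)] by (auto intro!: continuous_at_imp_continuous_on)
  have i1: "integrable lborel (\<lambda>x. A x * u' x)"
    by (rule integrable_cont_supp1[where L=L]) (auto intro!: continuous_intros cA u(2) s(2))
  have i2: "integrable lborel (\<lambda>x. A' x * u x)"
    by (rule integrable_cont_supp1[where L=L]) (auto intro!: continuous_intros cu A(2) s(1))
  let ?K = "\<bar>L\<bar>"
  have d: "((\<lambda>x. A x * u x) has_vector_derivative (A x * u' x + A' x * u x)) (at x within S)" for x S
    by (rule has_vector_derivative_at_within)
       (auto simp flip: has_real_derivative_iff_has_vector_derivative intro!: derivative_eq_intros A u)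
  have "(LINT x|lborel. indicator {-?K..?K} x *\<^sub>R (A x * u' x + A' x * u x)) = A ?K * u ?K - A (-?K) * u (-?K)"
    by (rule integral_FTC_atLeastAtMost) (auto intro!: d continuous_intros continuous_on_subset[OF cA]
       continuous_on_subset[OF cu] continuous_on_subset[OF A(2)] continuous_on_subset[OF u(2)])
  also have "\<dots> = 0" using s(1) by simp
  also have "(\<lambda>x. indicator {-?K..?K} x *\<^sub>R (A x * u' x + A' x * u x)) = (\<lambda>x. A x * u' x + A' x * u x)"
    by (rule ext, rename_tac x, case_tac "\<bar>x\<bar> \<ge> L") (auto simp: indicator_def s)
  finally show ?thesis using i1 i2 by simp
qed

text \<open>A chord of the unit disc seen from the centre under the angle \<open>2 a\<close> cuts off a segment of this area.\<close>

definition segarea :: "real \<Rightarrow> real" where "segarea a = a - sin a * cos a"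

definition segangle :: "real \<Rightarrow> real" where "segangle = the_inv_into {0..pi} segarea"

lemma has_real_derivative_segarea: "(segarea has_real_derivative 2 * (sin a)\<^sup>2) (at a)"
  unfolding segarea_def
  by (auto intro!: derivative_eq_intros) (simp add: power2_eq_square[symmetric] cos_squared_eq)

lemma continuous_on_segarea: "continuous_on S segarea"
  using has_real_derivative_segarea DERIV_isCont by (blast intro: continuous_at_imp_continuous_on)

lemma segarea_strict_mono: "strict_mono_on {0..pi} segarea"
proof (rule strict_mono_onI)
  fix r s :: real assume rs: "r \<in> {0..pi}" "s \<in> {0..pi}" "r < s"
  show "segarea r < segarea s"
  proof (rule DERIV_pos_imp_increasing_open[OF rs(3)])
    fix x assume "r < x" "x < s"
    hence "sin x > 0" using rs by (intro sin_gt_zero) auto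
    hence "2 * (sin x)\<^sup>2 > 0" by simp
    thus "\<exists>y. (segarea has_real_derivative y) (at x) \<and> 0 < y" using has_real_derivative_segarea by blast
  qed (rule continuous_on_segarea)
qed

lemma segarea_bij: "bij_betw segarea {0..pi} {0..pi}"
proof -
  have e: "segarea 0 = 0" "segarea pi = pi" by (auto simp: segarea_def)
  have inj: "inj_on segarea {0..pi}" by (rule strict_mono_on_imp_inj_on[OF segarea_strict_mono])
  have "segarea ` {0..pi} = {0..pi}"
  proof safe
    fix x assume "x \<in> {0..pi}"
    hence "segarea 0 \<le> segarea x" "segarea x \<le> segarea pi"
      using strict_mono_on_leD[OF segarea_strict_mono, of 0 x] strict_mono_on_leD[OF segarea_strict_mono, of x pi] by auto
    thus "segarea x \<in> {0..pi}" using e by auto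
  next
    fix y assume "y \<in> {0..pi}"
    hence "\<exists>x\<ge>0. x \<le> pi \<and> segarea x = y"
      by (intro IVT') (auto simp: e continuous_on_segarea)
    thus "y \<in> segarea ` {0..pi}" by auto
  qed
  thus ?thesis using inj by (simp add: bij_betw_def)
qed

lemma segarea_segangle: "s \<in> {0..pi} \<Longrightarrow> segarea (segangle s) = s"
  unfolding segangle_def using segarea_bij f_the_inv_into_f[of segarea "{0..pi}" s] by (auto simp: bij_betw_def)

lemma segangle_segarea: "a \<in> {0..pi} \<Longrightarrow> segangle (segarea a) = a"
  unfolding segangle_def using segarea_bij by (auto simp: bij_betw_def the_inv_into_f_f)

lemma segangle_range: "s \<in> {0..pi} \<Longrightarrow> segangle s \<in> {0..pi}"
  unfolding segangle_def using segarea_bij by (metis bij_betwE bij_betw_the_inv_into)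

lemma segangle_range_open: "s \<in> {0<..<pi} \<Longrightarrow> segangle s \<in> {0<..<pi}"
proof -
  assume s: "s \<in> {0<..<pi}"
  hence "segangle s \<in> {0..pi}" "segarea (segangle s) = s" using segangle_range segarea_segangle by auto
  moreover have "segangle s \<noteq> 0" "segangle s \<noteq> pi"
    using calculation s by (auto simp: segarea_def)
  ultimately show ?thesis by auto
qed

lemma continuous_on_segangle: "continuous_on {0..pi} segangle"
proof -
  have "continuous_on (segarea ` {0..pi}) segangle"
    by (rule continuous_on_inv) (auto simp: continuous_on_segarea segangle_segarea)
  thus ?thesis using segarea_bij by (simp add: bij_betw_def)
qed

lemma has_real_derivative_segangle:
  assumes s: "s \<in> {0<..<pi}"
  shows "(segangle has_real_derivative 1 / (2 * (sin (segangle s))\<^sup>2)) (at s)"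
proof -
  have "sin (segangle s) > 0" using segangle_range_open[OF s] by (intro sin_gt_zero) auto
  moreover have "isCont segangle s"
    using continuous_on_subset[OF continuous_on_segangle, of "{0<..<pi}"] s
    by (simp add: continuous_on_eq_continuous_at greaterThanLessThan_subseteq_atLeastAtMost_iff subset_iff)
  ultimately have "(segangle has_real_derivative inverse (2 * (sin (segangle s))\<^sup>2)) (at s)"
    using s by (intro DERIV_inverse_function[OF has_real_derivative_segarea, of _ _ 0 pi])
      (auto simp: segarea_segangle)
  thus ?thesis by (simp add: inverse_eq_divide)
qed

section \<open>Knothe's vector field\<close>

abbreviation plane :: "(real \<times> real) measure" where
  "plane \<equiv> lborel \<Otimes>\<^sub>M lborel"

definition C1_box :: "real \<Rightarrow> (real \<Rightarrow> real \<Rightarrow> real) \<Rightarrow> (real \<Rightarrow> real \<Rightarrow> real) \<Rightarrow> (real \<Rightarrow> real \<Rightarrow> real) \<Rightarrow> bool" where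
  "C1_box L f f1 f2 \<longleftrightarrow>
     (\<forall>x y. ((\<lambda>x. f x y) has_real_derivative f1 x y) (at x)) \<and>
     (\<forall>x y. (f x has_real_derivative f2 x y) (at y)) \<and>
     continuous_on UNIV (\<lambda>z. f (fst z) (snd z)) \<and>
     continuous_on UNIV (\<lambda>z. f1 (fst z) (snd z)) \<and> continuous_on UNIV (\<lambda>z. f2 (fst z) (snd z)) \<and>
     (\<forall>x y. \<bar>x\<bar> \<ge> L \<or> \<bar>y\<bar> \<ge> L \<longrightarrow> f x y = 0 \<and> f1 x y = 0 \<and> f2 x y = 0)"

lemma cont_section:
  fixes g :: "real \<Rightarrow> real \<Rightarrow> real"
  assumes "continuous_on UNIV (\<lambda>z. g (fst z) (snd z))"
  shows "continuous_on UNIV (g x)" "continuous_on UNIV (\<lambda>x. g x y)"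
proof -
  have "continuous_on UNIV (\<lambda>y::real. (x, y))" "continuous_on UNIV (\<lambda>x::real. (x, y))" by (intro continuous_intros)+
  from this[THEN continuous_on_compose2[OF assms]]
  show "continuous_on UNIV (g x)" "continuous_on UNIV (\<lambda>x. g x y)" by simp_all
qed

lemma integrable_cont_supp2:
  fixes g :: "real \<Rightarrow> real \<Rightarrow> real"
  assumes "continuous_on UNIV (\<lambda>z. g (fst z) (snd z))" "\<And>x y. \<bar>x\<bar> \<ge> L \<or> \<bar>y\<bar> \<ge> L \<Longrightarrow> g x y = 0"
  shows "integrable plane (\<lambda>z. g (fst z) (snd z))"
  unfolding lborel_prod
proof (rule integrable_cont_supp[OF assms(1), of "cbox (-L,-L) (L,L)"])
  fix z :: "real \<times> real" assume "z \<notin> cbox (-L,-L) (L,L)"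
  hence "\<bar>fst z\<bar> \<ge> L \<or> \<bar>snd z\<bar> \<ge> L" by (cases z) (auto simp: cbox_Pair_eq)
  thus "g (fst z) (snd z) = 0" by (rule assms(2))
qed (rule compact_cbox)

text \<open>The field \<open>(f1, f2)\<close> below is the Knothe map which carries the density \<open>\<psi>\<close> into a disc of radius \<open>R\<close>
  whose area exceeds the mass of \<open>\<psi>\<close>: \<open>f1\<close> matches areas to the left of vertical lines, and \<open>f2\<close> maps each
  vertical slice monotonically onto the corresponding chord. The surplus of area is split between both ends, which keeps
  the chords away from length 0 and \<open>f1\<close> continuously differentiable.
  On an empty slice \<open>x / 0 = 0\<close> makes \<open>f2\<close> constant, as it should be.\<close>

locale knothe =
  fixes \<psi> :: "real \<Rightarrow> real \<Rightarrow> real" and L R :: real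
  assumes cont: "continuous_on UNIV (\<lambda>z. \<psi> (fst z) (snd z))"
    and nonneg: "\<psi> x y \<ge> 0"
    and supp: "\<bar>x\<bar> \<ge> L \<or> \<bar>y\<bar> \<ge> L \<Longrightarrow> \<psi> x y = 0"
    and R: "R > 0"
    and mass: "(LINT z|plane. \<psi> (fst z) (snd z)) < pi * R\<^sup>2"
begin

definition slice :: "real \<Rightarrow> real" where "slice x = (LINT y|lborel. \<psi> x y)"
definition total :: real where "total = (LINT x|lborel. slice x)"
definition angle :: "real \<Rightarrow> real" where
  "angle x = segangle (prim slice x / R\<^sup>2 + (pi - total / R\<^sup>2) / 2)"
definition chord :: "real \<Rightarrow> real" where "chord x = 2 * R * sin (angle x)"
definition f1 :: "real \<Rightarrow> real" where "f1 x = - R * cos (angle x)"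
definition f2 :: "real \<Rightarrow> real \<Rightarrow> real" where "f2 x y = chord x * (prim (\<psi> x) y / slice x - 1 / 2)"
definition dv :: "real \<Rightarrow> real \<Rightarrow> real" where "dv x y = slice x / chord x + chord x * \<psi> x y / slice x"
text \<open>A lower bound of \<open>dv\<close> when \<psi> is at most 1. The extra factor \<psi> in
  the first summand makes the expression vanish outside the support, so that it is integrable by
  itself, and its integral over a slice is \<open>slice^2 / chord + chord\<close> wherever the slice
  is not null.\<close>

definition ev :: "real \<Rightarrow> real \<Rightarrow> real" where "ev x y = \<psi> x y * (slice x / chord x + chord x / slice x)"

lemma int_psi: "integrable plane (\<lambda>z. \<psi> (fst z) (snd z))"
  by (rule integrable_cont_supp2[OF cont supp])

lemma total_eq: "total = (LINT z|plane. \<psi> (fst z) (snd z))"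
  unfolding total_def slice_def using lborel_pair.integral_fst[of "\<lambda>x y. \<psi> x y"] int_psi
  by (simp add: case_prod_beta')

lemma int_psi_x: "integrable lborel (\<psi> x)"
  by (rule integrable_cont_supp1[where L=L]) (auto intro: cont_section[OF cont] supp)

lemma supp_D: "\<psi> x y \<noteq> 0 \<Longrightarrow> \<bar>x\<bar> < L \<and> \<bar>y\<bar> < L"
  using supp[of x y] by linarith

lemma slice_supp: "\<bar>x\<bar> \<ge> L \<Longrightarrow> slice x = 0"
  by (simp add: slice_def supp)

lemma slice_nonneg: "slice x \<ge> 0"
  by (simp add: slice_def nonneg)

lemma cont_slice: "continuous_on UNIV slice"
proof -
  have "slice = (\<lambda>x. integral (cbox (-L) L) (\<psi> x))"
  proof
    fix x
    have "slice x = (LINT y:{-L..L}|lborel. \<psi> x y)"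
      unfolding slice_def set_lebesgue_integral_def
      by (intro Bochner_Integration.integral_cong) (auto simp: indicator_def dest!: supp_D)
    also have "\<dots> = integral (cbox (-L) L) (\<psi> x)"
      using continuous_on_subset[OF cont_section(1)[OF cont]]
      by (subst set_borel_integral_eq_integral(2)) (auto intro!: borel_integrable_atLeastAtMost')
    finally show "slice x = integral (cbox (-L) L) (\<psi> x)" .
  qed
  moreover have "continuous_on UNIV (\<lambda>x. integral (cbox (-L) L) (\<psi> x))"
    by (rule integral_continuous_on_param) (use continuous_on_subset[OF cont] in \<open>auto simp: case_prod_beta'\<close>)
  ultimately show ?thesis by simp
qed

lemma int_slice: "integrable lborel slice"
  by (rule integrable_cont_supp1[OF cont_slice slice_supp])

lemma arg_range: "prim slice x / R\<^sup>2 + (pi - total / R\<^sup>2) / 2 \<in> {0<..<pi}"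
proof -
  have "0 \<le> prim slice x / R\<^sup>2" "prim slice x / R\<^sup>2 \<le> total / R\<^sup>2"
    using prim_bounds(1)[OF cont_slice slice_supp slice_nonneg, where x=x] prim_bounds(2)[OF cont_slice slice_supp slice_nonneg, where x=x] R
    by (auto simp: total_def divide_right_mono)
  moreover have "total / R\<^sup>2 < pi" using mass R by (simp add: total_eq field_simps)
  moreover have "0 < p + (pi - t) / 2 \<and> p + (pi - t) / 2 < pi" if "0 \<le> p" "p \<le> t" "t < pi" for p t :: real
    using that pi_gt_zero by (simp add: field_simps)
  ultimately show ?thesis by simp
qed

lemma angle_range: "angle x \<in> {0<..<pi}"
  unfolding angle_def by (rule segangle_range_open[OF arg_range])

lemma sin_angle_pos: "sin (angle x) > 0"
  using angle_range by (intro sin_gt_zero) auto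

lemma chord_pos: "chord x > 0" using sin_angle_pos R by (simp add: chord_def)

lemma chord_le: "chord x \<le> 2 * R" using R by (simp add: chord_def)

lemma deriv_angle: "(angle has_real_derivative slice x / (2 * R\<^sup>2 * (sin (angle x))\<^sup>2)) (at x)"
proof -
  have "((\<lambda>x. prim slice x / R\<^sup>2 + (pi - total / R\<^sup>2) / 2) has_real_derivative slice x / R\<^sup>2) (at x)"
    using DERIV_add[OF DERIV_cdivide[OF has_real_derivative_prim[OF cont_slice slice_supp]] DERIV_const] by simp
  from DERIV_chain2[OF has_real_derivative_segangle[OF arg_range] this]
  show ?thesis unfolding angle_def by (simp add: algebra_simps)
qed

lemma cont_angle: "continuous_on UNIV angle"
  using DERIV_isCont[OF deriv_angle] by (auto intro!: continuous_at_imp_continuous_on)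

lemma cont_chord: "continuous_on UNIV chord"
  unfolding chord_def by (intro continuous_intros cont_angle)

lemma deriv_f1: "(f1 has_real_derivative slice x / chord x) (at x)"
proof -
  have "(f1 has_real_derivative R * sin (angle x) * (slice x / (2 * R\<^sup>2 * (sin (angle x))\<^sup>2))) (at x)"
    unfolding f1_def using DERIV_cmult[OF DERIV_chain2[OF DERIV_cos deriv_angle], of "-R"] by (simp add: mult.assoc)
  also have "R * sin (angle x) * (slice x / (2 * R\<^sup>2 * (sin (angle x))\<^sup>2)) = slice x / chord x"
    using R sin_angle_pos[of x] by (simp add: chord_def power2_eq_square)
  finally show ?thesis .
qed

lemma deriv_f2: "(f2 x has_real_derivative chord x * \<psi> x y / slice x) (at y)"
  unfolding f2_def
  using DERIV_cmult[OF DERIV_diff[OF DERIV_cdivide[OF has_real_derivative_prim[OF cont_section(1)[OF cont] supp[OF disjI2]]] DERIV_const]]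
  by simp

text \<open>At the abscissa \<open>- R * cos (angle x)\<close> half a chord has the length
  \<open>R * sin (angle x)\<close>, and \<open>f2\<close> never exceeds half a chord because the
  quotient in its definition lies in [0, 1].\<close>

lemma field_bound: "(f1 x)\<^sup>2 + (f2 x y)\<^sup>2 \<le> R\<^sup>2"
proof -
  have p: "0 \<le> prim (\<psi> x) y" "prim (\<psi> x) y \<le> slice x"
    using prim_bounds[OF cont_section(1)[OF cont] supp[OF disjI2] nonneg] by (auto simp: slice_def)
  hence "0 \<le> prim (\<psi> x) y / slice x" "prim (\<psi> x) y / slice x \<le> 1"
    by (auto simp: divide_le_eq_1)
  hence "\<bar>prim (\<psi> x) y / slice x - 1/2\<bar> \<le> 1/2" unfolding abs_le_iff by linarith
  hence "(prim (\<psi> x) y / slice x - 1/2)\<^sup>2 \<le> (1/2)\<^sup>2" by (subst abs_le_square_iff[symmetric]) simp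
  hence "(f2 x y)\<^sup>2 \<le> (chord x)\<^sup>2 * (1/2)\<^sup>2" unfolding f2_def power_mult_distrib
    by (intro mult_left_mono) auto
  also have "\<dots> = R\<^sup>2 * (sin (angle x))\<^sup>2" by (simp add: chord_def power_mult_distrib power2_eq_square)
  finally have "(f1 x)\<^sup>2 + (f2 x y)\<^sup>2 \<le> R\<^sup>2 * ((cos (angle x))\<^sup>2 + (sin (angle x))\<^sup>2)"
    unfolding distrib_left by (simp add: f1_def power_mult_distrib)
  thus ?thesis by simp
qed

section \<open>Measurability and integrals of the divergence\<close>

lemma meas_psi [measurable]: "(\<lambda>z. \<psi> (fst z) (snd z)) \<in> borel_measurable plane"
  using int_psi by (rule borel_measurable_integrable)
lemma meas_psi' [measurable]: "(\<lambda>z. \<psi> (fst z) (snd z)) \<in> borel_measurable (borel \<Otimes>\<^sub>M borel)"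
  using meas_psi by (simp add: borel_prod lborel_prod)
lemma meas_slice [measurable]: "slice \<in> borel_measurable borel"
  using cont_slice by (rule borel_measurable_continuous_onI)
lemma meas_chord [measurable]: "chord \<in> borel_measurable borel"
  using cont_chord by (rule borel_measurable_continuous_onI)
lemma meas_f1 [measurable]: "f1 \<in> borel_measurable borel"
  using DERIV_isCont[OF deriv_f1] by (intro borel_measurable_continuous_onI continuous_at_imp_continuous_on) auto
lemma meas_f2 [measurable]: "(\<lambda>z. f2 (fst z) (snd z)) \<in> borel_measurable plane"
proof -
  have 1: "(\<lambda>w. \<psi> (fst (fst w)) (snd w)) \<in> borel_measurable ((borel \<Otimes>\<^sub>M borel) \<Otimes>\<^sub>M lborel)"
    by (rule measurable_compose[OF _ meas_psi', of "\<lambda>w. (fst (fst w), snd w)", simplified]) measurable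
  have "(\<lambda>z. prim (\<psi> (fst z)) (snd z)) \<in> borel_measurable (borel \<Otimes>\<^sub>M borel)"
    unfolding prim_def
  proof (rule sigma_finite_measure.borel_measurable_lebesgue_integral[OF sigma_finite_lborel])
    have "(\<lambda>w. (if snd w \<le> snd (fst w) then 1 else 0) * \<psi> (fst (fst w)) (snd w)) \<in> borel_measurable ((borel \<Otimes>\<^sub>M borel) \<Otimes>\<^sub>M lborel)"
      using 1 by measurable
    thus "(\<lambda>(z, t). indicator {..snd z} t * \<psi> (fst z) t) \<in> borel_measurable ((borel \<Otimes>\<^sub>M borel) \<Otimes>\<^sub>M lborel)"
      by (simp add: case_prod_beta' indicator_def of_bool_def)
  qed
  thus ?thesis unfolding f2_def by simp
qed

text \<open>The integrand may be unbounded where the slices shrink to 0. Integrating over a slice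
  first cancels \<open>slice\<close>, and what remains is at most \<open>chord\<close>, hence at
  most \<open>2 * R\<close> on a bounded range of \<open>x\<close>.\<close>

lemma int_dv_part: "integrable plane (\<lambda>z. chord (fst z) * \<psi> (fst z) (snd z) / slice (fst z))"
proof (rule lborel_pair.Fubini_integrable)
  show "(\<lambda>z. chord (fst z) * \<psi> (fst z) (snd z) / slice (fst z)) \<in> borel_measurable plane"
    by measurable
  have eq: "(LINT y|lborel. norm (chord x * \<psi> x y / slice x)) = (if slice x = 0 then 0 else chord x)" for x
  proof -
    have "(LINT y|lborel. norm (chord x * \<psi> x y / slice x)) = (LINT y|lborel. chord x / slice x * \<psi> x y)"
      using chord_pos[of x] slice_nonneg[of x] nonneg by (intro Bochner_Integration.integral_cong) auto
    also have "\<dots> = chord x / slice x * slice x" by (simp add: slice_def)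
    finally show ?thesis by simp
  qed
  have "integrable lborel (\<lambda>x. 2 * R * indicator {-L..L} x :: real)"
    by (intro integrable_mult_right integrable_real_indicator) (auto simp: emeasure_lborel_Icc_eq)
  hence "integrable lborel (\<lambda>x. if slice x = 0 then 0 else chord x)"
  proof (rule Bochner_Integration.integrable_bound)
    show "AE x in lborel. norm (if slice x = 0 then 0 else chord x) \<le> norm (2 * R * indicator {-L..L} x :: real)"
    proof (rule AE_I2)
      fix x show "norm (if slice x = 0 then 0 else chord x) \<le> norm (2 * R * indicator {-L..L} x :: real)"
        using slice_supp[of x] chord_pos[of x] chord_le[of x] R by (cases "\<bar>x\<bar> \<ge> L") (auto simp: indicator_def)
    qed
  qed measurable
  thus "integrable lborel (\<lambda>x. LINT y|lborel. norm (chord (fst (x, y)) * \<psi> (fst (x, y)) (snd (x, y)) / slice (fst (x, y))))"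
    by (simp only: fst_conv snd_conv eq)
  show "AE x in lborel. integrable lborel (\<lambda>y. chord (fst (x, y)) * \<psi> (fst (x, y)) (snd (x, y)) / slice (fst (x, y)))"
    using int_psi_x by (intro AE_I2) simp
qed

lemma int_ev: "integrable plane (\<lambda>z. ev (fst z) (snd z))"
proof -
  have "integrable plane (\<lambda>z. \<psi> (fst z) (snd z) * (slice (fst z) / chord (fst z)))"
  proof (rule integrable_cont_supp2[where L=L])
    show "continuous_on UNIV (\<lambda>z. \<psi> (fst z) (snd z) * (slice (fst z) / chord (fst z)))"
      using chord_pos
      by (intro continuous_intros cont continuous_on_compose2[OF cont_slice] continuous_on_compose2[OF cont_chord])
         (auto simp: less_imp_neq[symmetric])
  qed (auto simp: supp)
  from Bochner_Integration.integrable_add[OF this int_dv_part] show ?thesis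
    by (simp add: ev_def algebra_simps)
qed

text \<open>The inequality of arithmetic and geometric means for slice and chord, with its
  remainder. The term \<open>2 * total\<close> yields the isoperimetric inequality; the remainder
  measures how far the slices are from chords of a disc and decides the strict case.\<close>

lemma integral_ev: "(LINT z|plane. ev (fst z) (snd z)) =
   2 * total + (LINT x|lborel. (if slice x = 0 then 0 else (slice x - chord x)\<^sup>2 / chord x))"
   "integrable lborel (\<lambda>x. (if slice x = 0 then 0 else (slice x - chord x)\<^sup>2 / chord x))"
proof -
  have eq: "(LINT y|lborel. ev x y) = 2 * slice x + (if slice x = 0 then 0 else (slice x - chord x)\<^sup>2 / chord x)" for x
  proof -
    have "(LINT y|lborel. ev x y) = slice x * (slice x / chord x + chord x / slice x)"
      by (simp add: ev_def slice_def)
    also have "\<dots> = 2 * slice x + (if slice x = 0 then 0 else (slice x - chord x)\<^sup>2 / chord x)"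
      using chord_pos[of x] by (simp add: field_simps power2_eq_square)
    finally show ?thesis .
  qed
  have i: "integrable plane (\<lambda>(x,y). ev x y)" using int_ev by (simp add: case_prod_beta')
  have "integrable lborel (\<lambda>x. LINT y|lborel. ev x y)" using lborel_pair.integrable_fst[OF i] .
  hence "integrable lborel (\<lambda>x. (LINT y|lborel. ev x y) - 2 * slice x)" using int_slice by simp
  thus i2: "integrable lborel (\<lambda>x. (if slice x = 0 then 0 else (slice x - chord x)\<^sup>2 / chord x))"
    by (simp only: eq add_diff_cancel_left')
  have "(LINT z|plane. ev (fst z) (snd z)) = (LINT x|lborel. LINT y|lborel. ev x y)"
    using lborel_pair.integral_fst[OF i] by (simp add: case_prod_beta')
  also have "\<dots> = (LINT x|lborel. 2 * slice x) + (LINT x|lborel. (if slice x = 0 then 0 else (slice x - chord x)\<^sup>2 / chord x))"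
    unfolding eq by (rule Bochner_Integration.integral_add) (use int_slice i2 in auto)
  finally show "(LINT z|plane. ev (fst z) (snd z)) =
   2 * total + (LINT x|lborel. (if slice x = 0 then 0 else (slice x - chord x)\<^sup>2 / chord x))"
    by (simp add: total_def)
qed

text \<open>The divergence \<open>dv\<close> of the field contains only \<open>\<partial>f1/\<partial>x\<close> and \<open>\<partial>f2/\<partial>y\<close>. Integrating by parts along
  horizontal and vertical lines separately, one never needs the regularity of \<open>f2\<close> in \<open>x\<close>.\<close>

lemma calibration:
  assumes f: "C1_box L f g1 g2"
  shows "integrable plane (\<lambda>z. f (fst z) (snd z) * dv (fst z) (snd z))"
    and "(LINT z|plane. f (fst z) (snd z) * dv (fst z) (snd z))
         \<le> R * (LINT z|plane. sqrt ((g1 (fst z) (snd z))\<^sup>2 + (g2 (fst z) (snd z))\<^sup>2))"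
proof -
  let ?P = "plane"
  from f have d1: "((\<lambda>x. f x y) has_real_derivative g1 x y) (at x)" and d2: "(f x has_real_derivative g2 x y) (at y)"
    and c: "continuous_on UNIV (\<lambda>z. f (fst z) (snd z))"
    and c1: "continuous_on UNIV (\<lambda>z. g1 (fst z) (snd z))" and c2: "continuous_on UNIV (\<lambda>z. g2 (fst z) (snd z))"
    and s: "\<bar>x\<bar> \<ge> L \<or> \<bar>y\<bar> \<ge> L \<Longrightarrow> f x y = 0" "\<bar>x\<bar> \<ge> L \<or> \<bar>y\<bar> \<ge> L \<Longrightarrow> g1 x y = 0" "\<bar>x\<bar> \<ge> L \<or> \<bar>y\<bar> \<ge> L \<Longrightarrow> g2 x y = 0" for x y
    unfolding C1_box_def by blast+
  note ifz = integrable_cont_supp2[OF c s(1)] and i1 = integrable_cont_supp2[OF c1 s(2)] and i2 = integrable_cont_supp2[OF c2 s(3)]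
  note [measurable] = ifz[THEN borel_measurable_integrable] i1[THEN borel_measurable_integrable] i2[THEN borel_measurable_integrable]
  have f1R: "\<bar>f1 x\<bar> \<le> R" for x using R by (simp add: f1_def abs_mult)
  have f2R: "\<bar>f2 x y\<bar> \<le> R" for x y
  proof -
    have "(f2 x y)\<^sup>2 \<le> R\<^sup>2" using field_bound[of x y] by (smt (verit) zero_le_power2)
    thus ?thesis using R abs_le_square_iff[of "f2 x y" R] by simp
  qed
  have j1: "integrable ?P (\<lambda>z. f1 (fst z) * g1 (fst z) (snd z))"
    by (rule Bochner_Integration.integrable_bound[of _ "\<lambda>z. R * g1 (fst z) (snd z)"])
       (use i1 R f1R in \<open>auto simp: abs_mult intro!: mult_right_mono AE_I2\<close>)
  have j2: "integrable ?P (\<lambda>z. f2 (fst z) (snd z) * g2 (fst z) (snd z))"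
    by (rule Bochner_Integration.integrable_bound[of _ "\<lambda>z. R * g2 (fst z) (snd z)"])
       (use i2 R f2R in \<open>auto simp: abs_mult intro!: mult_right_mono AE_I2\<close>)
  have csc: "continuous_on UNIV (\<lambda>x. slice x / chord x)"
    using chord_pos by (intro continuous_intros cont_slice cont_chord) (auto simp: less_imp_neq[symmetric])
  have csc': "continuous_on UNIV (\<lambda>z::real \<times> real. slice (fst z) / chord (fst z))"
    by (rule continuous_on_compose2[OF csc continuous_on_fst[OF continuous_on_id]]) simp
  have k1: "integrable ?P (\<lambda>z. slice (fst z) / chord (fst z) * f (fst z) (snd z))"
    by (rule integrable_cont_supp2[where L=L])
       (rule continuous_on_mult[OF csc' c], simp add: s(1))
  obtain B where B: "\<And>z. \<bar>f (fst z) (snd z)\<bar> \<le> B"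
  proof -
    have "compact ((\<lambda>z. f (fst z) (snd z)) ` cbox (-L,-L) (L,L))"
      by (rule compact_continuous_image[OF continuous_on_subset[OF c] compact_cbox]) simp
    then obtain B where B: "\<forall>x\<in>(\<lambda>z. f (fst z) (snd z)) ` cbox (-L,-L) (L,L). norm x \<le> B"
      using compact_imp_bounded bounded_iff by blast
    have "\<bar>f (fst z) (snd z)\<bar> \<le> \<bar>B\<bar>" for z
    proof (cases "z \<in> cbox (-L,-L) (L,L)")
      case True thus ?thesis using B by fastforce
    next
      case False
      hence "\<bar>fst z\<bar> \<ge> L \<or> \<bar>snd z\<bar> \<ge> L" by (cases z) (auto simp: cbox_Pair_eq)
      thus ?thesis by (simp add: s(1))
    qed
    thus ?thesis using that by blast
  qed
  have k2: "integrable ?P (\<lambda>z. chord (fst z) * \<psi> (fst z) (snd z) / slice (fst z) * f (fst z) (snd z))"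
  proof (rule Bochner_Integration.integrable_bound[of _ "\<lambda>z. B * (chord (fst z) * \<psi> (fst z) (snd z) / slice (fst z))"])
    show "integrable ?P (\<lambda>z. B * (chord (fst z) * \<psi> (fst z) (snd z) / slice (fst z)))"
      by (rule integrable_mult_right) (rule int_dv_part)
    have "norm (w * f (fst z) (snd z)) \<le> norm (B * w)" for w z
      using B[of z] mult_left_mono[OF B[of z], of "\<bar>w\<bar>"] by (simp add: abs_mult mult.commute)
    thus "AE z in ?P. norm (chord (fst z) * \<psi> (fst z) (snd z) / slice (fst z) * f (fst z) (snd z)) \<le>
       norm (B * (chord (fst z) * \<psi> (fst z) (snd z) / slice (fst z)))" by blast
  qed measurable
  have sum: "(\<lambda>z. f (fst z) (snd z) * dv (fst z) (snd z)) =
    (\<lambda>z. slice (fst z) / chord (fst z) * f (fst z) (snd z) + chord (fst z) * \<psi> (fst z) (snd z) / slice (fst z) * f (fst z) (snd z))"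
    by (simp add: dv_def algebra_simps)
  show "integrable ?P (\<lambda>z. f (fst z) (snd z) * dv (fst z) (snd z))"
    unfolding sum by (rule Bochner_Integration.integrable_add[OF k1 k2])
  have e1: "(LINT z|?P. f1 (fst z) * g1 (fst z) (snd z)) = - (LINT z|?P. slice (fst z) / chord (fst z) * f (fst z) (snd z))"
  proof -
    have "(LINT z|?P. f1 (fst z) * g1 (fst z) (snd z)) = (LINT y|lborel. LINT x|lborel. f1 x * g1 x y)"
      using lborel_pair.integral_snd[of "\<lambda>x y. f1 x * g1 x y"] j1 by (simp add: case_prod_beta')
    also have "\<dots> = (LINT y|lborel. - (LINT x|lborel. slice x / chord x * f x y))"
      by (intro Bochner_Integration.integral_cong HOL.refl ibp_line[OF deriv_f1 csc d1 cont_section(2)[OF c1], where L=L])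
         (auto simp: s)
    also have "\<dots> = - (LINT y|lborel. LINT x|lborel. slice x / chord x * f x y)" by simp
    also have "(LINT y|lborel. LINT x|lborel. slice x / chord x * f x y) = (LINT z|?P. slice (fst z) / chord (fst z) * f (fst z) (snd z))"
      using lborel_pair.integral_snd[of "\<lambda>x y. slice x / chord x * f x y"] k1 by (simp add: case_prod_beta')
    finally show ?thesis .
  qed
  have e2: "(LINT z|?P. f2 (fst z) (snd z) * g2 (fst z) (snd z)) = - (LINT z|?P. chord (fst z) * \<psi> (fst z) (snd z) / slice (fst z) * f (fst z) (snd z))"
  proof -
    have "(LINT z|?P. f2 (fst z) (snd z) * g2 (fst z) (snd z)) = (LINT x|lborel. LINT y|lborel. f2 x y * g2 x y)"
      using lborel_pair.integral_fst[of "\<lambda>x y. f2 x y * g2 x y"] j2 by (simp add: case_prod_beta')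
    also have "\<dots> = (LINT x|lborel. - (LINT y|lborel. chord x * \<psi> x y / slice x * f x y))"
    proof (rule Bochner_Integration.integral_cong[OF HOL.refl])
      fix x
      have "continuous_on UNIV (\<lambda>y. chord x * \<psi> x y / slice x)"
        unfolding divide_inverse by (intro continuous_intros cont_section(1)[OF cont])
      thus "(LINT y|lborel. f2 x y * g2 x y) = - (LINT y|lborel. chord x * \<psi> x y / slice x * f x y)"
        by (intro ibp_line[OF deriv_f2 _ d2 cont_section(1)[OF c2], where L=L]) (auto simp: s)
    qed
    also have "\<dots> = - (LINT x|lborel. LINT y|lborel. chord x * \<psi> x y / slice x * f x y)" by simp
    also have "(LINT x|lborel. LINT y|lborel. chord x * \<psi> x y / slice x * f x y) = (LINT z|?P. chord (fst z) * \<psi> (fst z) (snd z) / slice (fst z) * f (fst z) (snd z))"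
      using lborel_pair.integral_fst[of "\<lambda>x y. chord x * \<psi> x y / slice x * f x y"] k2 by (simp add: case_prod_beta')
    finally show ?thesis .
  qed
  let ?n = "\<lambda>z. sqrt ((g1 (fst z) (snd z))\<^sup>2 + (g2 (fst z) (snd z))\<^sup>2)"
  have iN: "integrable ?P ?n"
    by (rule integrable_cont_supp2[where L=L]) (auto intro!: continuous_intros c1 c2 simp: s)
  \<comment> \<open>Cauchy-Schwarz for the field and the gradient, through Lagrange's
    identity.\<close>
  have pt: "- (a * u + b * v) \<le> R * sqrt (u\<^sup>2 + v\<^sup>2)" if "a\<^sup>2 + b\<^sup>2 \<le> R\<^sup>2" for a b u v :: real
  proof -
    have "(a * u + b * v)\<^sup>2 + (a * v - b * u)\<^sup>2 = (a\<^sup>2 + b\<^sup>2) * (u\<^sup>2 + v\<^sup>2)" by (simp add: algebra_simps power2_eq_square)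
    hence "(- (a * u + b * v))\<^sup>2 \<le> (a\<^sup>2 + b\<^sup>2) * (u\<^sup>2 + v\<^sup>2)" by (smt (verit) power2_minus zero_le_power2)
    also have "\<dots> \<le> R\<^sup>2 * (u\<^sup>2 + v\<^sup>2)" using that by (intro mult_right_mono) auto
    finally have "- (a * u + b * v) \<le> sqrt (R\<^sup>2 * (u\<^sup>2 + v\<^sup>2))" by (rule real_le_rsqrt)
    thus ?thesis using R by (simp add: real_sqrt_mult)
  qed
  have "(LINT z|?P. f (fst z) (snd z) * dv (fst z) (snd z)) =
     (LINT z|?P. - (f1 (fst z) * g1 (fst z) (snd z) + f2 (fst z) (snd z) * g2 (fst z) (snd z)))"
    unfolding sum Bochner_Integration.integral_add[OF k1 k2] Bochner_Integration.integral_minus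
      Bochner_Integration.integral_add[OF j1 j2] e1 e2 by simp
  also have "\<dots> \<le> (LINT z|?P. R * ?n z)"
    by (rule integral_mono) (use j1 j2 iN pt field_bound in auto)
  finally show "(LINT z|?P. f (fst z) (snd z) * dv (fst z) (snd z)) \<le> R * (LINT z|?P. ?n z)" by (simp only: Bochner_Integration.integral_mult_right_zero)
qed

text \<open>\<open>ev\<close> is at most \<open>dv\<close>, and \<open>dv\<close> is nonnegative, so
  \<open>f\<close> may replace the indicator of any set on which it is at least 1. The set
  \<open>V\<close> is not tied to the support of \<psi>: one fixed field can test all sets that
  nearly fill a domain.\<close>

lemma calibration_set:
  assumes f: "C1_box L f g1 g2" and f0: "\<And>x y. f x y \<ge> 0" and \<psi>1: "\<And>x y. \<psi> x y \<le> 1"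
    and V: "V \<in> sets plane" and fV: "\<And>x y. (x, y) \<in> V \<Longrightarrow> f x y \<ge> 1"
  shows "(LINT z|plane. indicator V z * ev (fst z) (snd z))
         \<le> R * (LINT z|plane. sqrt ((g1 (fst z) (snd z))\<^sup>2 + (g2 (fst z) (snd z))\<^sup>2))"
proof -
  have dv0: "dv x y \<ge> 0" for x y using chord_pos[of x] slice_nonneg[of x] nonneg[of x y] by (simp add: dv_def)
  have "ev x y \<le> dv x y" for x y
  proof -
    have "\<psi> x y * (slice x / chord x) \<le> 1 * (slice x / chord x)"
      using \<psi>1[of x y] chord_pos[of x] slice_nonneg[of x] by (intro mult_right_mono) auto
    thus ?thesis by (simp add: ev_def dv_def algebra_simps)
  qed
  hence pt: "indicator V (x, y) * ev x y \<le> f x y * dv x y" for x y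
    using fV[of x y] f0[of x y] dv0[of x y] mult_right_mono[of 1 "f x y" "dv x y"]
    by (auto simp: indicator_def intro: order_trans)
  have "(LINT z|plane. indicator V z * ev (fst z) (snd z)) \<le> (LINT z|plane. f (fst z) (snd z) * dv (fst z) (snd z))"
    by (rule integral_mono)
       (use calibration(1)[OF f] pt integrable_mult_indicator[OF V int_ev] in auto)
  also note calibration(2)[OF f]
  finally show ?thesis .
qed

end

section \<open>The limit of the Knothe fields of an open set\<close>

text \<open>The factor \<open>1 - 1/(n+2)\<close> keeps the mass strictly below that of \<open>W\<close>, as the locale \<open>knothe\<close> with \<open>R = 1\<close>
  requires.\<close>

definition inner_cut :: "(real \<times> real) set \<Rightarrow> nat \<Rightarrow> real \<Rightarrow> real \<Rightarrow> real" where
  "inner_cut W n x y = (1 - 1 / real (n + 2)) * min 1 (real n * infdist (x, y) (- W))"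

lemma tendsto_inner_cut:
  assumes "open W" "W \<noteq> UNIV"
  shows "(\<lambda>n. inner_cut W n x y) \<longlonglongrightarrow> indicator W (x, y)"
proof -
  have 1: "(\<lambda>n. 1 - 1 / real (n + 2)) \<longlonglongrightarrow> 1 - 0"
    by (intro tendsto_intros LIMSEQ_ignore_initial_segment[OF lim_1_over_n, of 2])
  have 2: "(\<lambda>n. min 1 (real n * infdist (x, y) (- W))) \<longlonglongrightarrow> indicator W (x, y)"
  proof (cases "(x,y) \<in> W")
    case True
    have d: "infdist (x, y) (- W) > 0"
    proof -
      have "closed (-W)" "-W \<noteq> {}" using assms by auto
      thus ?thesis using True infdist_pos_not_in_closed[of "-W" "(x,y)"] by auto
    qed
    obtain N where N: "real N * infdist (x, y) (- W) > 1" using d reals_Archimedean3 by blast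
    have "\<forall>n\<ge>N. min 1 (real n * infdist (x, y) (- W)) = 1"
    proof safe
      fix n assume "n \<ge> N"
      hence "real N * infdist (x, y) (- W) \<le> real n * infdist (x, y) (- W)" using d by (intro mult_right_mono) auto
      thus "min 1 (real n * infdist (x, y) (- W)) = 1" using N by simp
    qed
    hence "eventually (\<lambda>n. min 1 (real n * infdist (x, y) (- W)) = indicator W (x, y)) sequentially"
      using True unfolding eventually_sequentially by auto
    thus ?thesis by (rule tendsto_eventually)
  next
    case False thus ?thesis by simp
  qed
  from tendsto_mult[OF 1 2] show ?thesis unfolding inner_cut_def by simp
qed

lemma inner_cut_bounds:
  "0 \<le> inner_cut W n x y" "inner_cut W n x y \<le> 1" "(x, y) \<notin> W \<Longrightarrow> inner_cut W n x y = 0"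
  "inner_cut W n x y \<le> (1 - 1 / real (n + 2)) * indicator W (x, y)"
proof -
  show "0 \<le> inner_cut W n x y" unfolding inner_cut_def by (intro mult_nonneg_nonneg) (auto simp: infdist_nonneg)
  have a: "min 1 (real n * infdist (x, y) (- W)) \<le> 1" by simp
  show "inner_cut W n x y \<le> 1" unfolding inner_cut_def
    by (rule order_trans[OF mult_left_mono[OF a]]) auto
  show z: "(x, y) \<notin> W \<Longrightarrow> inner_cut W n x y = 0" by (simp add: inner_cut_def)
  show "inner_cut W n x y \<le> (1 - 1 / real (n + 2)) * indicator W (x, y)"
    by (cases "(x,y) \<in> W") (use z a in \<open>auto simp: inner_cut_def intro!: mult_left_mono\<close>)
qed

lemma inner_cut_continuous: "continuous_on UNIV (\<lambda>z. inner_cut W n (fst z) (snd z))"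
  unfolding inner_cut_def by (auto intro!: continuous_intros)

text \<open>The disc of radius 1 has the same area as \<open>W\<close>, so no surplus remains in the
  limit and the chords may shrink to 0 at both ends. Slices and chords are therefore passed to the
  limit separately, and no limit field is formed.\<close>

locale knothe_limit =
  fixes W :: "(real \<times> real) set" and L :: real
  assumes W: "open W" "connected W" and WL: "\<And>x y. (x, y) \<in> W \<Longrightarrow> \<bar>x\<bar> < L \<and> \<bar>y\<bar> < L"
    and Wpi: "measure plane W = pi"
begin

lemma W_sets [measurable]: "W \<in> sets plane" "W \<in> sets (borel \<Otimes>\<^sub>M borel)"
proof -
  show "W \<in> sets plane" unfolding lborel_prod using W(1) by simp
  show "W \<in> sets (borel \<Otimes>\<^sub>M borel)" unfolding borel_prod using W(1) by simp
qed

lemma W_ne: "W \<noteq> {}" using Wpi by auto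
lemma WL_D: "\<bar>x\<bar> \<ge> L \<or> \<bar>y\<bar> \<ge> L \<Longrightarrow> (x, y) \<notin> W"
  using WL[of x y] by linarith

lemma W_nu: "W \<noteq> UNIV" using WL_D[OF disjI1[OF abs_ge_self], of 0] by auto
lemma L0: "L > 0"
proof -
  obtain x y where "(x, y) \<in> W" using W_ne by (metis ex_in_conv surj_pair)
  from WL[OF this] show ?thesis by linarith
qed

lemma W_fin: "emeasure plane W < \<infinity>"
  using Wpi by (cases "emeasure plane W = \<infinity>") (auto simp: measure_def top.not_eq_extremum)

lemma int_W: "integrable plane (indicator W :: _ \<Rightarrow> real)"
  using W_fin by (intro integrable_real_indicator) auto

lemma cut_int: "integrable plane (\<lambda>z. inner_cut W n (fst z) (snd z))"
  by (rule integrable_cont_supp2[OF inner_cut_continuous, where L=L])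
     (intro inner_cut_bounds(3) WL_D)

lemma cut_total_lt: "(LINT z|plane. inner_cut W n (fst z) (snd z)) < pi * 1\<^sup>2"
proof -
  have "(LINT z|plane. inner_cut W n (fst z) (snd z)) \<le> (LINT z|plane. (1 - 1 / real (n + 2)) * indicator W z)"
  proof (rule integral_mono[OF cut_int])
    show "integrable plane (\<lambda>z. (1 - 1 / real (n + 2)) * indicator W z)"
      by (rule integrable_mult_right) (rule int_W)
    show "inner_cut W n (fst z) (snd z) \<le> (1 - 1 / real (n + 2)) * indicator W z" for z
      using inner_cut_bounds(4)[of W n "fst z" "snd z"] by simp
  qed
  also have "\<dots> = (1 - 1 / real (n + 2)) * pi" using Wpi by simp
  also have "\<dots> < 1 * pi" by (intro mult_strict_right_mono) auto
  finally show ?thesis by simp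
qed

lemma knothe_cut: "knothe (inner_cut W n) L 1"
proof
  show "inner_cut W n x y = 0" if "L \<le> \<bar>x\<bar> \<or> L \<le> \<bar>y\<bar>" for x y
    using that by (intro inner_cut_bounds(3) WL_D)
qed (use inner_cut_continuous inner_cut_bounds(1) cut_total_lt in auto)

section \<open>Convergence of slices, masses and chords\<close>

definition sec :: "real \<Rightarrow> real" where "sec x = (LINT y|lborel. indicator W (x, y))"

lemma ind_le: "(indicator W (x, y) :: real) \<le> indicator {-L..L} y"
  using WL[of x y] by (cases "(x, y) \<in> W") (auto simp: abs_less_iff indicator_def)

lemma int_LL: "integrable lborel (indicator {-L..L} :: real \<Rightarrow> real)"
  by (intro integrable_real_indicator) (auto simp: emeasure_lborel_Icc_eq)

lemma meas_ind: "(\<lambda>y. indicator W (x, y) :: real) \<in> borel_measurable borel"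
proof -
  have "open (Pair x -` W)" by (rule open_vimage[OF W(1)]) (intro continuous_intros)
  hence "(indicator (Pair x -` W) :: _ \<Rightarrow> real) \<in> borel_measurable borel" by (intro borel_measurable_indicator) simp
  thus ?thesis by (simp add: indicator_def vimage_def)
qed

lemma sec_bounds: "0 \<le> sec x" "sec x \<le> 2 * L" "\<bar>x\<bar> \<ge> L \<Longrightarrow> sec x = 0"
proof -
  show "0 \<le> sec x" by (simp add: sec_def)
  have "sec x \<le> (LINT y|lborel. indicator {-L..L} y)" unfolding sec_def
    by (rule integral_mono_AE'[OF int_LL]) (auto intro!: AE_I2 ind_le)
  thus "sec x \<le> 2 * L" using L0 by simp
  show "\<bar>x\<bar> \<ge> L \<Longrightarrow> sec x = 0" unfolding sec_def using WL_D[of x] by simp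
qed

lemma sec_int: "integrable lborel sec"
  using lborel_pair.integrable_fst[of "\<lambda>x y. indicator W (x,y) :: real"] int_W by (simp add: sec_def[abs_def] case_prod_beta')

lemma sec_meas [measurable]: "sec \<in> borel_measurable borel"
  using borel_measurable_integrable[OF sec_int] by simp

lemma sec_total: "(LINT x|lborel. sec x) = pi"
  using lborel_pair.integral_fst[of "\<lambda>x y. indicator W (x,y) :: real"] int_W Wpi by (simp add: sec_def case_prod_beta')

lemma slice_eq: "knothe.slice (inner_cut W n) x = (LINT y|lborel. inner_cut W n x y)"
  by (rule knothe.slice_def[OF knothe_cut])

lemma cut_le: "inner_cut W n x y \<le> indicator {-L..L} y"
proof (cases "(x, y) \<in> W")
  case True
  have "inner_cut W n x y \<le> 1" by (rule inner_cut_bounds(2))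
  thus ?thesis using WL[OF True] by (simp add: indicator_def abs_less_iff)
next
  case False
  show ?thesis unfolding inner_cut_bounds(3)[OF False] by simp
qed

lemma slice_lim: "(\<lambda>n. knothe.slice (inner_cut W n) x) \<longlonglongrightarrow> sec x"
  unfolding slice_eq sec_def
proof (rule integral_dominated_convergence[where w="indicator {-L..L}"])
  show "integrable lborel (indicator {-L..L} :: real \<Rightarrow> real)" by (rule int_LL)
  show "AE y in lborel. (\<lambda>n. inner_cut W n x y) \<longlonglongrightarrow> indicator W (x, y)"
    by (rule AE_I2) (rule tendsto_inner_cut[OF W(1) W_nu])
  show "AE y in lborel. norm (inner_cut W n x y) \<le> indicator {-L..L} y" for n
  proof (rule AE_I2)
    fix y show "norm (inner_cut W n x y) \<le> indicator {-L..L} y"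
      unfolding real_norm_def abs_of_nonneg[OF inner_cut_bounds(1)] by (rule cut_le)
  qed
  show "inner_cut W n x \<in> borel_measurable lborel" for n
    using borel_measurable_continuous_onI[OF cont_section(1)[OF inner_cut_continuous]] by simp
  show "(\<lambda>y. indicator W (x, y) :: real) \<in> borel_measurable lborel" using meas_ind by simp
qed

lemma slice_le: "knothe.slice (inner_cut W n) x \<le> 2 * L * indicator {-L..L} x"
proof -
  have "knothe.slice (inner_cut W n) x \<le> (LINT y|lborel. indicator {-L..L} y)" unfolding slice_eq
    by (rule integral_mono[OF knothe.int_psi_x[OF knothe_cut] int_LL cut_le])
  hence "knothe.slice (inner_cut W n) x \<le> 2 * L" using L0 by simp
  thus ?thesis using knothe.slice_supp[OF knothe_cut, of x n] by (cases "\<bar>x\<bar> \<ge> L") (auto simp: indicator_def)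
qed

lemma prim_slice_lim: "(\<lambda>n. prim (knothe.slice (inner_cut W n)) x) \<longlonglongrightarrow> prim sec x"
  unfolding prim_def
proof (rule integral_dominated_convergence[where w="\<lambda>x. 2 * L * indicator {-L..L} x"])
  show "integrable lborel (\<lambda>x. 2 * L * indicator {-L..L} x :: real)"
    by (intro integrable_mult_right integrable_real_indicator) (auto simp: emeasure_lborel_Icc_eq)
  show "AE t in lborel. (\<lambda>n. indicator {..x} t * knothe.slice (inner_cut W n) t) \<longlonglongrightarrow> indicator {..x} t * sec t"
    by (intro AE_I2 tendsto_intros slice_lim)
  show "AE t in lborel. norm (indicator {..x} t * knothe.slice (inner_cut W n) t) \<le> 2 * L * indicator {-L..L} t" for n
  proof (rule AE_I2)
    fix t show "norm (indicator {..x} t * knothe.slice (inner_cut W n) t) \<le> 2 * L * indicator {-L..L} t"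
      using slice_le[of n t] knothe.slice_nonneg[OF knothe_cut, of n t] L0 by (auto simp: indicator_def split: if_splits)
  qed
  show "(\<lambda>t. indicator {..x} t * knothe.slice (inner_cut W n) t) \<in> borel_measurable lborel" for n
    using knothe.meas_slice[OF knothe_cut, of n] by measurable
qed measurable

lemma total_lim: "(\<lambda>n. knothe.total (inner_cut W n)) \<longlonglongrightarrow> pi"
proof -
  have "(\<lambda>n. LINT z|plane. inner_cut W n (fst z) (snd z)) \<longlonglongrightarrow> (LINT z|plane. indicator W z)"
  proof (rule integral_dominated_convergence[where w="indicator W"])
    show "integrable plane (indicator W :: _ \<Rightarrow> real)" by (rule int_W)
    show "AE z in plane. (\<lambda>n. inner_cut W n (fst z) (snd z)) \<longlonglongrightarrow> indicator W z"
      using tendsto_inner_cut[OF W(1) W_nu, of "fst z" "snd z" for z] by (intro AE_I2) simp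
    show "AE z in plane. norm (inner_cut W n (fst z) (snd z)) \<le> indicator W z" for n
    proof (rule AE_I2)
      fix z :: "real \<times> real"
      have "inner_cut W n (fst z) (snd z) \<le> indicator W z"
        using inner_cut_bounds(2)[of W n "fst z" "snd z"] inner_cut_bounds(3)[of "fst z" "snd z" W n]
        by (cases "z \<in> W") simp_all
      thus "norm (inner_cut W n (fst z) (snd z)) \<le> indicator W z"
        unfolding real_norm_def abs_of_nonneg[OF inner_cut_bounds(1)] .
    qed
    show "(\<lambda>z. inner_cut W n (fst z) (snd z)) \<in> borel_measurable plane" for n
      by (rule borel_measurable_integrable[OF cut_int])
    show "(indicator W :: _ \<Rightarrow> real) \<in> borel_measurable plane"
      by (rule borel_measurable_integrable[OF int_W])
  qed
  thus ?thesis using Wpi by (simp add: knothe.total_eq[OF knothe_cut])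
qed

definition ang :: "real \<Rightarrow> real" where "ang x = segangle (prim sec x)"

lemma prim_sec_range: "prim sec x \<in> {0..pi}"
proof -
  have "0 \<le> prim sec x" unfolding prim_def by (intro integral_nonneg_AE) (auto simp: sec_bounds)
  moreover have "prim sec x \<le> (LINT x|lborel. sec x)" unfolding prim_def
    by (rule integral_mono_AE'[OF sec_int]) (auto simp: indicator_def sec_bounds)
  ultimately show ?thesis by (simp add: sec_total)
qed

lemma chord_lim: "(\<lambda>n. knothe.chord (inner_cut W n) 1 x) \<longlonglongrightarrow> 2 * sin (ang x)"
proof -
  let ?s = "\<lambda>n. prim (knothe.slice (inner_cut W n)) x / 1\<^sup>2 + (pi - knothe.total (inner_cut W n) / 1\<^sup>2) / 2"
  have "?s \<longlonglongrightarrow> prim sec x / 1\<^sup>2 + (pi - pi / 1\<^sup>2) / 2"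
    by (intro tendsto_intros prim_slice_lim total_lim) auto
  hence "?s \<longlonglongrightarrow> prim sec x" by simp
  moreover have "?s n \<in> {0..pi}" for n using knothe.arg_range[OF knothe_cut, of n x] by auto
  ultimately have "(\<lambda>n. segangle (?s n)) \<longlonglongrightarrow> segangle (prim sec x)"
    using continuous_on_segangle prim_sec_range unfolding continuous_on_sequentially by (auto simp: o_def)
  hence "(\<lambda>n. 2 * 1 * sin (segangle (?s n))) \<longlonglongrightarrow> 2 * 1 * sin (ang x)"
    unfolding ang_def by (intro tendsto_intros)
  thus ?thesis by (simp add: knothe.chord_def[OF knothe_cut] knothe.angle_def[OF knothe_cut])
qed

lemma proj_interval: obtains A B where "fst ` W = {A<..<B}" "A < B"
proof -
  let ?S = "fst ` W"
  have o: "open ?S" using W(1) by (rule open_image_fst)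
  have c: "connected ?S" by (rule connected_continuous_image[OF _ W(2)]) (intro continuous_intros)
  have ne: "?S \<noteq> {}" using W_ne by simp
  have bd: "\<And>x. x \<in> ?S \<Longrightarrow> \<bar>x\<bar> < L" using WL by fastforce
  have b: "bdd_below ?S" "bdd_above ?S" using bd by (auto intro!: bdd_belowI[of _ "-L"] bdd_aboveI[of _ L] simp: abs_less_iff less_imp_le) fastforce+
  have "?S = {Inf ?S<..<Sup ?S}"
  proof safe
    fix a b assume ab: "(a, b) \<in> W"
    have "a \<in> ?S" using ab by force
    then obtain e where e: "e > 0" "ball a e \<subseteq> ?S" using o by (meson openE)
    have "a - e/2 \<in> ?S" "a + e/2 \<in> ?S" using e by (auto simp: subset_iff dist_real_def)
    hence "Inf ?S \<le> a - e/2" "a + e/2 \<le> Sup ?S" using b by (auto intro: cInf_lower cSup_upper)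
    thus "fst (a, b) \<in> {Inf ?S<..<Sup ?S}" using e by simp
  next
    fix x assume x: "x \<in> {Inf ?S<..<Sup ?S}"
    obtain p where p: "p \<in> ?S" "p < x" using x cInf_less_iff[OF ne b(1), of x] by auto
    obtain q where q: "q \<in> ?S" "x < q" using x less_cSup_iff[OF ne b(2), of x] by auto
    show "x \<in> ?S" using connectedD_interval[OF c p(1) q(1), of x] p q by auto
  qed
  moreover have "Inf ?S < Sup ?S"
  proof (rule ccontr)
    assume "\<not> Inf ?S < Sup ?S"
    hence "{Inf ?S<..<Sup ?S} = {}" by simp
    thus False using calculation ne by simp
  qed
  ultimately show ?thesis using that by blast
qed

lemma sec_pos: "x \<in> fst ` W \<Longrightarrow> sec x > 0"
proof -
  assume "x \<in> fst ` W"
  then obtain y where "(x, y) \<in> W" by auto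
  then obtain e where e: "e > 0" "ball (x, y) e \<subseteq> W" using W(1) by (meson openE)
  have i: "integrable lborel (\<lambda>y. indicator W (x, y) :: real)"
  proof (rule Bochner_Integration.integrable_bound[of _ "indicator {-L..L} :: real \<Rightarrow> real"])
    show "integrable lborel (indicator {-L..L} :: real \<Rightarrow> real)" by (rule int_LL)
    show "AE y in lborel. norm (indicator W (x, y) :: real) \<le> norm (indicator {-L..L} y :: real)"
      using ind_le by (intro AE_I2) simp
  qed (simp add: meas_ind)
  have "(LINT t|lborel. indicator {y-e/2..y+e/2} t) \<le> sec x" unfolding sec_def
  proof (rule integral_mono_AE'[OF i])
    show "AE t in lborel. indicator {y-e/2..y+e/2} t \<le> (indicator W (x, t) :: real)"
    proof (rule AE_I2)
      fix t
      have "(x, t) \<in> W" if "t \<in> {y-e/2..y+e/2}"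
      proof -
        have "(x, t) \<in> ball (x, y) e" using that e by (auto simp: dist_Pair_Pair dist_real_def)
        thus ?thesis using e by blast
      qed
      thus "indicator {y-e/2..y+e/2} t \<le> (indicator W (x, t) :: real)" by (auto simp: indicator_def)
    qed
  qed auto
  thus "sec x > 0" using e by simp
qed

abbreviation s\<^sub>n where "s\<^sub>n n x \<equiv> knothe.slice (inner_cut W n) x"
abbreviation h\<^sub>n where "h\<^sub>n n x \<equiv> knothe.chord (inner_cut W n) 1 x"

text \<open>The remainder of \<open>integral_ev\<close>, made smaller by replacing the chord in the
  denominator with its upper bound 2. Chords may tend to 0, whereas this expression has a limit at
  every point with a slice of positive length.\<close>

definition defect :: "nat \<Rightarrow> real \<Rightarrow> real" where
  "defect n x = (if s\<^sub>n n x = 0 then 0 else (s\<^sub>n n x - h\<^sub>n n x)\<^sup>2 / 2)"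

lemma defect_meas [measurable]: "defect n \<in> borel_measurable borel"
  unfolding defect_def using knothe.meas_slice[OF knothe_cut, of n] knothe.meas_chord[OF knothe_cut, of n] by measurable

lemma defect_lim: assumes "sec x > 0" shows "(\<lambda>n. defect n x) \<longlonglongrightarrow> (sec x - 2 * sin (ang x))\<^sup>2 / 2"
proof -
  have "(\<lambda>n. (s\<^sub>n n x - h\<^sub>n n x)\<^sup>2 / 2) \<longlonglongrightarrow> (sec x - 2 * sin (ang x))\<^sup>2 / 2"
    by (intro tendsto_intros slice_lim chord_lim) auto
  moreover have "eventually (\<lambda>n. s\<^sub>n n x > 0) sequentially"
    using order_tendstoD(1)[OF slice_lim assms] .
  hence "eventually (\<lambda>n. (s\<^sub>n n x - h\<^sub>n n x)\<^sup>2 / 2 = defect n x) sequentially"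
    by eventually_elim (simp add: defect_def)
  ultimately show ?thesis by (rule Lim_transform_eventually)
qed

text \<open>By \<open>H\<close> and \<open>integral_ev\<close> the defects have integral at most
  \<open>2 * pi - 2 * total\<close>, which tends to 0. Fatou's lemma carries this to the limit of
  the defects.\<close>

lemma sec_eq_sin:
  assumes H: "\<And>n. (LINT z|plane. knothe.ev (inner_cut W n) 1 (fst z) (snd z)) \<le> 2 * pi"
  shows "AE x in lborel. sec x > 0 \<longrightarrow> sec x = 2 * sin (ang x)"
proof -
  define k where "k x = liminf (\<lambda>n. ennreal (defect n x))" for x
  have m [measurable]: "k \<in> borel_measurable lborel" unfolding k_def by measurable
  have b: "(\<integral>\<^sup>+ x. ennreal (defect n x) \<partial>lborel) \<le> ennreal (2 * pi - 2 * knothe.total (inner_cut W n))" for n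
  proof -
    let ?d = "\<lambda>x. (if s\<^sub>n n x = 0 then 0 else (s\<^sub>n n x - h\<^sub>n n x)\<^sup>2 / h\<^sub>n n x)"
    have d0: "?d x \<ge> 0" for x using knothe.chord_pos[OF knothe_cut, of n x] by simp
    have "(\<integral>\<^sup>+ x. ennreal (defect n x) \<partial>lborel) \<le> (\<integral>\<^sup>+ x. ennreal (?d x) \<partial>lborel)"
    proof (intro nn_integral_mono ennreal_leI)
      fix x show "defect n x \<le> ?d x"
        using knothe.chord_pos[OF knothe_cut, of n x] knothe.chord_le[OF knothe_cut, of n x]
          divide_left_mono[of "h\<^sub>n n x" 2 "(s\<^sub>n n x - h\<^sub>n n x)\<^sup>2"]
        by (simp add: defect_def)
    qed
    also have "\<dots> = ennreal (LINT x|lborel. ?d x)"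
      by (rule nn_integral_eq_integral[OF knothe.integral_ev(2)[OF knothe_cut]]) (use d0 in simp)
    also have "\<dots> \<le> ennreal (2 * pi - 2 * knothe.total (inner_cut W n))"
      using H[of n] knothe.integral_ev(1)[OF knothe_cut, of n] by (intro ennreal_leI) simp
    finally show ?thesis .
  qed
  have "(\<lambda>n. ennreal (2 * pi - 2 * knothe.total (inner_cut W n))) \<longlonglongrightarrow> ennreal (2 * pi - 2 * pi)"
    by (intro tendsto_ennrealI tendsto_intros total_lim)
  hence l0: "liminf (\<lambda>n. ennreal (2 * pi - 2 * knothe.total (inner_cut W n))) = 0"
    using lim_imp_Liminf[OF sequentially_bot] by fastforce
  have "(\<integral>\<^sup>+ x. k x \<partial>lborel) \<le> liminf (\<lambda>n. \<integral>\<^sup>+ x. ennreal (defect n x) \<partial>lborel)"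
    unfolding k_def by (rule nn_integral_liminf) measurable
  also have "\<dots> \<le> 0" unfolding l0[symmetric] by (intro Liminf_mono always_eventually allI b)
  finally have "(\<integral>\<^sup>+ x. k x \<partial>lborel) = 0" by simp
  hence "AE x in lborel. k x = 0" by (subst (asm) nn_integral_0_iff_AE) auto
  thus ?thesis
  proof eventually_elim
    case (elim x)
    show ?case
    proof
      assume "sec x > 0"
      hence "(\<lambda>n. ennreal (defect n x)) \<longlonglongrightarrow> ennreal ((sec x - 2 * sin (ang x))\<^sup>2 / 2)"
        by (intro tendsto_ennrealI defect_lim)
      hence "k x = ennreal ((sec x - 2 * sin (ang x))\<^sup>2 / 2)"
        unfolding k_def by (intro lim_imp_Liminf) auto
      hence "(sec x - 2 * sin (ang x))\<^sup>2 \<le> 0" using elim by (simp add: ennreal_eq_0_iff)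
      thus "sec x = 2 * sin (ang x)" by simp
    qed
  qed
qed

lemma prim_sec_cont: "continuous_on UNIV (prim sec)"
proof -
  have *: "\<bar>prim sec y - prim sec x\<bar> \<le> 2 * L * (y - x)" if "x \<le> y" for x y
  proof -
    have i: "integrable lborel (\<lambda>t. indicator {..z} t * sec t)" for z
      using integrable_mult_indicator[OF _ sec_int, of "{..z}"] by simp
    have "prim sec y - prim sec x = (LINT t|lborel. indicator {..y} t * sec t - indicator {..x} t * sec t)"
      unfolding prim_def using i by simp
    also have "\<dots> = (LINT t|lborel. indicator {x<..y} t * sec t)"
      using that by (intro Bochner_Integration.integral_cong) (auto simp: indicator_def)
    finally have e: "prim sec y - prim sec x = (LINT t|lborel. indicator {x<..y} t * sec t)" .
    have i2: "integrable lborel (\<lambda>t. 2 * L * indicator {x<..y} t :: real)"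
      using that by (intro integrable_mult_right integrable_real_indicator) auto
    have "(LINT t|lborel. indicator {x<..y} t * sec t) \<le> (LINT t|lborel. 2 * L * indicator {x<..y} t)"
      using L0 by (intro integral_mono_AE'[OF i2]) (auto simp: indicator_def sec_bounds)
    moreover have "0 \<le> (LINT t|lborel. indicator {x<..y} t * sec t)" by (intro integral_nonneg_AE) (auto simp: sec_bounds)
    ultimately show ?thesis using that unfolding e by simp
  qed
  have "dist (prim sec y) (prim sec x) \<le> 2 * L * dist y x" for x y
    using *[of x y] *[of y x] by (cases "x \<le> y") (simp_all add: dist_real_def abs_minus_commute)
  hence "(2 * L)-lipschitz_on UNIV (prim sec)" using L0 by (intro lipschitz_onI) auto
  thus ?thesis by (rule lipschitz_on_continuous_on)
qed

lemma ang_cont: "continuous_on UNIV ang"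
  unfolding ang_def by (rule continuous_on_compose2[OF continuous_on_segangle prim_sec_cont]) (use prim_sec_range in auto)

text \<open>Connectedness of \<open>W\<close> is essential here: two half discs separated by a vertical strip have the
  slices of a disc, up to the gap.\<close>

lemma sec_disc:
  assumes H: "\<And>n. (LINT z|plane. knothe.ev (inner_cut W n) 1 (fst z) (snd z)) \<le> 2 * pi"
  obtains c where "AE x in lborel. sec x = (if \<bar>x - c\<bar> < 1 then 2 * sqrt (1 - (x - c)\<^sup>2) else 0)"
proof -
  obtain A B where AB: "fst ` W = {A<..<B}" "A < B" by (rule proj_interval)
  have out: "sec x = 0" if "x \<notin> {A<..<B}" for x
  proof -
    have "(x, y) \<notin> W" for y using that AB(1) by force
    thus ?thesis by (simp add: sec_def)
  qed
  have ae: "AE x in lborel. sec x = indicator {A<..<B} x * (2 * sin (ang x))"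
    using sec_eq_sin[OF H]
  proof eventually_elim
    case (elim x)
    thus ?case using out[of x] sec_pos[of x] AB by (auto simp: indicator_def)
  qed
  have ch: "continuous_on S (\<lambda>x. 2 * sin (ang x))" for S
    by (intro continuous_intros continuous_on_subset[OF ang_cont]) auto
  have prim_eq: "prim sec x = integral {A..x} (\<lambda>x. 2 * sin (ang x))" if "x \<in> {A..B}" for x
  proof -
    have "prim sec x = (LINT t:{A..x}|lborel. 2 * sin (ang t))"
      unfolding prim_def set_lebesgue_integral_def
    proof (rule integral_cong_AE)
      have "AE t in lborel. t \<noteq> A" "AE t in lborel. t \<noteq> B" by (rule AE_lborel_singleton)+
      with ae show "AE t in lborel. indicator {..x} t * sec t = indicator {A..x} t *\<^sub>R (2 * sin (ang t))"
        by eventually_elim (use that in \<open>auto simp: indicator_def\<close>)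
      show "(\<lambda>t. indicator {A..x} t *\<^sub>R (2 * sin (ang t))) \<in> borel_measurable lborel"
        using borel_measurable_continuous_onI[OF ch] by measurable
    qed measurable
    also have "\<dots> = integral {A..x} (\<lambda>x. 2 * sin (ang x))"
      by (rule set_borel_integral_eq_integral(2)[OF borel_integrable_atLeastAtMost'[OF ch]])
    finally show ?thesis .
  qed
  have PA: "prim sec A = 0" using prim_eq[of A] AB by simp
  have PB: "prim sec B = pi"
  proof -
    have "prim sec B = (LINT x|lborel. sec x)" unfolding prim_def
      by (rule Bochner_Integration.integral_cong) (auto simp: indicator_def out)
    thus ?thesis by (simp add: sec_total)
  qed
  have dP: "(prim sec has_real_derivative 2 * sin (ang x)) (at x)" if "x \<in> {A<..<B}" for x
  proof -
    have "((\<lambda>t. integral {A..t} (\<lambda>x. 2 * sin (ang x))) has_real_derivative 2 * sin (ang x)) (at x within {A..B})"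
      using that by (intro integral_has_real_derivative ch) auto
    hence "(prim sec has_real_derivative 2 * sin (ang x)) (at x within {A..B})"
      by (rule has_field_derivative_transform_within[where d=1]) (use that prim_eq in auto)
    thus ?thesis using that by (simp add: at_within_Icc_at)
  qed
  have sin0: "sin (ang x) \<ge> 0" for x
    unfolding ang_def using segangle_range[OF prim_sec_range] by (intro sin_ge_zero) auto
  \<comment> \<open>Strict monotonicity keeps \<open>prim sec\<close> off 0 and \<pi> inside the
    interval, where \<open>segangle\<close> is differentiable. It holds because every slice over the
    projection of \<open>W\<close> has positive length.\<close>
  have mono: "prim sec x < prim sec y" if "A \<le> x" "x < y" "y \<le> B" for x y
  proof (rule ccontr)
    assume n: "\<not> prim sec x < prim sec y"
    have i: "integrable lborel (\<lambda>t. indicator {x<..<y} t * sec t)"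
      using integrable_mult_indicator[OF _ sec_int, of "{x<..<y}"] by simp
    have iz: "integrable lborel (\<lambda>t. indicator {..z} t * sec t)" for z
      using integrable_mult_indicator[OF _ sec_int, of "{..z}"] by simp
    have "(LINT t|lborel. indicator {x<..<y} t * sec t) \<le> (LINT t|lborel. indicator {..y} t * sec t - indicator {..x} t * sec t)"
      using that by (intro integral_mono i Bochner_Integration.integrable_diff iz) (auto simp: indicator_def sec_bounds)
    also have "\<dots> = prim sec y - prim sec x" unfolding prim_def using iz by simp
    also have "\<dots> \<le> 0" using n by simp
    finally have "(LINT t|lborel. indicator {x<..<y} t * sec t) = 0"
      by (intro antisym integral_nonneg_AE) (auto simp: sec_bounds)
    hence "AE t in lborel. indicator {x<..<y} t * sec t = 0"
      by (subst (asm) integral_nonneg_eq_0_iff_AE[OF i]) (auto simp: sec_bounds)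
    hence "AE t in lborel. t \<notin> {x<..<y}"
    proof eventually_elim
      case (elim t)
      thus ?case using sec_pos[of t] AB that by (auto simp: indicator_def)
    qed
    moreover have "{t \<in> space lborel. \<not> t \<notin> {x<..<y}} = {x<..<y}" by auto
    ultimately have "emeasure lborel {x<..<y} = 0" using AE_iff_measurable[of "{x<..<y}" lborel "\<lambda>t. t \<notin> {x<..<y}"] by simp
    thus False using that by simp
  qed
  \<comment> \<open>The abscissa of the chord in the unit disc. The equation for
    \<open>prim sec\<close> and the derivative of \<open>segangle\<close> combine to
    \<open>a' = 1\<close>, so the chords sweep the disc at unit speed. As \<open>a\<close> runs from
    -1 at \<open>A\<close> to 1 at \<open>B\<close>, the centre must be
    \<open>A + 1\<close>.\<close>
  define a where "a x = - cos (ang x)" for x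
  have da: "(a has_real_derivative 1) (at x)" if "x \<in> {A<..<B}" for x
  proof -
    have r: "prim sec x \<in> {0<..<pi}" using mono[of A x] mono[of x B] that PA PB by auto
    have sp: "sin (ang x) > 0" unfolding ang_def using segangle_range_open[OF r] by (intro sin_gt_zero) auto
    have "(ang has_real_derivative 1 / (2 * (sin (ang x))\<^sup>2) * (2 * sin (ang x))) (at x)"
      using DERIV_chain2[OF has_real_derivative_segangle[OF r] dP[OF that]] unfolding ang_def .
    from DERIV_minus[OF DERIV_chain2[OF DERIV_cos this]]
    have "(a has_real_derivative (sin (ang x) * (1 / (2 * (sin (ang x))\<^sup>2) * (2 * sin (ang x))))) (at x)"
      unfolding a_def by simp
    also have "sin (ang x) * (1 / (2 * (sin (ang x))\<^sup>2) * (2 * sin (ang x))) = 1"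
      using sp by (simp add: power2_eq_square)
    finally show ?thesis .
  qed
  have ca: "continuous_on S a" for S unfolding a_def by (intro continuous_intros continuous_on_subset[OF ang_cont]) auto
  have "a A = -1" unfolding a_def ang_def PA using segangle_segarea[of 0] by (simp add: segarea_def)
  have "a B = 1" unfolding a_def ang_def PB using segangle_segarea[of pi] by (simp add: segarea_def)
  define c where "c = A + 1"
  have ax: "a x = x - c" if x: "x \<in> {A..B}" for x
  proof -
    have "((\<lambda>x. a x - x) has_real_derivative 0) (at z)" if "A < z" "z < B" for z
      using DERIV_diff[OF da DERIV_ident] that by simp
    hence "a x - x = a A - A"
      using x AB by (intro DERIV_isconst2[of A B]) (auto intro!: continuous_intros ca)
    thus ?thesis by (simp add: \<open>a A = -1\<close> c_def)
  qed
  have B: "B = c + 1" using ax[of B] \<open>a B = 1\<close> AB by auto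
  have "AE x in lborel. sec x = (if \<bar>x - c\<bar> < 1 then 2 * sqrt (1 - (x - c)\<^sup>2) else 0)"
    using ae
  proof eventually_elim
    case (elim x)
    show ?case
    proof (cases "\<bar>x - c\<bar> < 1")
      case True
      hence x: "x \<in> {A<..<B}" using B by (auto simp: c_def abs_less_iff)
      have "sin (ang x) = sqrt (1 - (cos (ang x))\<^sup>2)"
        using sin0[of x] by (simp add: sin_squared_eq[symmetric])
      also have "cos (ang x) = - (x - c)" using ax[of x] x by (simp add: a_def)
      finally show ?thesis using True elim x by (simp add: power2_commute[of c x])
    next
      case False
      hence "x \<notin> {A<..<B}" using B by (auto simp: c_def abs_less_iff)
      thus ?thesis using False elim by simp
    qed
  qed
  thus ?thesis using that by blast
qed

end

section \<open>The isoperimetric inequality in the plane\<close>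

definition pt :: "real \<Rightarrow> real \<Rightarrow> R2" where "pt x y = (\<chi> i. if i = 1 then x else y)"

lemma pt_nth [simp]: "pt x y $ 1 = x" "pt x y $ 2 = y" by (auto simp: pt_def)

lemma pt_eta: "pt (v $ 1) (v $ 2) = v" by (simp add: vec_eq_iff forall_2)

lemma pt_add_axis: "pt x y + t *\<^sub>R axis 1 1 = pt (x + t) y" "pt x y + t *\<^sub>R axis 2 1 = pt x (y + t)"
  by (auto simp: vec_eq_iff forall_2 axis_def)

lemma norm_R2: "norm (v :: R2) = sqrt ((v $ 1)\<^sup>2 + (v $ 2)\<^sup>2)"
  by (simp add: norm_vec_def L2_set_def sum_2)

text \<open>The flag exchanges the two axes, so the construction with vertical slices also serves
  for horizontal ones.\<close>

definition pt_of :: "bool \<Rightarrow> real \<times> real \<Rightarrow> R2" where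
  "pt_of b z = (if b then pt (fst z) (snd z) else pt (snd z) (fst z))"

lemma continuous_on_pt [continuous_intros]:
  assumes "continuous_on S f" "continuous_on S g"
  shows "continuous_on S (\<lambda>x. pt (f x) (g x))"
  unfolding pt_def by (rule continuous_on_vec_lambda, rename_tac i, case_tac "i = 1") (auto simp: assms)

lemma continuous_on_pt_of: "continuous_on S (pt_of b)"
  unfolding pt_of_def by (cases b) (auto intro!: continuous_intros)

lemma pt_of_meas [measurable]: "pt_of b \<in> borel_measurable plane"
  unfolding lborel_prod using borel_measurable_continuous_onI[OF continuous_on_pt_of] by simp

lemma lborel_pt_of: "(lborel :: R2 measure) = distr plane borel (pt_of b)"
proof (rule lborel_eqI)
  fix l u :: R2 assume le: "\<And>i. i \<in> Basis \<Longrightarrow> l \<bullet> i \<le> u \<bullet> i"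
  have B: "(Basis :: R2 set) = {axis 1 1, axis 2 1}"
    unfolding Basis_vec_def by (auto simp: UNIV_2)
  have l12: "l $ 1 \<le> u $ 1" "l $ 2 \<le> u $ 2"
    using le[of "axis 1 1"] le[of "axis 2 1"] by (auto simp: B inner_axis)
  let ?A = "if b then {l$1<..<u$1} \<times> {l$2<..<u$2} else {l$2<..<u$2} \<times> {l$1<..<u$1}"
  have "pt_of b -` box l u \<inter> space plane = ?A"
    by (auto simp: pt_of_def box_def B inner_axis space_pair_measure)
  hence "emeasure (distr plane borel (pt_of b)) (box l u) = emeasure plane ?A"
    by (subst emeasure_distr[OF pt_of_meas]) auto
  also have "\<dots> = ennreal (u$1 - l$1) * ennreal (u$2 - l$2)"
    using l12 by (cases b) (auto simp: lborel.emeasure_pair_measure_Times mult.commute)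
  also have "\<dots> = ennreal (\<Prod>i\<in>Basis. (u - l) \<bullet> i)"
    using l12 by (simp add: B ennreal_mult inner_axis axis_eq_axis inner_diff_left)
  finally show "emeasure (distr plane borel (pt_of b)) (box l u) = ennreal (\<Prod>i\<in>Basis. (u - l) \<bullet> i)" .
qed simp

lemma integral_pt_of:
  fixes F :: "R2 \<Rightarrow> real"
  assumes "F \<in> borel_measurable borel"
  shows "(LINT v|lborel. F v) = (LINT z|plane. F (pt_of b z))"
  by (subst lborel_pt_of[of b], rule integral_distr) (use assms pt_of_meas in auto)

lemma integrable_pt_of:
  fixes F :: "R2 \<Rightarrow> real"
  assumes "F \<in> borel_measurable borel"
  shows "integrable lborel F \<longleftrightarrow> integrable plane (\<lambda>z. F (pt_of b z))"
  by (subst lborel_pt_of[of b], rule integrable_distr_eq) (use assms pt_of_meas in auto)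

lemma emeasure_pt_of:
  assumes "S \<in> sets borel"
  shows "emeasure lborel S = emeasure plane (pt_of b -` S)"
  by (subst lborel_pt_of[of b], subst emeasure_distr) (use assms pt_of_meas in \<open>auto simp: space_pair_measure\<close>)

definition C1c :: "(R2 \<Rightarrow> real) \<Rightarrow> (R2 \<Rightarrow> R2) \<Rightarrow> bool" where
  "C1c f p \<longleftrightarrow> (\<forall>x i. ((\<lambda>t. f (x + t *\<^sub>R axis i 1)) has_real_derivative p x $ i) (at 0)) \<and>
     continuous_on UNIV f \<and> continuous_on UNIV p \<and> (\<exists>K. compact K \<and> (\<forall>x. x \<notin> K \<longrightarrow> f x = 0 \<and> p x = 0))"

text \<open>A threshold for \<open>L\<close> rather than a single box: the function and the density
  of the Knothe field have to be placed in a common box later.\<close>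

lemma C1c_box:
  assumes "C1c f p"
  obtains L0 where "\<And>L b. L \<ge> L0 \<Longrightarrow> C1_box L (\<lambda>x y. f (pt_of b (x, y))) (\<lambda>x y. p (pt_of b (x, y)) $ (if b then 1 else 2)) (\<lambda>x y. p (pt_of b (x, y)) $ (if b then 2 else 1))"
proof -
  from assms have d: "\<And>x i. ((\<lambda>t. f (x + t *\<^sub>R axis i 1)) has_real_derivative p x $ i) (at 0)"
    and c: "continuous_on UNIV f" "continuous_on UNIV p" unfolding C1c_def by auto
  from assms obtain K where K: "compact K" "\<And>x. x \<notin> K \<Longrightarrow> f x = 0 \<and> p x = 0" unfolding C1c_def by auto
  obtain M where M: "\<And>x. x \<in> K \<Longrightarrow> norm x \<le> M" using compact_imp_bounded[OF K(1)] bounded_iff by blast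
  have shift: "((\<lambda>x. g x) has_real_derivative D) (at x)" if "((\<lambda>t. g (x + t)) has_real_derivative D) (at 0)" for g :: "real \<Rightarrow> real" and x D
    using that DERIV_shift[of g D 0 x] by (simp add: add.commute)
  have "C1_box L (\<lambda>x y. f (pt_of b (x, y))) (\<lambda>x y. p (pt_of b (x, y)) $ (if b then 1 else 2)) (\<lambda>x y. p (pt_of b (x, y)) $ (if b then 2 else 1))"
    if L: "L \<ge> \<bar>M\<bar> + 1" for L b
    unfolding C1_box_def
  proof (intro conjI allI impI)
    fix x y
    show "((\<lambda>x. f (pt_of b (x, y))) has_real_derivative p (pt_of b (x, y)) $ (if b then 1 else 2)) (at x)"
      by (rule shift, use d[of "pt_of b (x, y)" "if b then 1 else 2"] in \<open>cases b; simp add: pt_of_def pt_add_axis\<close>)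
    show "((\<lambda>y. f (pt_of b (x, y))) has_real_derivative p (pt_of b (x, y)) $ (if b then 2 else 1)) (at y)"
      by (rule shift, use d[of "pt_of b (x, y)" "if b then 2 else 1"] in \<open>cases b; simp add: pt_of_def pt_add_axis\<close>)
    assume "L \<le> \<bar>x\<bar> \<or> L \<le> \<bar>y\<bar>"
    hence "norm (pt_of b (x, y)) > M"
      using component_le_norm_cart[of "pt_of b (x, y)" 1] component_le_norm_cart[of "pt_of b (x, y)" 2] L
      by (cases b) (auto simp: pt_of_def)
    hence n: "pt_of b (x, y) \<notin> K" using M[of "pt_of b (x, y)"] by linarith
    show "f (pt_of b (x, y)) = 0" "p (pt_of b (x, y)) $ (if b then 1 else 2) = 0" "p (pt_of b (x, y)) $ (if b then 2 else 1) = 0"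
      using K(2)[OF n] by auto
  next
    have "continuous_on UNIV (\<lambda>z. g (pt_of b z))" if "continuous_on UNIV g" for g :: "R2 \<Rightarrow> real"
      by (rule continuous_on_compose2[OF that continuous_on_pt_of]) simp
    note * = this[OF c(1)] this[OF continuous_on_component[OF c(2)]]
    show "continuous_on UNIV (\<lambda>z. f (pt_of b (fst z, snd z)))"
      "continuous_on UNIV (\<lambda>z. p (pt_of b (fst z, snd z)) $ (if b then 1 else 2))"
      "continuous_on UNIV (\<lambda>z. p (pt_of b (fst z, snd z)) $ (if b then 2 else 1))"
      using * by simp_all
  qed
  thus ?thesis using that by blast
qed

lemma integral_norm_grad:
  assumes "C1c f p"
  shows "(LINT v|lborel. norm (p v)) = (LINT z|plane.
     sqrt ((p (pt_of b (fst z, snd z)) $ (if b then 1 else 2))\<^sup>2 + (p (pt_of b (fst z, snd z)) $ (if b then 2 else 1))\<^sup>2))"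
proof -
  have "continuous_on UNIV p" using assms by (simp add: C1c_def)
  hence "(\<lambda>v. norm (p v)) \<in> borel_measurable borel"
    by (intro borel_measurable_continuous_onI continuous_intros)
  from integral_pt_of[OF this, of b] show ?thesis
    by (cases b) (simp_all add: norm_R2 add.commute)
qed

lemma knothe_pt_of:
  assumes c: "continuous_on UNIV \<psi>" and K: "compact K" "\<And>v. v \<notin> K \<Longrightarrow> \<psi> v = 0" and nn: "\<And>v. \<psi> v \<ge> (0::real)"
    and R: "R > 0" "(LINT v|lborel. \<psi> v) < pi * R\<^sup>2"
  obtains L0 where "\<And>L b. L \<ge> L0 \<Longrightarrow> knothe (\<lambda>x y. \<psi> (pt_of b (x, y))) L R"
proof -
  obtain M where M: "\<And>x. x \<in> K \<Longrightarrow> norm x \<le> M" using compact_imp_bounded[OF K(1)] bounded_iff by blast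
  have "knothe (\<lambda>x y. \<psi> (pt_of b (x, y))) L R" if L: "L \<ge> \<bar>M\<bar> + 1" for L b
  proof
    show "continuous_on UNIV (\<lambda>z. \<psi> (pt_of b (fst z, snd z)))"
      using continuous_on_compose2[OF c continuous_on_pt_of[of UNIV b]] by simp
    show "0 < R" by (rule R)
    show "0 \<le> \<psi> (pt_of b (x, y))" for x y by (rule nn)
    show "\<psi> (pt_of b (x, y)) = 0" if "L \<le> \<bar>x\<bar> \<or> L \<le> \<bar>y\<bar>" for x y
    proof -
      have "norm (pt_of b (x, y)) > M"
        using component_le_norm_cart[of "pt_of b (x, y)" 1] component_le_norm_cart[of "pt_of b (x, y)" 2] L that
        by (cases b) (auto simp: pt_of_def)
      hence "pt_of b (x, y) \<notin> K" using M[of "pt_of b (x, y)"] by linarith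
      thus ?thesis by (rule K(2))
    qed
    show "(LINT z|plane. \<psi> (pt_of b (fst z, snd z))) < pi * R\<^sup>2"
      using R(2) integral_pt_of[OF borel_measurable_continuous_onI[OF c], of b] by simp
  qed
  thus ?thesis using that by blast
qed

text \<open>The Knothe field of \<psi> into a disc of radius \<open>R\<close> is bounded by
  \<open>R\<close>, while its divergence tested with \<open>f\<close> is at least twice the mass. So
  twice the mass is at most \<open>R\<close> times the integral of the gradient, and
  \<open>R\<close> is then lowered to the radius of the disc whose area is the mass. The continuous
  density \<psi> stands in for an indicator function.\<close>

lemma isoperimetric:
  assumes f: "C1c f p" "\<And>v. f v \<ge> 0"
    and c: "continuous_on UNIV \<psi>" and \<psi>: "\<And>v. 0 \<le> \<psi> v" "\<And>v. \<psi> v \<le> 1" "\<And>v. \<psi> v > 0 \<Longrightarrow> f v \<ge> 1"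
  shows "4 * pi * (LINT v|lborel. \<psi> v) \<le> (LINT v|lborel. norm (p v))\<^sup>2"
proof -
  let ?m = "LINT v|lborel. \<psi> v" and ?G = "LINT v|lborel. norm (p v)"
  obtain K where K: "compact K" "\<And>x. x \<notin> K \<Longrightarrow> f x = 0" using f(1) unfolding C1c_def by auto
  have K\<psi>: "\<psi> v = 0" if "v \<notin> K" for v using K(2)[OF that] \<psi>(1)[of v] \<psi>(3)[of v] by linarith
  have m0: "?m \<ge> 0" by (intro integral_nonneg_AE) (simp add: \<psi>)
  have G0: "?G \<ge> 0" by (intro integral_nonneg_AE) simp
  have main: "2 * ?m \<le> R * ?G" if R: "R > 0" "?m < pi * R\<^sup>2" for R
  proof -
    obtain L1 where L1: "\<And>L b. L \<ge> L1 \<Longrightarrow> knothe (\<lambda>x y. \<psi> (pt_of b (x, y))) L R"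
      using knothe_pt_of[OF c K(1) K\<psi> \<psi>(1) R] by metis
    obtain L0 where L0: "\<And>L b. L \<ge> L0 \<Longrightarrow> C1_box L (\<lambda>x y. f (pt_of b (x, y))) (\<lambda>x y. p (pt_of b (x, y)) $ (if b then 1 else 2)) (\<lambda>x y. p (pt_of b (x, y)) $ (if b then 2 else 1))"
      using C1c_box[OF f(1)] by metis
    define L where "L = max L0 L1"
    have k: "knothe (\<lambda>x y. \<psi> (pt_of True (x, y))) L R" by (intro L1) (simp add: L_def)
    have bx: "C1_box L (\<lambda>x y. f (pt_of True (x, y))) (\<lambda>x y. p (pt_of True (x, y)) $ (if True then 1 else 2)) (\<lambda>x y. p (pt_of True (x, y)) $ (if True then 2 else 1))"
      by (intro L0) (simp add: L_def)
    let ?V = "{z. \<psi> (pt_of True z) > 0}"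
    have "open ?V" by (intro open_Collect_less continuous_intros continuous_on_compose2[OF c continuous_on_pt_of]) auto
    hence V: "?V \<in> sets plane" unfolding lborel_prod by simp
    interpret knothe "\<lambda>x y. \<psi> (pt_of True (x, y))" L R by (rule k)
    have "(LINT z|plane. indicator ?V z * ev (fst z) (snd z)) \<le> R * ?G"
      unfolding integral_norm_grad[OF f(1), of True]
      by (rule calibration_set[OF bx _ _ V]) (use f(2) \<psi> in auto)
    also have "(\<lambda>z. indicator ?V z * ev (fst z) (snd z)) = (\<lambda>z. ev (fst z) (snd z))"
    proof
      fix z show "indicator ?V z * ev (fst z) (snd z) = ev (fst z) (snd z)"
        using \<psi>(1)[of "pt_of True z"] by (cases "\<psi> (pt_of True z) > 0") (auto simp: ev_def)
    qed
    also have "(LINT z|plane. ev (fst z) (snd z)) \<ge> 2 * total"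
    proof -
      have "(LINT x|lborel. (if slice x = 0 then 0 else (slice x - chord x)\<^sup>2 / chord x)) \<ge> 0"
        using chord_pos by (intro integral_nonneg_AE AE_I2) (simp add: less_imp_le)
      thus ?thesis unfolding integral_ev(1) by simp
    qed
    moreover have "total = ?m" using integral_pt_of[OF borel_measurable_continuous_onI[OF c], of True] by (simp add: total_eq)
    ultimately show ?thesis by linarith
  qed
  \<comment> \<open>The field needs a strict surplus of area, so the optimal radius is only
    approached from above.\<close>
  let ?r = "sqrt (?m / pi)"
  have "2 * ?m \<le> ?r * ?G"
  proof (rule tendsto_lowerbound)
    show "((\<lambda>R. R * ?G) \<longlongrightarrow> ?r * ?G) (at_right ?r)" by (intro tendsto_intros)
    show "\<forall>\<^sub>F R in at_right ?r. 2 * ?m \<le> R * ?G"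
      unfolding eventually_at_right_field
    proof (intro exI[of _ "?r + 1"] conjI allI impI)
      fix R assume R: "?r < R" "R < ?r + 1"
      have "?r \<ge> 0" using m0 by simp
      moreover have "?r\<^sup>2 < R\<^sup>2" using R m0 by (intro power_strict_mono) auto
      hence "?m < pi * R\<^sup>2" using m0 by (simp add: field_simps)
      ultimately show "2 * ?m \<le> R * ?G" using main[of R] R by linarith
    qed simp
  qed simp
  hence "(2 * ?m)\<^sup>2 \<le> (?r * ?G)\<^sup>2" using m0 by (intro power_mono) auto
  hence "4 * ?m * ?m \<le> ?m / pi * ?G\<^sup>2" using m0
    by (simp only: power_mult_distrib real_sqrt_pow2 divide_nonneg_nonneg pi_ge_zero) (simp add: power2_eq_square)
  hence "?m * (4 * pi * ?m) \<le> ?m * ?G\<^sup>2" by (simp add: field_simps)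
  thus ?thesis using m0 G0 by (cases "?m = 0") (auto simp: mult_le_cancel_left)
qed

section \<open>The isoperimetric gain of a set that is not a disc\<close>

lemma knothe_limit_pt_of:
  assumes o: "open \<Omega>" "connected \<Omega>" "bounded \<Omega>" and m: "measure lborel \<Omega> = pi"
  obtains L0 where "\<And>L b. L \<ge> L0 \<Longrightarrow> knothe_limit (pt_of b -` \<Omega>) L"
proof -
  obtain M where M: "\<And>x. x \<in> \<Omega> \<Longrightarrow> norm x \<le> M" using o(3) bounded_iff by blast
  have "knothe_limit (pt_of b -` \<Omega>) L" if L: "L \<ge> \<bar>M\<bar> + 1" for L b
  proof -
    have k1: "open (pt_of b -` \<Omega>)" by (rule open_vimage[OF o(1) continuous_on_pt_of])
    define q :: "R2 \<Rightarrow> real \<times> real" where "q v = (if b then (v $ 1, v $ 2) else (v $ 2, v $ 1))" for v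
    have pq: "pt_of b (q v) = v" for v by (cases b) (auto simp: q_def pt_of_def pt_eta)
    have qp: "q (pt_of b z) = z" for z by (cases b) (auto simp: q_def pt_of_def)
    have "pt_of b -` \<Omega> = q ` \<Omega>"
    proof (rule set_eqI, rule iffI)
      fix z assume "z \<in> pt_of b -` \<Omega>"
      hence "q (pt_of b z) \<in> q ` \<Omega>" by (intro imageI) simp
      thus "z \<in> q ` \<Omega>" by (simp only: qp)
    next
      fix z assume "z \<in> q ` \<Omega>"
      then obtain v where "z = q v" "v \<in> \<Omega>" by blast
      thus "z \<in> pt_of b -` \<Omega>" by (simp add: pq)
    qed
    moreover have "continuous_on \<Omega> q" unfolding q_def by (cases b) (auto intro!: continuous_intros)
    ultimately have k2: "connected (pt_of b -` \<Omega>)" using connected_continuous_image[OF _ o(2)] by metis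
    have k3: "\<bar>x\<bar> < L \<and> \<bar>y\<bar> < L" if "(x, y) \<in> pt_of b -` \<Omega>" for x y
      using component_le_norm_cart[of "pt_of b (x, y)" 1] component_le_norm_cart[of "pt_of b (x, y)" 2]
        M[of "pt_of b (x, y)"] that L by (cases b) (auto simp: pt_of_def)
    have k4: "measure plane (pt_of b -` \<Omega>) = pi"
      using emeasure_pt_of[of \<Omega> b] o(1) m by (simp add: measure_def)
    show ?thesis by (rule knothe_limit.intro[OF k1 k2 k3 k4])
  qed
  thus ?thesis using that by blast
qed

text \<open>\<open>4 * pi^2\<close> is the classical bound \<open>4 * pi\<close> times area for the
  full area \<pi>. The gain is measured against the full area even though \<open>V\<close> may lack
  \<kappa>.\<close>

definition isoperimetric_gain :: "R2 set \<Rightarrow> real \<Rightarrow> real \<Rightarrow> bool" where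
  "isoperimetric_gain \<Omega> \<gamma> \<kappa> \<longleftrightarrow> \<gamma> > 1 \<and> 0 < \<kappa> \<and> \<kappa> < pi \<and>
     (\<forall>f p V. C1c f p \<longrightarrow> (\<forall>v. f v \<ge> 0) \<longrightarrow> V \<in> sets borel \<longrightarrow> V \<subseteq> \<Omega> \<longrightarrow> (\<forall>v\<in>V. f v \<ge> 1) \<longrightarrow>
       measure lborel V \<ge> pi - \<kappa> \<longrightarrow> \<gamma> * (4 * pi\<^sup>2) \<le> (LINT v|lborel. norm (p v))\<^sup>2)"

lemma isoperimetric_gainD:
  assumes "isoperimetric_gain \<Omega> \<gamma> \<kappa>" "C1c f p" "\<And>v. f v \<ge> 0" "V \<in> sets borel" "V \<subseteq> \<Omega>"
    "\<And>v. v \<in> V \<Longrightarrow> f v \<ge> 1" "measure lborel V \<ge> pi - \<kappa>"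
  shows "\<gamma> * (4 * pi\<^sup>2) \<le> (LINT v|lborel. norm (p v))\<^sup>2"
  using assms unfolding isoperimetric_gain_def by blast

text \<open>A flux above \<open>2 * pi\<close> of one fixed approximate field is stable under the
  removal of a small set: truncating \<open>ev\<close> at a height \<open>k0\<close> still leaves an
  integral \<open>J\<close> above \<open>2 * pi\<close>, and a set of measure \<kappa> takes at most
  \<open>k0 * \<kappa>\<close> away from it.\<close>

lemma knothe_gain:
  assumes W: "knothe_limit (pt_of b -` \<Omega>) L1" "\<Omega> \<in> sets borel"
    and I: "2 * pi < (LINT z|plane. knothe.ev (inner_cut (pt_of b -` \<Omega>) n) 1 (fst z) (snd z))"
    and LL: "\<And>L. L \<ge> L1 \<Longrightarrow> knothe_limit (pt_of b -` \<Omega>) L"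
  obtains \<gamma> \<kappa> where "isoperimetric_gain \<Omega> \<gamma> \<kappa>"
proof -
  define W where "W = pt_of b -` \<Omega>"
  let ?P = "plane"
  let ?ev = "\<lambda>z. knothe.ev (inner_cut W n) 1 (fst z) (snd z)"
  interpret knothe_limit W L1 using W(1) by (simp add: W_def)
  have kn: "knothe (inner_cut W n) L1 1" by (rule knothe_cut)
  note ie = knothe.int_ev[OF kn]
  note [measurable] = borel_measurable_integrable[OF ie]
  have ev0: "?ev z \<ge> 0" for z
    unfolding knothe.ev_def[OF kn] using knothe.chord_pos[OF kn, of "fst z"] knothe.slice_nonneg[OF kn, of "fst z"]
    by (intro mult_nonneg_nonneg inner_cut_bounds) auto
  have evW: "?ev z = 0" if "z \<notin> W" for z
    unfolding knothe.ev_def[OF kn] using inner_cut_bounds(3)[of "fst z" "snd z" W n] that by simp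
  have "(\<lambda>k. LINT z|?P. min (?ev z) (real k)) \<longlonglongrightarrow> (LINT z|?P. ?ev z)"
  proof (rule integral_dominated_convergence[where w="?ev"])
    show "AE z in ?P. (\<lambda>k. min (?ev z) (real k)) \<longlonglongrightarrow> ?ev z"
    proof (rule AE_I2)
      fix z
      obtain N where N: "?ev z < real N" using reals_Archimedean2 by blast
      have "\<forall>k\<ge>N. min (?ev z) (real k) = ?ev z" using N by (auto simp: min_def)
      thus "(\<lambda>k. min (?ev z) (real k)) \<longlonglongrightarrow> ?ev z"
        by (intro tendsto_eventually) (auto simp: eventually_sequentially)
    qed
    show "AE z in ?P. norm (min (?ev z) (real k)) \<le> ?ev z" for k
      using ev0 by (intro AE_I2) (simp add: abs_of_nonneg min_def)
  qed (use ie in measurable)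
  hence "eventually (\<lambda>k. (LINT z|?P. min (?ev z) (real k)) > 2 * pi) sequentially"
    using I unfolding W_def by (rule order_tendstoD)
  then obtain k0 where k0: "(LINT z|?P. min (?ev z) (real k0)) > 2 * pi" unfolding eventually_sequentially by blast
  define J where "J = (LINT z|?P. min (?ev z) (real k0))"
  have im: "integrable ?P (\<lambda>z. min (?ev z) (real k0))"
    by (rule Bochner_Integration.integrable_bound[OF ie]) (use ev0 in \<open>auto intro!: AE_I2\<close>)
  \<comment> \<open>Half of the surplus \<open>J - 2 * pi\<close> is given up for the missing set,
    the other half is kept in \<gamma>. The minimum with 1 ensures that \<kappa> is below
    \<pi>.\<close>
  define \<kappa> where "\<kappa> = min 1 ((J - 2 * pi) / (2 * (real k0 + 1)))"
  define \<gamma> where "\<gamma> = ((J + 2 * pi) / 2 / (2 * pi))\<^sup>2"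
  have J: "J > 2 * pi" using k0 by (simp add: J_def)
  have "0 < 2 * pi" by simp
  with J have J0: "0 < J" by (rule order.strict_trans[rotated])
  have \<kappa>0: "0 < \<kappa>" using J by (simp add: \<kappa>_def)
  have "1 < pi" using pi_gt3 by linarith
  hence \<kappa>1: "\<kappa> < pi" by (auto simp: \<kappa>_def)
  have \<kappa>k: "real k0 * \<kappa> \<le> (J - 2 * pi) / 2"
  proof -
    have "real k0 * \<kappa> \<le> (real k0 + 1) * \<kappa>" using \<kappa>0 by simp
    also have "\<dots> \<le> (real k0 + 1) * ((J - 2 * pi) / (2 * (real k0 + 1)))" by (intro mult_left_mono) (auto simp: \<kappa>_def)
    also have "\<dots> = (J - 2 * pi) / 2" by (simp add: field_simps)
    finally show ?thesis .
  qed
  have "(J + 2 * pi) / 2 / (2 * pi) > 1" using J by (simp add: field_simps)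
  hence \<gamma>1: "\<gamma> > 1" unfolding \<gamma>_def by (simp add: one_less_power)
  have "isoperimetric_gain \<Omega> \<gamma> \<kappa>"
    unfolding isoperimetric_gain_def
  proof (intro conjI allI impI \<gamma>1 \<kappa>0 \<kappa>1)
    fix f p V
    assume f: "C1c f p" "\<forall>v. f v \<ge> 0" and V: "V \<in> sets borel" "V \<subseteq> \<Omega>" "\<forall>v\<in>V. f v \<ge> 1" "measure lborel V \<ge> pi - \<kappa>"
    obtain L0 where L0: "\<And>L b. L \<ge> L0 \<Longrightarrow> C1_box L (\<lambda>x y. f (pt_of b (x, y))) (\<lambda>x y. p (pt_of b (x, y)) $ (if b then 1 else 2)) (\<lambda>x y. p (pt_of b (x, y)) $ (if b then 2 else 1))"
      using C1c_box[OF f(1)] by metis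
    \<comment> \<open>The box only has to contain the supports. \<open>ev\<close> does not depend on
      \<open>L\<close>, so \<gamma> and \<kappa>, which were chosen before \<open>f\<close>, remain
      valid in the larger box.\<close>
    define L where "L = max L0 L1"
    have kn': "knothe (inner_cut W n) L 1" unfolding W_def by (intro knothe_limit.knothe_cut LL) (simp add: L_def)
    have bx: "C1_box L (\<lambda>x y. f (pt_of b (x, y))) (\<lambda>x y. p (pt_of b (x, y)) $ (if b then 1 else 2)) (\<lambda>x y. p (pt_of b (x, y)) $ (if b then 2 else 1))"
      by (intro L0) (simp add: L_def)
    define V' where "V' = pt_of b -` V"
    have V'm: "V' \<in> sets ?P" unfolding V'_def using measurable_sets[OF pt_of_meas V(1), of b] by (simp add: space_pair_measure)
    have V'W: "V' \<subseteq> W" using V(2) by (auto simp: V'_def W_def)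
    have mV': "measure ?P V' \<ge> pi - \<kappa>" using V(4) emeasure_pt_of[OF V(1), of b] by (simp add: measure_def V'_def)
    have Wf: "emeasure ?P W \<noteq> \<infinity>" using W_fin by simp
    have "measure ?P (W - V') = measure ?P W - measure ?P V'"
      using Wf W_sets V'm V'W by (intro measure_Diff) auto
    hence mD: "measure ?P (W - V') \<le> \<kappa>" using mV' Wpi by simp
    have Df: "emeasure ?P (W - V') < \<infinity>" using W_fin by (rule le_less_trans[rotated]) (auto intro!: emeasure_mono)
    have iD: "integrable ?P (\<lambda>z. real k0 * indicator (W - V') z)"
      by (intro integrable_mult_right integrable_real_indicator Df) (use V'm in auto)
    have iV: "integrable ?P (\<lambda>z. indicator V' z * ?ev z)" using integrable_mult_indicator[OF V'm ie] by simp
    have "J \<le> (LINT z|?P. indicator V' z * ?ev z + real k0 * indicator (W - V') z)"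
      unfolding J_def
    proof (rule integral_mono[OF im Bochner_Integration.integrable_add[OF iV iD]])
      fix z show "min (?ev z) (real k0) \<le> indicator V' z * ?ev z + real k0 * indicator (W - V') z"
        using V'W evW[of z] by (auto simp: indicator_def)
    qed
    also have "\<dots> = (LINT z|?P. indicator V' z * ?ev z) + real k0 * measure ?P (W - V')"
      using Bochner_Integration.integral_add[OF iV iD] by (simp add: space_pair_measure)
    also have "real k0 * measure ?P (W - V') \<le> real k0 * \<kappa>" using mD by (intro mult_left_mono) auto
    also have "(LINT z|?P. indicator V' z * ?ev z) \<le> 1 * (LINT v|lborel. norm (p v))"
      unfolding integral_norm_grad[OF f(1), of b]
    proof (rule knothe.calibration_set[OF kn' bx _ _ V'm])
      show "0 \<le> f (pt_of b (x, y))" for x y using f(2) by blast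
      show "inner_cut W n x y \<le> 1" for x y by (rule inner_cut_bounds(2))
      show "1 \<le> f (pt_of b (x, y))" if "(x, y) \<in> V'" for x y using that V(3) by (simp add: V'_def)
    qed
    finally have "(J + 2 * pi) / 2 \<le> (LINT v|lborel. norm (p v))" using \<kappa>k by simp
    hence "((J + 2 * pi) / 2)\<^sup>2 \<le> (LINT v|lborel. norm (p v))\<^sup>2" using J0 by (intro power_mono) auto
    moreover have "\<gamma> * (4 * pi\<^sup>2) = ((J + 2 * pi) / 2)\<^sup>2" unfolding \<gamma>_def power_divide by (simp add: field_simps)
    ultimately show "\<gamma> * (4 * pi\<^sup>2) \<le> (LINT v|lborel. norm (p v))\<^sup>2" by simp
  qed
  thus ?thesis by (rule that)
qed

definition disc_slice :: "real \<Rightarrow> real" where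
  "disc_slice s = (if \<bar>s\<bar> < 1 then 2 * sqrt (1 - s\<^sup>2) else 0)"

text \<open>With the squared distance to a line as \<open>q\<close> this is one of the two summands
  of the second moment, computed from the slices in a single direction.\<close>

lemma integral_slices:
  fixes q :: "real \<Rightarrow> real"
  assumes S: "S \<in> sets borel" "bounded S" and sm: "s \<in> borel_measurable borel" and q: "continuous_on UNIV q"
    and sl: "AE x in lborel. (LINT y|lborel. indicator S (pt_of b (x, y))) = s x"
  shows "integrable lborel (\<lambda>v. indicator S v * q (if b then v $ 1 else v $ 2))"
    and "(LINT v|lborel. indicator S v * q (if b then v $ 1 else v $ 2)) = (LINT x|lborel. q x * s x)"
proof -
  let ?F = "\<lambda>v. indicator S v * q (if b then v $ 1 else v $ 2)"
  let ?P = "plane"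
  have cq: "continuous_on UNIV (\<lambda>v::R2. q (if b then v $ 1 else v $ 2))"
    by (rule continuous_on_compose2[OF q]) (cases b; auto intro!: continuous_intros)+
  have m: "?F \<in> borel_measurable borel"
    using borel_measurable_continuous_onI[OF cq] S(1) by measurable
  obtain M where M: "\<And>x. x \<in> S \<Longrightarrow> norm x \<le> M" using S(2) bounded_iff by blast
  have i0: "integrable lborel (\<lambda>v::R2. indicator (cball 0 M) v *\<^sub>R q (if b then v $ 1 else v $ 2))"
    by (rule borel_integrable_compact[OF compact_cball continuous_on_subset[OF cq]]) simp
  show i: "integrable lborel ?F"
  proof (rule Bochner_Integration.integrable_bound[OF i0])
    show "AE v in lborel. norm (?F v) \<le> norm (indicator (cball 0 M) v *\<^sub>R q (if b then v $ 1 else v $ 2))"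
      using M by (intro AE_I2) (auto simp: indicator_def)
  qed (use m in simp)
  have iP: "integrable ?P (\<lambda>z. ?F (pt_of b z))" using i integrable_pt_of[OF m, of b] by simp
  have e: "?F (pt_of b (x, y)) = q x * indicator S (pt_of b (x, y))" for x y
    by (cases b) (auto simp: pt_of_def)
  have cm: "(\<lambda>x. LINT y|lborel. indicator S (pt_of b (x, y)) :: real) \<in> borel_measurable lborel"
  proof -
    have "pt_of b -` S \<in> sets ?P" using measurable_sets[OF pt_of_meas S(1), of b] by (simp add: space_pair_measure)
    hence "(indicator (pt_of b -` S) :: _ \<Rightarrow> real) \<in> borel_measurable ?P" by (rule borel_measurable_indicator)
    also have "(indicator (pt_of b -` S) :: _ \<Rightarrow> real) = (\<lambda>z. indicator S (pt_of b z))" by (auto simp: indicator_def)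
    finally have "(\<lambda>z. indicator S (pt_of b z) :: real) \<in> borel_measurable ?P" .
    from lborel.borel_measurable_lebesgue_integral[of "\<lambda>x y. indicator S (pt_of b (x, y)) :: real" lborel] this
    show ?thesis by (simp add: case_prod_beta')
  qed
  have "(LINT v|lborel. ?F v) = (LINT z|?P. ?F (pt_of b z))" by (rule integral_pt_of[OF m])
  also have "\<dots> = (LINT x|lborel. LINT y|lborel. ?F (pt_of b (x, y)))"
    by (rule lborel_pair.integral_fst'[OF iP, symmetric])
  also have "\<dots> = (LINT x|lborel. q x * (LINT y|lborel. indicator S (pt_of b (x, y))))"
    unfolding e by simp
  also have "\<dots> = (LINT x|lborel. q x * s x)"
  proof (rule integral_cong_AE)
    show "AE x in lborel. q x * (LINT y|lborel. indicator S (pt_of b (x, y))) = q x * s x"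
      using sl by eventually_elim simp
  qed (use cm sm borel_measurable_continuous_onI[OF q] in measurable)
  finally show "(LINT v|lborel. ?F v) = (LINT x|lborel. q x * s x)" .
qed

lemma disc_slice_meas [measurable]: "disc_slice \<in> borel_measurable borel"
  unfolding disc_slice_def by measurable

lemma ball_slice: "(LINT y|lborel. indicator (ball c 1) (pt_of b (x, y))) = disc_slice (x - (if b then c $ 1 else c $ 2))"
proof -
  let ?a = "if b then c $ 1 else c $ 2" and ?d = "if b then c $ 2 else c $ 1"
  let ?r = "sqrt (1 - (x - ?a)\<^sup>2)"
  have mem: "pt_of b (x, y) \<in> ball c 1 \<longleftrightarrow> (x - ?a)\<^sup>2 + (y - ?d)\<^sup>2 < 1" for y
    by (cases b) (auto simp: pt_of_def dist_norm norm_R2 power2_commute add.commute)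
  have ax: "\<bar>x - ?a\<bar> < 1 \<longleftrightarrow> (x - ?a)\<^sup>2 < 1" using abs_square_less_1 by blast
  show ?thesis
  proof (cases "\<bar>x - ?a\<bar> < 1")
    case True
    have "pt_of b (x, y) \<in> ball c 1 \<longleftrightarrow> y \<in> {?d - ?r<..<?d + ?r}" for y
    proof -
      have "(x - ?a)\<^sup>2 + (y - ?d)\<^sup>2 < 1 \<longleftrightarrow> (y - ?d)\<^sup>2 < 1 - (x - ?a)\<^sup>2" by linarith
      also have "\<dots> \<longleftrightarrow> sqrt ((y - ?d)\<^sup>2) < ?r" by (rule real_sqrt_less_iff[symmetric])
      also have "\<dots> \<longleftrightarrow> y \<in> {?d - ?r<..<?d + ?r}" unfolding real_sqrt_abs abs_less_iff by auto
      finally show ?thesis unfolding mem .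
    qed
    hence "(\<lambda>y. indicator (ball c 1) (pt_of b (x, y)) :: real) = indicator {?d - ?r<..<?d + ?r}"
      by (auto simp: indicator_def fun_eq_iff)
    moreover have "?r \<ge> 0" using True ax by simp
    ultimately show ?thesis using True by (simp add: disc_slice_def)
  next
    case False
    hence "pt_of b (x, y) \<notin> ball c 1" for y
      unfolding mem using ax by (smt (verit) zero_le_power2)
    thus ?thesis using False by (simp add: disc_slice_def)
  qed
qed

text \<open>Slices in two orthogonal directions determine the second moment about \<open>c\<close>, and among all sets of
  area \<open>\<pi>\<close> only the disc has a second moment as small as that of the disc.\<close>

lemma bathtub:
  fixes c :: R2
  assumes S: "S \<in> sets borel" "bounded S" "measure lborel S = pi"
    and sec: "\<And>b. AE x in lborel. (LINT y|lborel. indicator S (pt_of b (x, y))) = disc_slice (x - (if b then c $ 1 else c $ 2))"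
  shows "AE v in lborel. (v \<in> S \<longrightarrow> dist v c \<le> 1) \<and> (dist v c < 1 \<longrightarrow> v \<in> S)"
proof -
  let ?B = "ball c 1" and ?q = "\<lambda>b x. (x - (if b then c $ 1 else c $ 2))\<^sup>2"
  have cq: "continuous_on UNIV (?q b)" for b by (intro continuous_intros)
  have dm: "(\<lambda>x. disc_slice (x - a)) \<in> borel_measurable borel" for a by measurable
  have B: "?B \<in> sets borel" "bounded ?B" by auto
  have mB: "measure lborel ?B = pi" by (simp add: content_ball unit_ball_vol_2)
  have Bs: "AE x in lborel. (LINT y|lborel. indicator ?B (pt_of b (x, y))) = disc_slice (x - (if b then c $ 1 else c $ 2))" for b
    using ball_slice by (intro AE_I2) blast
  have iS: "integrable lborel (\<lambda>v. indicator S v * ?q b (if b then v $ 1 else v $ 2))" for b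
    by (rule integral_slices(1)[OF S(1,2) dm cq sec])
  have iB: "integrable lborel (\<lambda>v. indicator ?B v * ?q b (if b then v $ 1 else v $ 2))" for b
    by (rule integral_slices(1)[OF B dm cq Bs])
  have eq: "(LINT v|lborel. indicator S v * ?q b (if b then v $ 1 else v $ 2)) = (LINT v|lborel. indicator ?B v * ?q b (if b then v $ 1 else v $ 2))" for b
    unfolding integral_slices(2)[OF S(1,2) dm cq sec] integral_slices(2)[OF B dm cq Bs] ..
  have fin: "emeasure lborel S < \<infinity>" "emeasure lborel ?B < \<infinity>"
    using emeasure_bounded_finite S(2) B(2) by auto
  have jS: "integrable lborel (indicator S :: R2 \<Rightarrow> real)" and jB: "integrable lborel (indicator ?B :: R2 \<Rightarrow> real)"
    using fin S(1) by (auto intro!: integrable_real_indicator)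
  have mS: "(LINT v|lborel. indicator S v) = measure lborel S" "(LINT v|lborel. indicator ?B v) = measure lborel ?B"
    by simp_all
  have n2: "(dist v c)\<^sup>2 = ?q True (v $ 1) + ?q False (v $ 2)" for v
    by (simp add: dist_norm norm_R2)
  \<comment> \<open>The factor \<open>1 - (dist v c)^2\<close> is positive exactly inside the disc,
    so the product is nonnegative whichever of the two sets contains the point. Equal areas and
    equal second moments make its integral 0.\<close>
  let ?D = "\<lambda>v. (indicator ?B v - indicator S v) * (1 - (dist v c)\<^sup>2) :: real"
  have Dsplit: "?D v = (indicator ?B v - indicator S v) - ((indicator ?B v * ?q True (v $ 1) + indicator ?B v * ?q False (v $ 2)) - (indicator S v * ?q True (v $ 1) + indicator S v * ?q False (v $ 2)))" for v
    unfolding n2 by (simp add: algebra_simps)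
  have i1: "integrable lborel (\<lambda>v. indicator S v * ?q True (v $ 1))" "integrable lborel (\<lambda>v. indicator ?B v * ?q True (v $ 1))"
    using iS[of True] iB[of True] by simp_all
  have i2: "integrable lborel (\<lambda>v. indicator S v * ?q False (v $ 2))" "integrable lborel (\<lambda>v. indicator ?B v * ?q False (v $ 2))"
    using iS[of False] iB[of False] by simp_all
  have iD: "integrable lborel ?D" unfolding Dsplit
    by (intro Bochner_Integration.integrable_diff Bochner_Integration.integrable_add jS jB i1 i2)
  have "(LINT v|lborel. ?D v) = (measure lborel ?B - measure lborel S) -
     (((LINT v|lborel. indicator ?B v * ?q True (v $ 1)) + (LINT v|lborel. indicator ?B v * ?q False (v $ 2)))
     - ((LINT v|lborel. indicator S v * ?q True (v $ 1)) + (LINT v|lborel. indicator S v * ?q False (v $ 2))))"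
    unfolding Dsplit
    by (simp only: Bochner_Integration.integral_diff Bochner_Integration.integral_add Bochner_Integration.integrable_diff Bochner_Integration.integrable_add jS jB i1 i2 mS)
  also have "\<dots> = 0" using eq[of True] eq[of False] mB S(3) by simp
  finally have z: "(LINT v|lborel. ?D v) = 0" .
  have D0: "?D v \<ge> 0" for v
  proof (cases "v \<in> ?B")
    case True
    hence "(dist v c)\<^sup>2 < 1" using abs_square_less_1[of "dist v c"] by (simp add: dist_commute)
    thus ?thesis using True by (auto simp: indicator_def)
  next
    case False
    hence "(dist v c)\<^sup>2 \<ge> 1" using abs_square_less_1[of "dist v c"] by (simp add: dist_commute)
    thus ?thesis using False by (auto simp: indicator_def)
  qed
  have "AE v in lborel. ?D v = 0"
    using z integral_nonneg_eq_0_iff_AE[OF iD] D0 by simp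
  thus ?thesis
  proof eventually_elim
    case (elim v)
    show ?case
    proof (intro conjI impI)
      assume "v \<in> S"
      show "dist v c \<le> 1"
      proof (rule ccontr)
        assume n: "\<not> dist v c \<le> 1"
        hence "(dist v c)\<^sup>2 > 1" by (simp add: one_less_power)
        moreover have "v \<notin> ?B" using n by (simp add: dist_commute)
        ultimately show False using elim \<open>v \<in> S\<close> by (simp add: indicator_def)
      qed
    next
      assume l: "dist v c < 1"
      hence "(dist v c)\<^sup>2 < 1" using abs_square_less_1[of "dist v c"] by simp
      thus "v \<in> S" using elim l by (auto simp: indicator_def dist_commute split: if_splits)
    qed
  qed
qed

lemma isoperimetric_strict:
  assumes o: "open \<Omega>" "connected \<Omega>" "bounded \<Omega>" and m: "measure lborel \<Omega> = pi"
    and nb: "\<And>c. \<not> (AE v in lborel. (v \<in> \<Omega> \<longrightarrow> dist v c \<le> 1) \<and> (dist v c < 1 \<longrightarrow> v \<in> \<Omega>))"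
  obtains \<gamma> \<kappa> where "isoperimetric_gain \<Omega> \<gamma> \<kappa>"
proof -
  obtain L0 where L0: "\<And>L b. L \<ge> L0 \<Longrightarrow> knothe_limit (pt_of b -` \<Omega>) L"
    using knothe_limit_pt_of[OF o m] by metis
  have kl: "knothe_limit (pt_of b -` \<Omega>) L0" for b by (rule L0) simp
  have ob: "\<Omega> \<in> sets borel" using o(1) by simp
  show ?thesis
  proof (cases "\<exists>b n. 2 * pi < (LINT z|plane. knothe.ev (inner_cut (pt_of b -` \<Omega>) n) 1 (fst z) (snd z))")
    case True
    then obtain b n where "2 * pi < (LINT z|plane. knothe.ev (inner_cut (pt_of b -` \<Omega>) n) 1 (fst z) (snd z))" by blast
    from knothe_gain[OF kl ob this L0] that show ?thesis by metis
  next
    case False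
    hence H: "(LINT z|plane. knothe.ev (inner_cut (pt_of b -` \<Omega>) n) 1 (fst z) (snd z)) \<le> 2 * pi" for b n
      by (meson not_less)
    have "\<exists>c. AE x in lborel. (LINT y|lborel. indicator \<Omega> (pt_of b (x, y))) = disc_slice (x - c)" for b
    proof -
      obtain c where "AE x in lborel. knothe_limit.sec (pt_of b -` \<Omega>) x = (if \<bar>x - c\<bar> < 1 then 2 * sqrt (1 - (x - c)\<^sup>2) else 0)"
        by (rule knothe_limit.sec_disc[OF kl H])
      moreover have "knothe_limit.sec (pt_of b -` \<Omega>) x = (LINT y|lborel. indicator \<Omega> (pt_of b (x, y)))" for x
        unfolding knothe_limit.sec_def[OF kl] by (simp add: indicator_def)
      ultimately show ?thesis by (intro exI[of _ c]) (simp only: disc_slice_def)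
    qed
    then obtain C where C: "\<And>b. AE x in lborel. (LINT y|lborel. indicator \<Omega> (pt_of b (x, y))) = disc_slice (x - C b)" by metis
    \<comment> \<open>Each direction of slicing yields one coordinate of the centre.\<close>
    define c where "c = pt (C True) (C False)"
    have "(if b then c $ 1 else c $ 2) = C b" for b by (cases b) (auto simp: c_def)
    hence "AE v in lborel. (v \<in> \<Omega> \<longrightarrow> dist v c \<le> 1) \<and> (dist v c < 1 \<longrightarrow> v \<in> \<Omega>)"
      using C by (intro bathtub ob o(3) m) presburger
    thus ?thesis using nb by blast
  qed
qed

section \<open>Superlevel sets of test functions\<close>

text \<open>For points at which a function is glued from pieces: the square of the positive part,
  and \<open>flat\<close> at 0.\<close>

lemma DERIV_quadratic_error:
  fixes f :: "real \<Rightarrow> real"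
  assumes "\<And>y. \<bar>f y - f x - D * (y - x)\<bar> \<le> C * (y - x)\<^sup>2"
  shows "(f has_real_derivative D) (at x)"
proof -
  have "((\<lambda>h. (f (x + h) - f x) / h - D) \<longlongrightarrow> 0) (at 0)"
  proof (rule Lim_null_comparison)
    have "norm ((f (x + h) - f x) / h - D) \<le> C * \<bar>h\<bar>" if "h \<noteq> 0" for h
    proof -
      have "(f (x + h) - f x) / h - D = (f (x + h) - f x - D * h) / h" using that by (simp add: field_simps)
      moreover have "\<bar>f (x + h) - f x - D * h\<bar> \<le> C * h\<^sup>2" using assms[of "x + h"] by simp
      ultimately have "\<bar>(f (x + h) - f x) / h - D\<bar> \<le> C * h\<^sup>2 / \<bar>h\<bar>" by (simp add: abs_divide divide_right_mono)
      also have "C * h\<^sup>2 / \<bar>h\<bar> = C * \<bar>h\<bar>" using that by (simp add: power2_eq_square field_simps abs_mult_self)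
      finally show ?thesis by simp
    qed
    thus "\<forall>\<^sub>F h in at 0. norm ((f (x + h) - f x) / h - D) \<le> C * \<bar>h\<bar>"
      by (auto simp: eventually_at_filter)
    show "((\<lambda>h. C * \<bar>h\<bar>) \<longlongrightarrow> 0) (at 0)" by (auto intro!: tendsto_eq_intros)
  qed
  hence "(\<lambda>h. (f (x + h) - f x) / h) \<midarrow>0\<rightarrow> D" using LIM_zero_iff by blast
  thus ?thesis by (simp add: DERIV_def)
qed

lemma DERIV_pos_part_square: "((\<lambda>x. (max 0 x)\<^sup>2) has_real_derivative 2 * max 0 x) (at (x::real))"
proof (rule DERIV_quadratic_error[where C=1])
  fix y :: real
  consider "x \<ge> 0" "y \<ge> 0" | "x \<ge> 0" "y < 0" | "x < 0" "y \<ge> 0" | "x < 0" "y < 0" by linarith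
  thus "\<bar>(max 0 y)\<^sup>2 - (max 0 x)\<^sup>2 - 2 * max 0 x * (y - x)\<bar> \<le> 1 * (y - x)\<^sup>2"
  proof cases
    case 1
    have "y\<^sup>2 - x\<^sup>2 - 2 * x * (y - x) = (y - x)\<^sup>2" by (simp add: power2_eq_square algebra_simps)
    thus ?thesis using 1 by simp
  next
    case 2
    have "x * y \<le> 0" using 2 by (simp add: mult_nonneg_nonpos)
    hence "0 \<le> x\<^sup>2 - 2 * (x * y)" using zero_le_power2[of x] by linarith
    hence "\<bar>x\<^sup>2 - 2 * (x * y)\<bar> = x\<^sup>2 - 2 * (x * y)" by simp
    moreover have "- x\<^sup>2 - 2 * x * (y - x) = x\<^sup>2 - 2 * (x * y)" by (simp add: power2_eq_square algebra_simps)
    moreover have "x\<^sup>2 - 2 * (x * y) \<le> (y - x)\<^sup>2" by (simp add: power2_eq_square algebra_simps)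
    ultimately show ?thesis using 2 by simp
  next
    case 3
    hence "y\<^sup>2 \<le> (y - x)\<^sup>2" by (intro power_mono) auto
    thus ?thesis using 3 by simp
  next
    case 4 thus ?thesis by simp
  qed
qed

text \<open>A C1 version of the positive part: quadratic on [0, e] and equal to
  \<open>w - e / 2\<close> beyond. Its derivative \<open>ramp\<close> also supplies continuous
  densities between 0 and 1.\<close>

definition huber :: "real \<Rightarrow> real \<Rightarrow> real" where
  "huber e w = ((max 0 w)\<^sup>2 - (max 0 (w - e))\<^sup>2) / (2 * e)"

definition ramp :: "real \<Rightarrow> real \<Rightarrow> real" where
  "ramp e w = (max 0 w - max 0 (w - e)) / e"

lemma DERIV_huber: "(huber e has_real_derivative ramp e w) (at w)"
proof -
  have "((\<lambda>w. (max 0 (w - e))\<^sup>2) has_real_derivative 2 * max 0 (w - e)) (at w)"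
    using DERIV_chain2[OF DERIV_pos_part_square DERIV_diff[OF DERIV_ident DERIV_const[of e]]] by simp
  hence "(huber e has_real_derivative (2 * max 0 w - 2 * max 0 (w - e)) / (2 * e)) (at w)"
    unfolding huber_def by (intro DERIV_cdivide DERIV_diff DERIV_pos_part_square)
  moreover have "(2 * max 0 w - 2 * max 0 (w - e)) / (2 * e) = ramp e w"
    by (simp add: ramp_def diff_divide_distrib)
  ultimately show ?thesis by simp
qed

lemma ramp_simps:
  assumes "e > 0"
  shows "w \<le> 0 \<Longrightarrow> ramp e w = 0" "w \<ge> e \<Longrightarrow> ramp e w = 1" "0 \<le> ramp e w" "ramp e w \<le> 1" "w \<le> w' \<Longrightarrow> ramp e w \<le> ramp e w'"
proof -
  have *: "0 \<le> max 0 w - max 0 (w - e)" "max 0 w - max 0 (w - e) \<le> e" using assms by (auto simp: max_def)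
  show "w \<le> 0 \<Longrightarrow> ramp e w = 0" "w \<ge> e \<Longrightarrow> ramp e w = 1" using assms by (simp_all add: ramp_def max_def)
  show "0 \<le> ramp e w" "ramp e w \<le> 1" using * assms by (simp_all add: ramp_def)
  assume "w \<le> w'"
  hence "max 0 w - max 0 (w - e) \<le> max 0 w' - max 0 (w' - e)" using assms by (auto simp: max_def)
  thus "ramp e w \<le> ramp e w'" unfolding ramp_def using assms by (intro divide_right_mono) auto
qed

lemma huber_simps:
  assumes "e > 0"
  shows "w \<le> 0 \<Longrightarrow> huber e w = 0" "w \<ge> e \<Longrightarrow> huber e w = w - e / 2"
proof -
  show "w \<le> 0 \<Longrightarrow> huber e w = 0" using assms by (simp add: huber_def max_def)
  assume w: "w \<ge> e"
  have "w\<^sup>2 - (w - e)\<^sup>2 = (2 * e) * (w - e / 2)" by (simp add: power2_eq_square algebra_simps)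
  thus "huber e w = w - e / 2" using assms w by (simp add: huber_def)
qed

lemma ramp_cont [continuous_intros]: "continuous_on S f \<Longrightarrow> continuous_on S (\<lambda>x. ramp e (f x))"
  unfolding ramp_def divide_inverse by (intro continuous_intros)

text \<open>The difference of two smoothed positive parts that start at \<open>t\<close> and at
  \<open>s - 2 * e\<close>, divided by the distance of these points. The value 1 is reached already
  at \<open>s - e\<close>, which leaves room for a continuous density that is positive only where
  the cutoff is 1.\<close>

definition cutoff :: "real \<Rightarrow> real \<Rightarrow> real \<Rightarrow> real \<Rightarrow> real" where
  "cutoff t s e w = (huber e (w - t) - huber e (w - s + 2 * e)) / (s - t - 2 * e)"

definition cutoff' :: "real \<Rightarrow> real \<Rightarrow> real \<Rightarrow> real \<Rightarrow> real" where
  "cutoff' t s e w = (ramp e (w - t) - ramp e (w - s + 2 * e)) / (s - t - 2 * e)"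

lemma DERIV_cutoff: "(cutoff t s e has_real_derivative cutoff' t s e w) (at w)"
proof -
  have "((\<lambda>w. huber e (w - t)) has_real_derivative ramp e (w - t)) (at w)"
    using DERIV_chain2[OF DERIV_huber DERIV_diff[OF DERIV_ident DERIV_const[of t]]] by simp
  moreover have "((\<lambda>w. huber e (w - s + 2 * e)) has_real_derivative ramp e (w - s + 2 * e)) (at w)"
    using DERIV_chain2[OF DERIV_huber DERIV_add[OF DERIV_diff[OF DERIV_ident DERIV_const[of s]] DERIV_const[of "2 * e"]]] by simp
  ultimately show ?thesis unfolding cutoff_def cutoff'_def by (intro DERIV_cdivide DERIV_diff)
qed

lemma cutoff_simps:
  assumes e: "e > 0" "4 * e < s - t"
  shows "w \<le> t \<Longrightarrow> cutoff t s e w = 0" "w \<ge> s - e \<Longrightarrow> cutoff t s e w = 1"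
    "0 \<le> cutoff' t s e w" "cutoff' t s e w \<le> 1 / (s - t - 2 * e)"
    "w \<le> t \<or> w \<ge> s - e \<Longrightarrow> cutoff' t s e w = 0" "0 \<le> cutoff t s e w"
proof -
  have p: "s - t - 2 * e > 0" using e by linarith
  show *: "cutoff t s e w = 0" if "w \<le> t" for w using that e huber_simps(1)[OF e(1)] by (simp add: cutoff_def)
  show "cutoff t s e w = 1" if "w \<ge> s - e" using that e p huber_simps(2)[OF e(1)] by (simp add: cutoff_def)
  have "ramp e (w - s + 2 * e) \<le> ramp e (w - t)" for w using e by (intro ramp_simps(5)) auto
  thus d0: "0 \<le> cutoff' t s e w" for w using p by (simp add: cutoff'_def)
  show "cutoff' t s e w \<le> 1 / (s - t - 2 * e)"
    unfolding cutoff'_def using p ramp_simps(3)[OF e(1), of "w - s + 2 * e"] ramp_simps(4)[OF e(1), of "w - t"]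
    by (intro divide_right_mono) auto
  show "cutoff' t s e w = 0" if "w \<le> t \<or> w \<ge> s - e" using that
  proof
    assume "w \<le> t"
    thus ?thesis using e ramp_simps(1)[OF e(1)] by (simp add: cutoff'_def)
  next
    assume "w \<ge> s - e"
    thus ?thesis using e ramp_simps(2)[OF e(1)] by (simp add: cutoff'_def)
  qed
  show "0 \<le> cutoff t s e w"
  proof (cases "w \<le> t")
    case False
    have "cutoff t s e t \<le> cutoff t s e w"
    proof (rule DERIV_nonneg_imp_nondecreasing[of t w])
      show "t \<le> w" using False by simp
      show "\<exists>y. (cutoff t s e has_real_derivative y) (at x) \<and> 0 \<le> y" for x
        by (intro exI[of _ "cutoff' t s e x"] conjI DERIV_cutoff d0)
    qed
    thus ?thesis using *[of t] by simp
  qed (simp add: *)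
qed

section \<open>Test functions and Cauchy-Schwarz on a set\<close>

lemma test_funD:
  assumes "test_fun \<Omega> \<phi>"
  shows "((\<lambda>t. \<phi> (x + t *\<^sub>R axis i 1)) has_real_derivative grad \<phi> x $ i) (at 0)"
    "continuous_on UNIV \<phi>" "continuous_on UNIV (grad \<phi>)"
    "compact (closure {x. \<phi> x \<noteq> 0})" "closure {x. \<phi> x \<noteq> 0} \<subseteq> \<Omega>"
    "x \<notin> closure {x. \<phi> x \<noteq> 0} \<Longrightarrow> \<phi> x = 0" "x \<notin> closure {x. \<phi> x \<noteq> 0} \<Longrightarrow> grad \<phi> x = 0"
proof -
  have s: "smooth_on UNIV \<phi>" using assms by (simp add: test_fun_def)
  have so: "continuous_on UNIV g \<and> (\<forall>i. \<forall>x\<in>UNIV. (\<lambda>t. g (x + t *\<^sub>R axis i 1)) differentiable (at 0))" if "higher_pd UNIV \<phi> g" for g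
    using s that by (simp add: smooth_on_def)
  have "(\<lambda>t. \<phi> (x + t *\<^sub>R axis i 1)) differentiable (at 0)" for x i
    using so[OF higher_pd.refl] by simp
  hence d: "((\<lambda>t. \<phi> (x + t *\<^sub>R axis i 1)) has_real_derivative grad \<phi> x $ i) (at 0)" for x i
    by (simp add: grad_def DERIV_deriv_iff_real_differentiable)
  show "((\<lambda>t. \<phi> (x + t *\<^sub>R axis i 1)) has_real_derivative grad \<phi> x $ i) (at 0)" by (rule d)
  show "continuous_on UNIV \<phi>" by (rule conjunct1[OF so[OF higher_pd.refl]])
  have "higher_pd UNIV \<phi> (\<lambda>x. grad \<phi> x $ i)" for i
    by (rule higher_pd.step[OF higher_pd.refl, of _ _ i]) (intro ballI d)
  hence "continuous_on UNIV (\<lambda>x. grad \<phi> x $ i)" for i by (rule conjunct1[OF so])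
  hence "continuous_on UNIV (\<lambda>x. \<chi> i. grad \<phi> x $ i)" by (rule continuous_on_vec_lambda)
  thus "continuous_on UNIV (grad \<phi>)" by simp
  show "compact (closure {x. \<phi> x \<noteq> 0})" "closure {x. \<phi> x \<noteq> 0} \<subseteq> \<Omega>"
    using assms by (simp_all add: test_fun_def)
  have cl: "\<phi> x = 0" if "x \<notin> closure {x. \<phi> x \<noteq> 0}" for x
    using that subsetD[OF closure_subset, of x "{x. \<phi> x \<noteq> 0}"] by blast
  show "\<phi> x = 0" if "x \<notin> closure {x. \<phi> x \<noteq> 0}" by (rule cl[OF that])
  show "grad \<phi> x = 0" if x: "x \<notin> closure {x. \<phi> x \<noteq> 0}"
  proof -
    have "grad \<phi> x $ i = 0" for i
    proof -
      let ?S = "(\<lambda>t. x + t *\<^sub>R axis i 1) -` (- closure {x. \<phi> x \<noteq> 0})"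
      have o: "open ?S" by (rule open_vimage, rule open_Compl, rule closed_closure) (intro continuous_intros)
      have "((\<lambda>t. \<phi> (x + t *\<^sub>R axis i 1)) has_real_derivative 0) (at 0)"
      proof (rule has_field_derivative_transform_within_open[OF DERIV_const o])
        show "0 \<in> ?S" using x by simp
        show "\<And>t. t \<in> ?S \<Longrightarrow> 0 = \<phi> (x + t *\<^sub>R axis i 1)"
          by (rule cl[symmetric]) simp
      qed
      thus ?thesis using DERIV_unique[OF d[of x i]] by simp
    qed
    thus ?thesis by (simp add: vec_eq_iff)
  qed
qed

lemma integral_Cauchy_Schwarz_set:
  fixes h :: "'a \<Rightarrow> real"
  assumes D: "D \<in> sets M" "emeasure M D < \<infinity>" and h: "integrable M (\<lambda>x. indicator D x * h x)" "integrable M (\<lambda>x. indicator D x * (h x)\<^sup>2)"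
  shows "(LINT x|M. indicator D x * h x)\<^sup>2 \<le> (LINT x|M. indicator D x * (h x)\<^sup>2) * measure M D"
proof -
  let ?A = "LINT x|M. indicator D x * (h x)\<^sup>2" and ?B = "LINT x|M. indicator D x * h x" and ?C = "measure M D"
  have iD: "integrable M (indicator D :: _ \<Rightarrow> real)" using D by (intro integrable_real_indicator) auto
  have q: "0 \<le> ?A - 2 * x * ?B + x\<^sup>2 * ?C" for x
  proof -
    have "0 \<le> (LINT y|M. indicator D y * (h y - x)\<^sup>2)" by (intro integral_nonneg_AE) simp
    also have "(\<lambda>y. indicator D y * (h y - x)\<^sup>2) = (\<lambda>y. indicator D y * (h y)\<^sup>2 - 2 * x * (indicator D y * h y) + x\<^sup>2 * indicator D y)"
      by (simp add: power2_eq_square algebra_simps fun_eq_iff)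
    also have "(LINT y|M. indicator D y * (h y)\<^sup>2 - 2 * x * (indicator D y * h y) + x\<^sup>2 * indicator D y) = ?A - 2 * x * ?B + x\<^sup>2 * ?C"
      using h iD D by (simp add: Int_absorb1 Int_absorb2 sets.sets_into_space)
    finally show ?thesis .
  qed
  show ?thesis
  proof (cases "?C = 0")
    case True
    have "?B = 0"
    proof (rule ccontr)
      assume "?B \<noteq> 0"
      \<comment> \<open>For a null set the quadratic polynomial is affine in \<open>x\<close>; this
        \<open>x\<close> gives it the value -1.\<close>
      hence "2 * ((?A + 1) / (2 * ?B)) * ?B = ?A + 1" by simp
      thus False using q[of "(?A + 1) / (2 * ?B)"] True by simp
    qed
    thus ?thesis using True by simp
  next
    case False
    hence C: "?C > 0" by (simp add: zero_less_measure_iff)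
    have "0 \<le> (?A - 2 * (?B / ?C) * ?B + (?B / ?C)\<^sup>2 * ?C) * ?C" using q[of "?B / ?C"] C by simp
    also have "\<dots> = ?A * ?C - ?B\<^sup>2" using C by (simp add: power2_eq_square field_simps)
    finally show ?thesis by simp
  qed
qed

lemma emeasure_open_pos:
  fixes S :: "'a::euclidean_space set"
  assumes "open S" "S \<noteq> {}" shows "emeasure lborel S > 0"
proof -
  obtain x where "x \<in> S" using assms by auto
  then obtain e where e: "e > 0" "ball x e \<subseteq> S" using assms openE by blast
  have "emeasure lborel (ball x e) = ennreal (unit_ball_vol (real DIM('a)) * e ^ DIM('a))"
    using e by (simp add: emeasure_ball)
  moreover have "unit_ball_vol (real DIM('a)) * e ^ DIM('a) > 0" using e by simp
  ultimately have "0 < emeasure lborel (ball x e)" by simp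
  also have "\<dots> \<le> emeasure lborel S" using e assms by (intro emeasure_mono) auto
  finally show ?thesis .
qed

section \<open>Area, exponential integral and energy of superlevel sets\<close>

locale level_sets =
  fixes \<Omega> :: "R2 set" and \<phi> :: "R2 \<Rightarrow> real"
  assumes o: "open \<Omega>" and mO: "measure lborel \<Omega> = pi" and tf: "test_fun \<Omega> \<phi>"
begin

abbreviation "K \<equiv> closure {x. \<phi> x \<noteq> 0}"
text \<open>The positive part makes level 0 the whole of \<Omega>, with area \<pi>. Replacing a test
  function by its positive part only raises the exponential integral, so an upper bound for the
  latter is enough.\<close>

definition V :: "real \<Rightarrow> R2 set" where "V t = {v\<in>\<Omega>. t \<le> max (\<phi> v) 0}"
definition m :: "real \<Rightarrow> real" where "m t = measure lborel (V t)"
definition F :: "real \<Rightarrow> real" where "F t = (LINT v|lborel. indicator (V t) v * exp (max (\<phi> v) 0))"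
definition G :: "real \<Rightarrow> real" where "G t = (LINT v|lborel. indicator (V t) v * (norm (grad \<phi> v))\<^sup>2)"

lemmas phi_cont = test_funD(2)[OF tf] and grad_cont = test_funD(3)[OF tf]

lemma in_O: "\<phi> v \<noteq> 0 \<Longrightarrow> v \<in> \<Omega>"
  using subsetD[OF test_funD(5)[OF tf], of v] test_funD(6)[OF tf, of v] by blast

lemma phi_meas [measurable]: "\<phi> \<in> borel_measurable borel"
  by (rule borel_measurable_continuous_onI[OF phi_cont])

lemma grad_meas [measurable]: "grad \<phi> \<in> borel_measurable borel"
  by (rule borel_measurable_continuous_onI[OF grad_cont])

lemma O_sets [measurable]: "\<Omega> \<in> sets borel" using o by simp

lemma V_sets [measurable]: "V t \<in> sets borel"
proof -
  have "closed {v. t \<le> max (\<phi> v) 0}" by (intro closed_Collect_le continuous_intros phi_cont)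
  moreover have "V t = \<Omega> \<inter> {v. t \<le> max (\<phi> v) 0}" by (auto simp: V_def)
  ultimately show ?thesis using O_sets by (simp add: sets.Int)
qed

lemma V0: "t \<le> 0 \<Longrightarrow> V t = \<Omega>" by (simp add: V_def max.coboundedI2)

lemma V_mono: "t \<le> s \<Longrightarrow> V s \<subseteq> V t" unfolding V_def by (blast intro: order_trans)

lemma O_fin: "emeasure lborel \<Omega> < \<infinity>"
  using mO by (cases "emeasure lborel \<Omega> = \<infinity>") (auto simp: measure_def top.not_eq_extremum)

lemma V_fin: "emeasure lborel (V t) < \<infinity>"
proof (rule le_less_trans[OF emeasure_mono O_fin])
  show "V t \<subseteq> \<Omega>" unfolding V_def by blast
qed simp

lemma int_V: "integrable lborel (indicator (V t) :: _ \<Rightarrow> real)"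
  by (rule integrable_real_indicator[OF _ V_fin]) simp

lemma int_grad: "integrable lborel (\<lambda>v. norm (grad \<phi> v))" "integrable lborel (\<lambda>v. (norm (grad \<phi> v))\<^sup>2)"
proof -
  show "integrable lborel (\<lambda>v. norm (grad \<phi> v))"
    by (rule integrable_cont_supp[OF continuous_on_norm[OF grad_cont] test_funD(4)[OF tf]]) (simp add: test_funD(7)[OF tf])
  show "integrable lborel (\<lambda>v. (norm (grad \<phi> v))\<^sup>2)"
    by (rule integrable_cont_supp[OF continuous_on_power[OF continuous_on_norm[OF grad_cont]] test_funD(4)[OF tf]])
       (simp add: test_funD(7)[OF tf])
qed

lemma int_exp: "integrable lborel (\<lambda>v. indicator \<Omega> v * exp (max (\<phi> v) 0))"
proof -
  have 1: "integrable lborel (\<lambda>v. exp (max (\<phi> v) 0) - 1)"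
  proof (rule integrable_cont_supp[OF _ test_funD(4)[OF tf]])
    show "continuous_on UNIV (\<lambda>v. exp (max (\<phi> v) 0) - 1)" by (intro continuous_intros phi_cont)
    show "exp (max (\<phi> v) 0) - 1 = 0" if "v \<notin> K" for v by (simp add: test_funD(6)[OF tf that])
  qed
  have 2: "integrable lborel (\<lambda>v. indicator \<Omega> v *\<^sub>R (exp (max (\<phi> v) 0) - 1))"
    by (rule integrable_mult_indicator[OF _ 1]) simp
  have "indicator \<Omega> v * exp (max (\<phi> v) 0) = indicator \<Omega> v *\<^sub>R (exp (max (\<phi> v) 0) - 1) + indicator (V 0) v" for v
    unfolding V0[OF order_refl] by (cases "v \<in> \<Omega>") simp_all
  thus ?thesis using Bochner_Integration.integrable_add[OF 2 int_V[of 0]] by (simp only:)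
qed

lemma int_F: "integrable lborel (\<lambda>v. indicator (V t) v * exp (max (\<phi> v) 0))"
proof -
  have "integrable lborel (\<lambda>v. indicator (V t) v *\<^sub>R (indicator \<Omega> v * exp (max (\<phi> v) 0)))"
    by (intro integrable_mult_indicator int_exp) simp
  moreover have "indicator (V t) v *\<^sub>R (indicator \<Omega> v * exp (max (\<phi> v) 0)) = indicator (V t) v * exp (max (\<phi> v) 0)" for v
    by (auto simp: indicator_def V_def)
  ultimately show ?thesis by (simp only:)
qed

lemma int_G: "S \<in> sets borel \<Longrightarrow> integrable lborel (\<lambda>v. indicator S v * (norm (grad \<phi> v))\<^sup>2)"
  using integrable_mult_indicator[OF _ int_grad(2), of S] by simp

lemma m_mono: "t \<le> s \<Longrightarrow> m s \<le> m t"
  unfolding m_def using V_mono V_fin by (intro measure_mono_fmeasurable) (auto simp: fmeasurable_def)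

lemma m0: "m 0 = pi" by (simp add: m_def V0 mO)

lemma m_le: "t \<ge> 0 \<Longrightarrow> m t \<le> pi" using m_mono[of 0 t] by (simp add: m0)

lemma int_indicator_V: "(LINT v|lborel. indicator (V t) v) = m t" by (simp add: m_def)

lemma F_lower: assumes "t \<ge> 0" shows "exp t * m t \<le> F t"
proof -
  have "exp t * m t = (LINT v|lborel. exp t * indicator (V t) v)" by (simp add: m_def)
  also have "\<dots> \<le> F t" unfolding F_def
    by (intro integral_mono integrable_mult_right int_V int_F) (auto simp: indicator_def V_def)
  finally show ?thesis .
qed

lemma F_step: assumes "t < s" shows "F t \<le> F s + exp s * (m t - m s)"
proof -
  have "F t \<le> (LINT v|lborel. indicator (V s) v * exp (max (\<phi> v) 0) + exp s * (indicator (V t) v - indicator (V s) v))"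
    unfolding F_def
  proof (intro integral_mono int_F Bochner_Integration.integrable_add integrable_mult_right Bochner_Integration.integrable_diff int_V)
    fix v show "indicator (V t) v * exp (max (\<phi> v) 0) \<le> indicator (V s) v * exp (max (\<phi> v) 0) + exp s * (indicator (V t) v - indicator (V s) v)"
      using V_mono[of t s] assms by (auto simp: indicator_def V_def)
  qed
  also have "\<dots> = F s + exp s * (m t - m s)"
    unfolding F_def m_def
    using int_F[of s] int_V[of s] int_V[of t] by simp
  finally show ?thesis .
qed

lemma F_upper: assumes "\<And>v. \<phi> v \<le> B" "B \<ge> 0" shows "F t \<le> exp B * m t"
proof -
  have "F t \<le> (LINT v|lborel. exp B * indicator (V t) v)" unfolding F_def
    using assms by (intro integral_mono integrable_mult_right int_V int_F) (auto simp: indicator_def)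
  thus ?thesis by (simp add: m_def)
qed

lemma G_diff: assumes "t \<le> s" shows "G t - G s = (LINT v|lborel. indicator (V t - V s) v * (norm (grad \<phi> v))\<^sup>2)"
proof -
  have "G t - G s = (LINT v|lborel. indicator (V t) v * (norm (grad \<phi> v))\<^sup>2 - indicator (V s) v * (norm (grad \<phi> v))\<^sup>2)"
    unfolding G_def using int_G[OF V_sets] by simp
  also have "\<dots> = (LINT v|lborel. indicator (V t - V s) v * (norm (grad \<phi> v))\<^sup>2)"
    using V_mono[OF assms] by (intro Bochner_Integration.integral_cong) (auto simp: indicator_def)
  finally show ?thesis .
qed

lemma G_mono: assumes "t \<le> s" shows "G s \<le> G t"
proof -
  have "0 \<le> G t - G s" unfolding G_diff[OF assms] by (intro integral_nonneg_AE) simp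
  thus ?thesis by simp
qed

lemma G_nonneg: "G t \<ge> 0" unfolding G_def by (intro integral_nonneg_AE) simp

text \<open>This takes the place of the coarea formula. The cutoff of \<phi> between the levels is
  an admissible \<open>f\<close> whose gradient lives in the layer \<open>V t - V s\<close> and is
  there at most \<open>norm (grad \<phi> v) / (s - t - 2 * e)\<close>; Cauchy-Schwarz on the layer
  brings in energy and area, and \<open>e\<close> tends to 0. \<open>C\<close> is left open so that
  both the classical and the improved isoperimetric bound can be inserted.\<close>

lemma step_of_iso:
  assumes ts: "0 \<le> t" "t < s"
    and C: "C \<ge> 0" "\<And>f p e. C1c f p \<Longrightarrow> (\<And>v. f v \<ge> 0) \<Longrightarrow> e > 0 \<Longrightarrow> (\<And>v. \<phi> v \<ge> s - e \<Longrightarrow> f v = 1) \<Longrightarrow> C \<le> (LINT v|lborel. norm (p v))\<^sup>2"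
  shows "C * (s - t)\<^sup>2 \<le> (G t - G s) * (m t - m s)"
proof -
  let ?D = "V t - V s"
  have D: "?D \<in> sets lborel" by simp
  have Dfin: "emeasure lborel ?D < \<infinity>" by (rule le_less_trans[OF emeasure_mono V_fin[of t]]) auto
  have h1: "integrable lborel (\<lambda>v. indicator ?D v * norm (grad \<phi> v))"
    using integrable_mult_indicator[OF D int_grad(1)] by simp
  have mD: "measure lborel ?D = m t - m s"
    unfolding m_def using V_fin[of t] V_mono[of t s] ts by (intro measure_Diff) auto
  let ?B = "LINT v|lborel. indicator ?D v * norm (grad \<phi> v)"
  have CS: "?B\<^sup>2 \<le> (G t - G s) * (m t - m s)"
    using integral_Cauchy_Schwarz_set[OF D Dfin h1 int_G] G_diff[of t s] ts by (simp add: mD)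
  have B0: "?B \<ge> 0" by (intro integral_nonneg_AE) simp
  have main: "C * (s - t - 2 * e)\<^sup>2 \<le> ?B\<^sup>2" if e: "e > 0" "4 * e < s - t" for e
  proof -
    define f where "f v = cutoff t s e (\<phi> v)" for v
    define p where "p v = cutoff' t s e (\<phi> v) *\<^sub>R grad \<phi> v" for v
    have q: "s - t - 2 * e > 0" using e by linarith
    have cc: "continuous_on UNIV (cutoff t s e)"
      using DERIV_isCont[OF DERIV_cutoff] by (intro continuous_at_imp_continuous_on) auto
    have "C1c f p"
      unfolding C1c_def
    proof (intro conjI allI exI[of _ K] impI)
      fix x i show "((\<lambda>t. f (x + t *\<^sub>R axis i 1)) has_real_derivative p x $ i) (at 0)"
        using DERIV_chain2[OF DERIV_cutoff test_funD(1)[OF tf, of x i]] by (simp add: f_def p_def)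
    next
      show "continuous_on UNIV f" unfolding f_def by (rule continuous_on_compose2[OF cc phi_cont]) simp
      show "continuous_on UNIV p" unfolding p_def cutoff'_def divide_inverse by (intro continuous_intros phi_cont grad_cont)
      show "compact K" by (rule test_funD(4)[OF tf])
      fix x assume "x \<notin> K"
      hence "\<phi> x = 0" "grad \<phi> x = 0" by (rule test_funD(6,7)[OF tf])+
      thus "f x = 0" "p x = 0" using ts cutoff_simps(1)[OF e, of 0] by (simp_all add: f_def p_def)
    qed
    hence "C \<le> (LINT v|lborel. norm (p v))\<^sup>2"
      by (rule C(2)[OF _ _ e(1)]) (use cutoff_simps(2,6)[OF e] in \<open>auto simp: f_def\<close>)
    also have "\<dots> \<le> (1 / (s - t - 2 * e) * ?B)\<^sup>2"
    proof (intro power_mono integral_nonneg_AE)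
      have "(LINT v|lborel. norm (p v)) \<le> (LINT v|lborel. 1 / (s - t - 2 * e) * (indicator ?D v * norm (grad \<phi> v)))"
      proof (rule integral_mono_AE')
        show "integrable lborel (\<lambda>v. 1 / (s - t - 2 * e) * (indicator ?D v * norm (grad \<phi> v)))"
          by (intro integrable_mult_right h1)
        have "norm (p v) \<le> 1 / (s - t - 2 * e) * (indicator ?D v * norm (grad \<phi> v))" for v
        proof (cases "\<phi> v \<le> t \<or> \<phi> v \<ge> s - e")
          case True
          thus ?thesis using cutoff_simps(5)[OF e True] q by (simp add: p_def)
        next
          case False
          hence "\<phi> v \<noteq> 0" using ts by auto
          hence "v \<in> \<Omega>" by (rule in_O)
          hence "v \<in> ?D" using False e ts by (auto simp: V_def)
          moreover have "cutoff' t s e (\<phi> v) * norm (grad \<phi> v) \<le> 1 / (s - t - 2 * e) * norm (grad \<phi> v)"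
            by (rule mult_right_mono[OF cutoff_simps(4)[OF e] norm_ge_zero])
          ultimately show ?thesis using cutoff_simps(3)[OF e, of "\<phi> v"] by (simp add: p_def)
        qed
        thus "AE v in lborel. norm (p v) \<le> 1 / (s - t - 2 * e) * (indicator ?D v * norm (grad \<phi> v))" by simp
      qed (use q in auto)
      thus "(LINT v|lborel. norm (p v)) \<le> 1 / (s - t - 2 * e) * ?B" by (simp only: Bochner_Integration.integral_mult_right_zero)
    qed auto
    finally have "C \<le> ?B\<^sup>2 / (s - t - 2 * e)\<^sup>2" by (simp add: power_mult_distrib power_divide)
    thus ?thesis using q by (simp add: pos_le_divide_eq)
  qed
  have "C * (s - t)\<^sup>2 \<le> ?B\<^sup>2"
  proof (rule tendsto_upperbound)
    have "((\<lambda>e. C * (s - t - 2 * e)\<^sup>2) \<longlongrightarrow> C * (s - t - 2 * 0)\<^sup>2) (at_right 0)" by (intro tendsto_intros)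
    thus "((\<lambda>e. C * (s - t - 2 * e)\<^sup>2) \<longlongrightarrow> C * (s - t)\<^sup>2) (at_right 0)" by simp
    show "\<forall>\<^sub>F e in at_right 0. C * (s - t - 2 * e)\<^sup>2 \<le> ?B\<^sup>2"
      unfolding eventually_at_right_field using main ts by (intro exI[of _ "(s - t) / 4"]) auto
  qed simp
  thus ?thesis using CS by linarith
qed

lemma step_iso:
  assumes ts: "0 \<le> t" "t < s"
  shows "4 * pi * 1 * (s - t)\<^sup>2 * m s \<le> (G t - G s) * (m t - m s)"
proof -
  have "(4 * pi * m s) * (s - t)\<^sup>2 \<le> (G t - G s) * (m t - m s)"
  proof (rule step_of_iso[OF ts])
    show "4 * pi * m s \<ge> 0" by (simp add: m_def)
    fix f p e assume f: "C1c f p" "\<And>v. 0 \<le> f v" "(e::real) > 0" "\<And>v. \<phi> v \<ge> s - e \<Longrightarrow> f v = 1"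
    \<comment> \<open>The bound by \<open>s\<close> makes \<psi> vanish where \<phi> is 0, hence
      outside a compact set; the bound by \<open>e\<close> keeps \<psi> within the region where
      \<open>f\<close> is 1.\<close>
    define e' where "e' = min e s"
    have e': "e' > 0" "e' \<le> s" "e' \<le> e" using f(3) ts by (auto simp: e'_def)
    define \<psi> where "\<psi> v = ramp e' (\<phi> v - (s - e'))" for v
    have c: "continuous_on UNIV \<psi>" unfolding \<psi>_def by (intro continuous_intros phi_cont)
    have pos: "\<psi> v > 0 \<Longrightarrow> \<phi> v > s - e'" for v
      using ramp_simps(1)[OF e'(1), of "\<phi> v - (s - e')"] by (force simp: \<psi>_def)
    have "4 * pi * (LINT v|lborel. \<psi> v) \<le> (LINT v|lborel. norm (p v))\<^sup>2"
    proof (rule isoperimetric[OF f(1,2) c])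
      show "0 \<le> \<psi> v" "\<psi> v \<le> 1" for v using ramp_simps(3,4)[OF e'(1)] by (auto simp: \<psi>_def)
      show "1 \<le> f v" if "0 < \<psi> v" for v using pos[OF that] f(4)[of v] e' by simp
    qed
    moreover have "m s \<le> (LINT v|lborel. \<psi> v)"
      unfolding int_indicator_V[symmetric]
    proof (rule integral_mono[OF int_V])
      show "integrable lborel \<psi>"
      proof (rule integrable_cont_supp[OF c test_funD(4)[OF tf]])
        fix v assume "v \<notin> K"
        hence "\<phi> v = 0" by (rule test_funD(6)[OF tf])
        thus "\<psi> v = 0" using ramp_simps(1)[OF e'(1)] e' by (simp add: \<psi>_def)
      qed
      show "indicator (V s) v \<le> \<psi> v" for v
      proof (cases "v \<in> V s")
        case True
        hence "\<phi> v \<ge> s" using ts by (auto simp: V_def max_def split: if_splits)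
        thus ?thesis using ramp_simps(2)[OF e'(1), of "\<phi> v - (s - e')"] by (simp add: \<psi>_def indicator_def)
      next
        case False thus ?thesis using ramp_simps(3)[OF e'(1)] by (simp add: \<psi>_def)
      qed
    qed
    ultimately show "4 * pi * m s \<le> (LINT v|lborel. norm (p v))\<^sup>2"
      using mult_left_mono[of "m s" "LINT v|lborel. \<psi> v" "4 * pi"] by (meson order_trans mult_nonneg_nonneg pi_ge_zero zero_le_numeral)
  qed
  thus ?thesis by (simp add: algebra_simps)
qed

lemma m_pos: assumes "\<exists>v. \<phi> v > S" "S \<ge> 0" shows "m S > 0"
proof -
  let ?U = "{v. S < \<phi> v}"
  have "open ?U" by (intro open_Collect_less continuous_intros phi_cont)
  moreover have "?U \<noteq> {}" using assms by auto
  ultimately have "emeasure lborel ?U > 0" by (rule emeasure_open_pos)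
  moreover have "?U \<subseteq> V S"
  proof (rule subsetI)
    fix v assume v: "v \<in> ?U"
    hence "\<phi> v \<noteq> 0" using assms by auto
    hence "v \<in> \<Omega>" by (rule in_O)
    thus "v \<in> V S" using v by (auto simp: V_def)
  qed
  hence "emeasure lborel ?U \<le> emeasure lborel (V S)" by (rule emeasure_mono) simp
  ultimately have "emeasure lborel (V S) > 0" by (rule order_less_le_trans)
  thus ?thesis unfolding m_def measure_def using V_fin[of S] by (simp add: enn2real_positive_iff)
qed

lemma excess_between_levels:
  assumes "0 \<le> T" "T < S" "m S > 0"
  shows "excess (F T / (exp T * m T)) \<le> excess (F S / (exp S * m S)) + (G T - G S) / (16 * pi * 1)"
proof (rule excess_band[where m=m and F=F and G=G and \<gamma>=1])
  show "T < S" "m S > 0" "(0::real) < 1" using assms by auto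
  fix t s assume ts: "T \<le> t" "t < s" "s \<le> S"
  hence t0: "0 \<le> t" using assms by linarith
  show "m s \<le> m t" by (rule m_mono) (use ts in linarith)
  show "F t \<le> F s + exp s * (m t - m s)" by (rule F_step[OF ts(2)])
  show "4 * pi * 1 * (s - t)\<^sup>2 * m s \<le> (G t - G s) * (m t - m s)" by (rule step_iso[OF t0 ts(2)])
next
  fix t assume "T \<le> t"
  thus "exp t * m t \<le> F t" using assms by (intro F_lower) linarith
qed

text \<open>Near the maximum \<open>B\<close> of \<phi> the values on \<open>V S\<close> lie between
  \<open>S\<close> and \<open>B\<close>, so the ratio there is at most \<open>exp (B - S)\<close>
  and its potential at most \<open>B - S\<close>. Starting from \<open>S\<close> and letting it tend
  to \<open>B\<close> leaves only the energy.\<close>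

lemma excess_le_energy:
  assumes T: "T \<ge> 0" "\<exists>v. \<phi> v > T"
  shows "excess (F T / (exp T * m T)) \<le> G T / (16 * pi)"
proof -
  obtain v0 where v0: "\<phi> v0 > T" using T by blast
  have "v0 \<in> K"
  proof (rule ccontr)
    assume "v0 \<notin> K"
    hence "\<phi> v0 = 0" by (rule test_funD(6)[OF tf])
    thus False using v0 T by simp
  qed
  hence "K \<noteq> {}" by (metis empty_iff)
  from continuous_attains_sup[OF test_funD(4)[OF tf] this continuous_on_subset[OF phi_cont subset_UNIV]]
  obtain x where x: "\<And>y. y \<in> K \<Longrightarrow> \<phi> y \<le> \<phi> x" by blast
  define B where "B = \<phi> x"
  have BT: "B > T" using x[OF \<open>v0 \<in> K\<close>] v0 by (simp add: B_def)
  have B: "\<phi> y \<le> B" for y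
  proof (cases "y \<in> K")
    case True thus ?thesis unfolding B_def by (rule x)
  next
    case False
    hence "\<phi> y = 0" by (rule test_funD(6)[OF tf])
    thus ?thesis using BT T by simp
  qed
  have main: "excess (F T / (exp T * m T)) \<le> (B - S) + G T / (16 * pi)" if S: "T < S" "S < B" for S
  proof -
    have mS: "m S > 0" using S T by (intro m_pos) (auto simp: B_def)
    let ?q = "F S / (exp S * m S)"
    have q1: "?q \<ge> 1" using F_lower[of S] mS S T by simp
    have "?q \<le> exp B * m S / (exp S * m S)"
      using F_upper[OF B] BT T mS by (intro divide_right_mono) auto
    also have "\<dots> = exp (B - S)" using mS by (simp add: exp_diff)
    finally have "excess ?q \<le> excess (exp (B - S))" by (rule excess_mono[OF q1])
    also have "\<dots> \<le> B - S"
      using S by (simp add: excess_def exp_minus[symmetric] divide_inverse)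
    finally have "excess ?q \<le> B - S" .
    moreover have "(G T - G S) / (16 * pi * 1) \<le> G T / (16 * pi)"
      using G_nonneg[of S] by (simp add: divide_right_mono)
    ultimately show ?thesis using excess_between_levels[OF T(1) S(1) mS] by linarith
  qed
  have "excess (F T / (exp T * m T)) \<le> 0 + G T / (16 * pi)"
  proof (rule tendsto_lowerbound)
    have "((\<lambda>S. (B - S) + G T / (16 * pi)) \<longlongrightarrow> (B - B) + G T / (16 * pi)) (at_left B)" by (intro tendsto_intros)
    thus "((\<lambda>S. (B - S) + G T / (16 * pi)) \<longlongrightarrow> 0 + G T / (16 * pi)) (at_left B)" by simp
    show "\<forall>\<^sub>F S in at_left B. excess (F T / (exp T * m T)) \<le> (B - S) + G T / (16 * pi)"
      unfolding eventually_at_left_field using main BT by (intro exI[of _ T]) auto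
  qed simp
  thus ?thesis by simp
qed

section \<open>The sharp inequality for test functions and its improvement\<close>

lemma F0_upper: assumes "\<And>v. \<phi> v \<le> B" "B \<ge> 0" shows "F 0 / pi \<le> exp B"
  using F_upper[OF assms, of 0] by (simp add: m0 pos_divide_le_eq)

lemma F0_ge: "F 0 / pi \<ge> 1" using F_lower[of 0] by (simp add: m0)

text \<open>The potential of the mean \<open>A\<close> is \<open>ln A - 1 + 1 / A\<close>. Dropping
  \<open>1 / A\<close> costs nothing when \<open>A\<close> tends to infinity, which is what happens
  along the bubbles.\<close>

lemma moser_trudinger: "ln (F 0 / pi) \<le> 1 + G 0 / (16 * pi)"
proof (cases "\<exists>v. \<phi> v > 0")
  case True
  have "excess (F 0 / pi) \<le> G 0 / (16 * pi)" using excess_le_energy[of 0] True by (simp add: m0)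
  moreover have "1 / (F 0 / pi) \<ge> 0"
    by (rule divide_nonneg_nonneg[OF zero_le_one order_trans[OF zero_le_one F0_ge]])
  ultimately show ?thesis by (simp add: excess_def)
next
  case False
  hence "F 0 / pi \<le> exp 0" by (intro F0_upper) (auto simp: not_less)
  hence "ln (F 0 / pi) \<le> 0" using F0_ge by simp
  thus ?thesis using G_nonneg[of 0] by (smt (verit) divide_nonneg_nonneg pi_gt_zero)
qed

text \<open>If the level set at height \<open>\<theta>\<close> still nearly fills \<open>\<Omega>\<close>, then all levels below \<open>\<theta>\<close> profit from the better
  isoperimetric constant and carry a definite amount of energy. Otherwise the area has already dropped by \<open>\<kappa>\<close> at
  the height \<open>\<kappa> / (2 \<pi>)\<close>, which is lower than the extremal profile would allow.\<close>

lemma moser_trudinger_gain: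
  assumes gain: "isoperimetric_gain \<Omega> \<gamma> \<kappa>"
  defines "\<theta> \<equiv> \<kappa> / (2 * pi)"
  defines "\<delta>\<^sub>1 \<equiv> (1 - 1 / \<gamma>) * (4 * pi * \<gamma> * \<theta>\<^sup>2 * (pi - \<kappa>) / \<kappa>) / (16 * pi)"
  shows "ln (F 0 / pi) \<le> 1 - min (1/2) (min \<delta>\<^sub>1 \<theta>) + G 0 / (16 * pi)"
proof -
  have \<gamma>: "\<gamma> > 1" and \<kappa>: "0 < \<kappa>" "\<kappa> < pi" using gain by (auto simp: isoperimetric_gain_def)
  have \<theta>: "\<theta> > 0" "\<theta> < 1/2" using \<kappa> by (simp_all add: \<theta>_def)
  have G0: "G 0 / (16 * pi) \<ge> 0" using G_nonneg by (intro divide_nonneg_nonneg) auto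
  show ?thesis
  proof (cases "\<exists>v. \<phi> v > \<theta>")
    \<comment> \<open>All values are at most \<theta>, which is below 1/2; this is the case that
      needs the entry 1/2 in the minimum.\<close>
    case False
    hence "F 0 / pi \<le> exp \<theta>" using \<theta> by (intro F0_upper) (auto simp: not_less)
    moreover have "F 0 / pi > 0" using F0_ge by linarith
    ultimately have "ln (F 0 / pi) \<le> \<theta>" using ln_le_cancel_iff[of "F 0 / pi" "exp \<theta>"] by simp
    thus ?thesis using \<theta> G0 by (simp add: min_def)
  next
    case True
    let ?q = "F \<theta> / (exp \<theta> * m \<theta>)"
    have mth: "m \<theta> > 0" using True \<theta> by (intro m_pos) auto
    have q1: "?q \<ge> 1" using F_lower[of \<theta>] \<theta> mth by simp
    have tq: "excess ?q \<le> G \<theta> / (16 * pi)" using excess_le_energy[of \<theta>] True \<theta> by simp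
    have A1: "F 0 / pi \<ge> 1" by (rule F0_ge)
    show ?thesis
    proof (cases "m \<theta> \<ge> pi - \<kappa>")
      case big: True
      have iso_step: "\<gamma> * (4 * pi\<^sup>2) * (s - t)\<^sup>2 \<le> (G t - G s) * (m t - m s)" if ts: "0 \<le> t" "t < s" "s \<le> \<theta>" for t s
      proof (rule step_of_iso[OF ts(1,2)])
        show "0 \<le> \<gamma> * (4 * pi\<^sup>2)" using \<gamma> by simp
        fix f p e assume f: "C1c f p" "\<And>v. 0 \<le> f v" "(e::real) > 0" "\<And>v. \<phi> v \<ge> s - e \<Longrightarrow> f v = 1"
        show "\<gamma> * (4 * pi\<^sup>2) \<le> (LINT v|lborel. norm (p v))\<^sup>2"
        proof -
          have 1: "V s \<subseteq> \<Omega>" by (auto simp: V_def)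
          have 2: "1 \<le> f v" if "v \<in> V s" for v
          proof -
            have "\<phi> v \<ge> s" using that ts by (auto simp: V_def max_def split: if_splits)
            thus ?thesis using f(3) f(4)[of v] by simp
          qed
          have "pi - \<kappa> \<le> m s" using big m_mono[OF ts(3)] by linarith
          hence "pi - \<kappa> \<le> measure lborel (V s)" by (simp add: m_def)
          from isoperimetric_gainD[OF gain f(1,2) V_sets 1 2 this] show ?thesis .
        qed
      qed
      have "excess (F 0 / (exp 0 * m 0)) \<le> excess ?q + (G 0 - G \<theta>) / (16 * pi * \<gamma>)"
      proof (rule excess_band[where m=m and F=F and G=G and \<gamma>=\<gamma>])
        show "0 < \<theta>" "m \<theta> > 0" "0 < \<gamma>" using \<theta> mth \<gamma> by auto
        fix t s :: real assume ts: "0 \<le> t" "t < s" "s \<le> \<theta>"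
        show "m s \<le> m t" by (rule m_mono) (use ts in linarith)
        show "F t \<le> F s + exp s * (m t - m s)" by (rule F_step[OF ts(2)])
        have "4 * pi * \<gamma> * (s - t)\<^sup>2 * m s \<le> 4 * pi * \<gamma> * (s - t)\<^sup>2 * pi"
          using m_le[of s] ts \<gamma> by (intro mult_left_mono) auto
        also have "\<dots> = \<gamma> * (4 * pi\<^sup>2) * (s - t)\<^sup>2" by (simp add: power2_eq_square)
        also note iso_step[OF ts]
        finally show "4 * pi * \<gamma> * (s - t)\<^sup>2 * m s \<le> (G t - G s) * (m t - m s)" .
      next
        fix t :: real assume "0 \<le> t" thus "exp t * m t \<le> F t" by (rule F_lower)
      qed
      hence ex: "excess (F 0 / pi) \<le> G \<theta> / (16 * pi) + (G 0 - G \<theta>) / (16 * pi * \<gamma>)" using tq by (simp add: m0)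
      \<comment> \<open>At most the area \<kappa> is lost between the levels 0 and \<theta>, so a
        single isoperimetric step forces this much energy there. The improved constant charges only
        the fraction \<open>1 / \<gamma>\<close> of it, and \<open>\<delta>\<^sub>1\<close> is the
        unspent share divided by \<open>16 * pi\<close>.\<close>
      have "4 * pi * \<gamma> * \<theta>\<^sup>2 * (pi - \<kappa>) / \<kappa> \<le> G 0 - G \<theta>"
      proof -
        have "4 * pi * \<gamma> * \<theta>\<^sup>2 * (pi - \<kappa>) \<le> 4 * pi * \<gamma> * \<theta>\<^sup>2 * pi" using \<gamma> \<kappa> by (intro mult_left_mono) auto
        also have "\<dots> = \<gamma> * (4 * pi\<^sup>2) * (\<theta> - 0)\<^sup>2" by (simp add: power2_eq_square)
        also have "\<dots> \<le> (G 0 - G \<theta>) * (m 0 - m \<theta>)" by (rule iso_step) (use \<theta> in auto)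
        also have "\<dots> \<le> (G 0 - G \<theta>) * \<kappa>"
          using big \<theta> G_mono[of 0 \<theta>] by (intro mult_left_mono) (auto simp: m0)
        finally show ?thesis using \<kappa> by (simp add: divide_le_eq)
      qed
      hence "(1 - 1 / \<gamma>) * (4 * pi * \<gamma> * \<theta>\<^sup>2 * (pi - \<kappa>) / \<kappa>) / (16 * pi) \<le> (1 - 1 / \<gamma>) * (G 0 - G \<theta>) / (16 * pi)"
        using \<gamma> by (intro divide_right_mono mult_left_mono) auto
      hence d: "\<delta>\<^sub>1 \<le> (1 - 1 / \<gamma>) * (G 0 - G \<theta>) / (16 * pi)" by (simp only: \<delta>\<^sub>1_def)
      have "G \<theta> / (16 * pi) + (G 0 - G \<theta>) / (16 * pi * \<gamma>) = G 0 / (16 * pi) - (1 - 1 / \<gamma>) * (G 0 - G \<theta>) / (16 * pi)"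
        using \<gamma> by (simp add: field_simps)
      hence "excess (F 0 / pi) \<le> G 0 / (16 * pi) - \<delta>\<^sub>1" using ex d by linarith
      moreover have "1 / (F 0 / pi) \<ge> 0"
        by (rule divide_nonneg_nonneg[OF zero_le_one order_trans[OF zero_le_one F0_ge]])
      ultimately have "ln (F 0 / pi) \<le> 1 - \<delta>\<^sub>1 + G 0 / (16 * pi)" unfolding excess_def by linarith
      moreover have "min (1/2) (min \<delta>\<^sub>1 \<theta>) \<le> \<delta>\<^sub>1" by simp
      ultimately show ?thesis by linarith
    next
      case small: False
      \<comment> \<open>With \<open>z = 1 / ?q\<close> the bound for \<open>F 0\<close> yields
        \<open>ln (F 0 / pi) \<le> \<theta> + ln ?q - k * (1 - z)\<close>, which equals
        \<open>1 + excess ?q + \<theta> - (z + k * (1 - z))\<close>. The bracket is at least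
        \<open>k\<close>, and the choice \<open>\<theta> = k / 2\<close> leaves a saving of
        \<theta>.\<close>
      define k where "k = \<kappa> / pi"
      have k: "0 < k" "k < 1" "\<theta> = k / 2" using \<kappa> by (simp_all add: k_def \<theta>_def)
      define z where "z = 1 / ?q"
      have q0: "?q > 0" using q1 by linarith
      have z: "0 < z" "z \<le> 1" using q1 q0 unfolding z_def by (simp_all only: zero_less_divide_1_iff divide_le_eq_1_pos)
      have "F 0 \<le> F \<theta> + exp \<theta> * (m 0 - m \<theta>)" by (rule F_step) (use \<theta> in simp)
      also have "\<dots> = exp \<theta> * (pi + (?q - 1) * m \<theta>)" using mth by (simp add: m0 field_simps)
      also have "\<dots> \<le> exp \<theta> * (pi + (?q - 1) * (pi - \<kappa>))"
        using small q1 by (intro mult_left_mono add_left_mono) auto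
      also have "pi + (?q - 1) * (pi - \<kappa>) = pi * (?q * (1 - k * (1 - z)))"
      proof -
        have "x * (1 / x) = 1" if "x > 0" for x :: real using that by simp
        from this[OF q0] have qz: "?q * z = 1" unfolding z_def .
        have "pi * k = \<kappa>" by (simp add: k_def)
        hence "pi + (?q - 1) * (pi - \<kappa>) = pi + (?q - 1) * (pi - pi * k)" by simp
        also have "\<dots> = pi * (?q - k * (?q - 1))" by (simp only: algebra_simps)
        also have "?q - k * (?q - 1) = ?q * (1 - k) + k * (?q * z)" unfolding qz by (simp only: algebra_simps)
        also have "\<dots> = ?q * (1 - k * (1 - z))" by (simp only: algebra_simps)
        finally show ?thesis .
      qed
      finally have "F 0 / pi \<le> exp \<theta> * (?q * (1 - k * (1 - z)))" by (simp add: pos_divide_le_eq mult.commute mult.left_commute)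
      moreover have kz: "1 - k * (1 - z) > 0"
      proof -
        have "k * (1 - z) \<le> k * 1" using k z by (intro mult_left_mono) auto
        thus ?thesis using k by linarith
      qed
      ultimately have "ln (F 0 / pi) \<le> ln (exp \<theta> * (?q * (1 - k * (1 - z))))"
      proof -
        assume le: "F 0 / pi \<le> exp \<theta> * (?q * (1 - k * (1 - z)))"
        have p0: "F 0 / pi > 0" using A1 by linarith
        have p1: "exp \<theta> * (?q * (1 - k * (1 - z))) > 0" by (intro mult_pos_pos exp_gt_zero q0 kz)
        show ?thesis by (rule ln_le_cancel_iff[OF p0 p1, THEN iffD2, OF le])
      qed
      also have "\<dots> = \<theta> + (ln ?q + ln (1 - k * (1 - z)))"
        using q0 kz by (simp only: ln_mult_pos mult_pos_pos exp_gt_zero ln_exp)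
      also have "ln (1 - k * (1 - z)) \<le> - (k * (1 - z))" using ln_le_minus_one[OF kz] by simp
      also have "ln ?q = excess ?q + 1 - z" unfolding excess_def z_def by simp
      finally have "ln (F 0 / pi) \<le> \<theta> + excess ?q + 1 - z - k * (1 - z)" by simp
      moreover have "z + k * (1 - z) = k + z * (1 - k)" by (simp add: algebra_simps)
      moreover have "z * (1 - k) \<ge> 0" using z k by simp
      moreover have "G \<theta> / (16 * pi) \<le> G 0 / (16 * pi)" using G_mono[of 0 \<theta>] \<theta> by (intro divide_right_mono) auto
      ultimately have "ln (F 0 / pi) \<le> 1 - \<theta> + G 0 / (16 * pi)" using tq k(3) by linarith
      moreover have "min (1/2) (min \<delta>\<^sub>1 \<theta>) \<le> \<theta>" by simp
      ultimately show ?thesis by linarith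
    qed
  qed
qed

end

text \<open>The form needed for the limit: a nonnegative integral, because the exponential of a
  limit in \<open>H10\<close> is not yet known to be integrable. \<delta> is 0 for the disc and
  positive for the other domains.\<close>

lemma test_fun_exp_bound:
  assumes o: "open \<Omega>" and mO: "measure lborel \<Omega> = pi" and tf: "test_fun \<Omega> \<phi>"
    and b: "\<And>\<phi>. test_fun \<Omega> \<phi> \<Longrightarrow> ln (level_sets.F \<Omega> \<phi> 0 / pi) \<le> 1 - \<delta> + level_sets.G \<Omega> \<phi> 0 / (16 * pi)"
  shows "(\<integral>\<^sup>+ v. ennreal (indicator \<Omega> v * exp (\<phi> v)) \<partial>lborel) \<le>
    ennreal (pi * exp (1 - \<delta> + (LINT v|lborel. indicator \<Omega> v * (norm (grad \<phi> v))\<^sup>2) / (16 * pi)))"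
proof -
  interpret level_sets \<Omega> \<phi> by unfold_locales (use o mO tf in auto)
  have "(\<integral>\<^sup>+ v. ennreal (indicator \<Omega> v * exp (\<phi> v)) \<partial>lborel) \<le> (\<integral>\<^sup>+ v. ennreal (indicator \<Omega> v * exp (max (\<phi> v) 0)) \<partial>lborel)"
    by (intro nn_integral_mono ennreal_leI mult_left_mono) auto
  also have "\<dots> = ennreal (LINT v|lborel. indicator \<Omega> v * exp (max (\<phi> v) 0))"
    by (rule nn_integral_eq_integral[OF int_exp]) simp
  also have "(LINT v|lborel. indicator \<Omega> v * exp (max (\<phi> v) 0)) = F 0" unfolding F_def V0[OF order_refl] ..
  also have "F 0 \<le> pi * exp (1 - \<delta> + G 0 / (16 * pi))"
  proof -
    have p: "F 0 / pi > 0" using F0_ge by linarith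
    have "F 0 / pi = exp (ln (F 0 / pi))" using p by (rule exp_ln[symmetric])
    also have "\<dots> \<le> exp (1 - \<delta> + G 0 / (16 * pi))" using b[OF tf] by simp
    finally show ?thesis by (simp add: pos_divide_le_eq mult.commute)
  qed
  also have "G 0 = (LINT v|lborel. indicator \<Omega> v * (norm (grad \<phi> v))\<^sup>2)" unfolding G_def V0[OF order_refl] ..
  finally show ?thesis by (simp add: ennreal_leI)
qed

section \<open>Passage to the Sobolev space\<close>

text \<open>Young's inequality with a free weight: the error term is sent to 0 for fixed
  \<open>k\<close>, and \<open>k\<close> afterwards.\<close>

lemma norm_sq_split:
  fixes a b :: "'a::real_normed_vector"
  assumes k: "k > 0"
  shows "(norm a)\<^sup>2 \<le> (1 + k) * (norm b)\<^sup>2 + (1 + 1 / k) * (norm (a - b))\<^sup>2"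
proof -
  let ?B = "norm b" and ?C = "norm (a - b)"
  have "norm a \<le> ?B + ?C" using norm_triangle_ineq[of b "a - b"] by simp
  hence "(norm a)\<^sup>2 \<le> (?B + ?C)\<^sup>2" by (intro power_mono) auto
  also have "\<dots> = ?B\<^sup>2 + 2 * ?B * ?C + ?C\<^sup>2" by (simp add: power2_eq_square algebra_simps)
  also have "2 * ?B * ?C = (k * ?B\<^sup>2 + ?C\<^sup>2 / k) - k * (?B - ?C / k)\<^sup>2"
    using k by (simp add: power2_eq_square field_simps)
  also have "?B\<^sup>2 + ((k * ?B\<^sup>2 + ?C\<^sup>2 / k) - k * (?B - ?C / k)\<^sup>2) + ?C\<^sup>2 \<le> ?B\<^sup>2 + (k * ?B\<^sup>2 + ?C\<^sup>2 / k) + ?C\<^sup>2"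
    using k by simp
  also have "\<dots> = (1 + k) * ?B\<^sup>2 + (1 + 1 / k) * ?C\<^sup>2" by (simp add: algebra_simps)
  finally show ?thesis .
qed

lemma L2_AE_subseq:
  fixes h :: "nat \<Rightarrow> 'a \<Rightarrow> real"
  assumes m: "\<And>n. h n \<in> borel_measurable M"
    and lim: "(\<lambda>n. \<integral>\<^sup>+ x. ennreal ((h n x)\<^sup>2) \<partial>M) \<longlonglongrightarrow> 0"
  obtains r :: "nat \<Rightarrow> nat" where "strict_mono r" "AE x in M. (\<lambda>n. h (r n) x) \<longlonglongrightarrow> 0"
proof -
  let ?I = "\<lambda>n. \<integral>\<^sup>+ x. ennreal ((h n x)\<^sup>2) \<partial>M"
  have "eventually (\<lambda>n. ?I n < 1) sequentially" using lim by (rule order_tendstoD) simp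
  then obtain N where N: "\<And>n. n \<ge> N \<Longrightarrow> ?I n < 1" unfolding eventually_sequentially by blast
  \<comment> \<open>The first members of the sequence may have infinite integral; after the shift by
    \<open>N\<close> all are integrable, as the extraction of a subsequence from L1 convergence
    requires.\<close>
  define w where "w n x = (h (n + N) x)\<^sup>2" for n x
  have wm [measurable]: "w n \<in> borel_measurable M" for n unfolding w_def using m[of "n + N"] by measurable
  have fin: "(\<integral>\<^sup>+ x. ennreal (w n x) \<partial>M) < \<infinity>" for n
    using order.strict_trans[OF N[of "n + N"] ennreal_one_less_top] unfolding w_def by simp
  have wi: "integrable M (w n)" for n
    by (rule integrableI_nonneg[OF wm _ fin]) (simp add: w_def)
  have "(\<lambda>n. LINT x|M. norm (w n x)) \<longlonglongrightarrow> 0"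
  proof -
    have "(LINT x|M. norm (w n x)) = enn2real (?I (n + N))" for n
    proof -
      have "(LINT x|M. norm (w n x)) = (LINT x|M. w n x)" by (simp add: w_def)
      also have "\<dots> = enn2real (\<integral>\<^sup>+ x. ennreal (w n x) \<partial>M)"
        by (rule integral_eq_nn_integral[OF wm]) (simp add: w_def)
      finally show ?thesis by (simp add: w_def)
    qed
    moreover have "(\<lambda>n. enn2real (?I (n + N))) \<longlonglongrightarrow> 0"
      by (rule tendsto_enn2real) (use LIMSEQ_ignore_initial_segment[OF lim, of N] in simp_all)
    ultimately show ?thesis by simp
  qed
  from tendsto_L1_AE_subseq[OF wi this]
  obtain r where r: "strict_mono r" "AE x in M. (\<lambda>n. w (r n) x) \<longlonglongrightarrow> 0" by blast
  have "AE x in M. (\<lambda>n. h (r n + N) x) \<longlonglongrightarrow> 0"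
    using r(2)
  proof eventually_elim
    case (elim x)
    hence "(\<lambda>n. sqrt (w (r n) x)) \<longlonglongrightarrow> sqrt 0" by (rule tendsto_real_sqrt)
    hence "(\<lambda>n. \<bar>h (r n + N) x\<bar>) \<longlonglongrightarrow> 0" by (simp add: w_def)
    thus ?case by (rule tendsto_rabs_zero_cancel)
  qed
  moreover have "strict_mono (\<lambda>n. r n + N)" using r(1) by (auto simp: strict_mono_def)
  ultimately show ?thesis using that[of "\<lambda>n. r n + N"] by blast
qed

text \<open>The energies are controlled by convergence in L2. The exponential integral passes to the
  limit by Fatou's lemma along a subsequence that converges almost everywhere, and only an upper
  bound for it is wanted.\<close>

lemma I8pi_lower:
  assumes o: "open \<Omega>" and mO: "measure lebesgue \<Omega> = pi" and H: "H10 \<Omega> u g" and \<delta>: "\<delta> \<le> 1"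
    and b: "\<And>\<phi>. test_fun \<Omega> \<phi> \<Longrightarrow> (\<integral>\<^sup>+ v. ennreal (indicator \<Omega> v * exp (\<phi> v)) \<partial>lborel) \<le>
       ennreal (pi * exp (1 - \<delta> + (LINT v|lborel. indicator \<Omega> v * (norm (grad \<phi> v))\<^sup>2) / (16 * pi)))"
  shows "- 1 + \<delta> \<le> I8pi \<Omega> u g"
proof -
  from H obtain \<phi> where um: "u \<in> borel_measurable lebesgue" and gm: "g \<in> borel_measurable lebesgue"
    and t: "\<And>n. test_fun \<Omega> (\<phi> n)"
    and lu: "(\<lambda>n. \<integral>\<^sup>+ x. ennreal ((\<phi> n x - u x)\<^sup>2) \<partial>lebesgue) \<longlonglongrightarrow> 0"
    and lg: "(\<lambda>n. \<integral>\<^sup>+ x. ennreal ((norm (grad (\<phi> n) x - g x))\<^sup>2) \<partial>lebesgue) \<longlonglongrightarrow> 0"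
    unfolding H10_def by blast
  note [measurable] = um gm
  have pm: "\<phi> n \<in> borel_measurable borel" for n by (rule borel_measurable_continuous_onI[OF test_funD(2)[OF t]])
  have gpm: "grad (\<phi> n) \<in> borel_measurable borel" for n by (rule borel_measurable_continuous_onI[OF test_funD(3)[OF t]])
  have pml [measurable]: "\<phi> n \<in> borel_measurable lebesgue" and gpml [measurable]: "grad (\<phi> n) \<in> borel_measurable lebesgue" for n
    using pm[of n] gpm[of n] by (auto intro: measurable_completion)
  have Ob: "\<Omega> \<in> sets borel" using o by simp
  hence Ol [measurable]: "\<Omega> \<in> sets lebesgue" by (simp add: sets_completionI_sets)
  define D where "D n = (LINT v|lborel. indicator \<Omega> v * (norm (grad (\<phi> n) v))\<^sup>2)" for n
  define e where "e n = enn2real (\<integral>\<^sup>+ x. ennreal ((norm (grad (\<phi> n) x - g x))\<^sup>2) \<partial>lebesgue)" for n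
  define X where "X = (LINT v|lebesgue. indicator \<Omega> v * (norm (g v))\<^sup>2)"
  have e0: "e \<longlonglongrightarrow> 0" unfolding e_def by (rule tendsto_enn2real) (use lg in simp_all)
  have "eventually (\<lambda>n. (\<integral>\<^sup>+ x. ennreal ((norm (grad (\<phi> n) x - g x))\<^sup>2) \<partial>lebesgue) < 1) sequentially"
    using lg by (rule order_tendstoD) simp
  then obtain N where N: "\<And>n. n \<ge> N \<Longrightarrow> (\<integral>\<^sup>+ x. ennreal ((norm (grad (\<phi> n) x - g x))\<^sup>2) \<partial>lebesgue) < 1"
    unfolding eventually_sequentially by blast
  have ei: "integrable lebesgue (\<lambda>x. (norm (grad (\<phi> n) x - g x))\<^sup>2)" if "n \<ge> N" for n
    by (rule integrableI_nonneg) (use order.strict_trans[OF N[OF that] ennreal_one_less_top] in auto)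
  have ee: "e n = (LINT x|lebesgue. (norm (grad (\<phi> n) x - g x))\<^sup>2)" for n
    unfolding e_def by (rule integral_eq_nn_integral[symmetric]) auto
  have gi0: "integrable lborel (\<lambda>v. (norm (grad (\<phi> n) v))\<^sup>2)" for n
  proof (rule integrable_cont_supp[OF continuous_on_power[OF continuous_on_norm[OF test_funD(3)[OF t]]] test_funD(4)[OF t]])
    fix x assume "x \<notin> closure {x. \<phi> n x \<noteq> 0}"
    hence "grad (\<phi> n) x = 0" by (rule test_funD(7)[OF t])
    thus "(norm (grad (\<phi> n) x))\<^sup>2 = 0" by simp
  qed
  have gi: "integrable lebesgue (\<lambda>v. (norm (grad (\<phi> n) v))\<^sup>2)" for n
    using gi0[of n] by (subst integrable_completion) (use gpm[of n] in measurable)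
  have giO: "integrable lebesgue (\<lambda>v. indicator \<Omega> v * (norm (grad (\<phi> n) v))\<^sup>2)" for n
    using integrable_mult_indicator[OF Ol gi[of n]] by simp
  have De: "D n = (LINT v|lebesgue. indicator \<Omega> v * (norm (grad (\<phi> n) v))\<^sup>2)" for n
    unfolding D_def by (rule integral_completion[symmetric]) (use gpm[of n] Ob in measurable)
  have gX: "integrable lebesgue (\<lambda>v. (norm (g v))\<^sup>2)"
  proof (rule Bochner_Integration.integrable_bound)
    show "integrable lebesgue (\<lambda>v. 2 * (norm (grad (\<phi> N) v))\<^sup>2 + 2 * (norm (grad (\<phi> N) v - g v))\<^sup>2)"
      by (intro Bochner_Integration.integrable_add integrable_mult_right gi ei) simp
    show "AE v in lebesgue. norm ((norm (g v))\<^sup>2) \<le> norm (2 * (norm (grad (\<phi> N) v))\<^sup>2 + 2 * (norm (grad (\<phi> N) v - g v))\<^sup>2)"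
    proof (rule AE_I2)
      fix v show "norm ((norm (g v))\<^sup>2) \<le> norm (2 * (norm (grad (\<phi> N) v))\<^sup>2 + 2 * (norm (grad (\<phi> N) v - g v))\<^sup>2)"
        using norm_sq_split[of 1 "g v" "grad (\<phi> N) v"] by (simp add: norm_minus_commute)
    qed
  qed measurable
  have gXO: "integrable lebesgue (\<lambda>v. indicator \<Omega> v * (norm (g v))\<^sup>2)"
    using integrable_mult_indicator[OF Ol gX] by simp
  have X0: "X \<ge> 0" unfolding X_def by (intro integral_nonneg_AE) simp
  have Dle: "D n \<le> (1 + k) * X + (1 + 1 / k) * e n" if n: "n \<ge> N" and k: "k > 0" for n k
  proof -
    have "D n \<le> (LINT v|lebesgue. (1 + k) * (indicator \<Omega> v * (norm (g v))\<^sup>2) + (1 + 1 / k) * (norm (grad (\<phi> n) v - g v))\<^sup>2)"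
      unfolding De
    proof (intro integral_mono giO Bochner_Integration.integrable_add integrable_mult_right gXO ei n)
      fix v
      have "0 \<le> (1 + 1 / k) * (norm (grad (\<phi> n) v - g v))\<^sup>2" using k by simp
      thus "indicator \<Omega> v * (norm (grad (\<phi> n) v))\<^sup>2 \<le> (1 + k) * (indicator \<Omega> v * (norm (g v))\<^sup>2) + (1 + 1 / k) * (norm (grad (\<phi> n) v - g v))\<^sup>2"
        using norm_sq_split[OF k, of "grad (\<phi> n) v" "g v"] by (cases "v \<in> \<Omega>") simp_all
    qed
    also have "\<dots> = (1 + k) * X + (1 + 1 / k) * e n"
      unfolding X_def ee by (simp only: Bochner_Integration.integral_add integrable_mult_right gXO ei[OF n] Bochner_Integration.integral_mult_right_zero)
    finally show ?thesis .
  qed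
  have "(\<lambda>x. \<phi> n x - u x) \<in> borel_measurable lebesgue" for n by measurable
  from L2_AE_subseq[OF this lu]
  obtain r where r: "strict_mono r" "AE x in lebesgue. (\<lambda>n. \<phi> (r n) x - u x) \<longlonglongrightarrow> 0" by blast
  define J where "J = (\<integral>\<^sup>+ v. ennreal (indicator \<Omega> v * exp (u v)) \<partial>lebesgue)"
  have Jk: "J \<le> ennreal (pi * exp (1 - \<delta> + ((1 + k) * X) / (16 * pi)))" if k: "k > 0" for k
  proof -
    have "J = (\<integral>\<^sup>+ v. liminf (\<lambda>n. ennreal (indicator \<Omega> v * exp (\<phi> (r n) v))) \<partial>lebesgue)"
      unfolding J_def
    proof (rule nn_integral_cong_AE)
      show "AE v in lebesgue. ennreal (indicator \<Omega> v * exp (u v)) = liminf (\<lambda>n. ennreal (indicator \<Omega> v * exp (\<phi> (r n) v)))"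
        using r(2)
      proof eventually_elim
        case (elim v)
        have "(\<lambda>n. \<phi> (r n) v) \<longlonglongrightarrow> u v" using elim by (simp add: LIM_zero_iff)
        hence "(\<lambda>n. ennreal (indicator \<Omega> v * exp (\<phi> (r n) v))) \<longlonglongrightarrow> ennreal (indicator \<Omega> v * exp (u v))"
          by (intro tendsto_ennrealI tendsto_intros)
        thus ?case by (rule lim_imp_Liminf[symmetric, OF sequentially_bot])
      qed
    qed
    also have "\<dots> \<le> liminf (\<lambda>n. \<integral>\<^sup>+ v. ennreal (indicator \<Omega> v * exp (\<phi> (r n) v)) \<partial>lebesgue)"
      by (rule nn_integral_liminf) measurable
    also have "\<dots> \<le> liminf (\<lambda>n. ennreal (pi * exp (1 - \<delta> + ((1 + k) * X + (1 + 1 / k) * e (r n)) / (16 * pi))))"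
    proof (rule Liminf_mono)
      have "(\<integral>\<^sup>+ v. ennreal (indicator \<Omega> v * exp (\<phi> (r n) v)) \<partial>lebesgue) \<le> ennreal (pi * exp (1 - \<delta> + ((1 + k) * X + (1 + 1 / k) * e (r n)) / (16 * pi)))"
        if n: "n \<ge> N" for n
      proof -
        have rn: "r n \<ge> N" using seq_suble[OF r(1), of n] n by linarith
        have "(\<integral>\<^sup>+ v. ennreal (indicator \<Omega> v * exp (\<phi> (r n) v)) \<partial>lebesgue) = (\<integral>\<^sup>+ v. ennreal (indicator \<Omega> v * exp (\<phi> (r n) v)) \<partial>lborel)"
          by (rule nn_integral_completion)
        also have "\<dots> \<le> ennreal (pi * exp (1 - \<delta> + D (r n) / (16 * pi)))"
          using b[OF t[of "r n"]] unfolding D_def .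
        also have "\<dots> \<le> ennreal (pi * exp (1 - \<delta> + ((1 + k) * X + (1 + 1 / k) * e (r n)) / (16 * pi)))"
        proof -
          have "D (r n) / (16 * pi) \<le> ((1 + k) * X + (1 + 1 / k) * e (r n)) / (16 * pi)"
            by (rule divide_right_mono[OF Dle[OF rn k]]) simp
          thus ?thesis by (intro ennreal_leI mult_left_mono) auto
        qed
        finally show ?thesis .
      qed
      thus "\<forall>\<^sub>F n in sequentially. (\<integral>\<^sup>+ v. ennreal (indicator \<Omega> v * exp (\<phi> (r n) v)) \<partial>lebesgue) \<le> ennreal (pi * exp (1 - \<delta> + ((1 + k) * X + (1 + 1 / k) * e (r n)) / (16 * pi)))"
        unfolding eventually_sequentially by blast
    qed
    also have "\<dots> = ennreal (pi * exp (1 - \<delta> + ((1 + k) * X + (1 + 1 / k) * 0) / (16 * pi)))"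
    proof (rule lim_imp_Liminf[OF sequentially_bot])
      have "(\<lambda>n. e (r n)) \<longlonglongrightarrow> 0" using LIMSEQ_subseq_LIMSEQ[OF e0 r(1)] by (simp add: o_def)
      thus "(\<lambda>n. ennreal (pi * exp (1 - \<delta> + ((1 + k) * X + (1 + 1 / k) * e (r n)) / (16 * pi)))) \<longlonglongrightarrow> ennreal (pi * exp (1 - \<delta> + ((1 + k) * X + (1 + 1 / k) * 0) / (16 * pi)))"
        by (intro tendsto_ennrealI tendsto_intros) auto
    qed
    finally show ?thesis by simp
  qed
  have J: "J \<le> ennreal (pi * exp (1 - \<delta> + X / (16 * pi)))"
  proof (rule tendsto_lowerbound)
    have "((\<lambda>k. ennreal (pi * exp (1 - \<delta> + ((1 + k) * X) / (16 * pi)))) \<longlongrightarrow> ennreal (pi * exp (1 - \<delta> + ((1 + 0) * X) / (16 * pi)))) (at_right 0)"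
      by (intro tendsto_ennrealI tendsto_intros) auto
    thus "((\<lambda>k. ennreal (pi * exp (1 - \<delta> + ((1 + k) * X) / (16 * pi)))) \<longlongrightarrow> ennreal (pi * exp (1 - \<delta> + X / (16 * pi)))) (at_right 0)" by simp
    show "\<forall>\<^sub>F k in at_right 0. J \<le> ennreal (pi * exp (1 - \<delta> + ((1 + k) * X) / (16 * pi)))"
      unfolding eventually_at_right_field using Jk by (intro exI[of _ 1]) auto
  qed simp
  define A where "A = 1 / measure lebesgue \<Omega> * (LINT x:\<Omega>|lebesgue. exp (u x))"
  have A: "A = 1 / pi * enn2real J"
  proof -
    have "(LINT x:\<Omega>|lebesgue. exp (u x)) = (LINT v|lebesgue. indicator \<Omega> v * exp (u v))"
      by (simp add: set_lebesgue_integral_def)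
    also have "\<dots> = enn2real J" unfolding J_def
    proof (rule integral_eq_nn_integral)
      show "(\<lambda>v. indicator \<Omega> v * exp (u v)) \<in> borel_measurable lebesgue" by measurable
    qed simp
    finally show ?thesis unfolding A_def mO by simp
  qed
  have A0: "A \<ge> 0" unfolding A by simp
  have AX: "A \<le> exp (1 - \<delta> + X / (16 * pi))"
  proof -
    have "enn2real J \<le> pi * exp (1 - \<delta> + X / (16 * pi))"
      using enn2real_mono[OF J] by simp
    thus ?thesis unfolding A by (simp add: pos_divide_le_eq mult.commute)
  qed
  have "ln A \<le> 1 - \<delta> + X / (16 * pi)"
  proof (cases "A = 0")
    \<comment> \<open>Here \<open>ln 0 = 0\<close>, so the claim rests on
      \<open>\<delta> \<le> 1\<close>.\<close>
    case True
    have "X / (16 * pi) \<ge> 0" using X0 by simp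
    thus ?thesis using True \<delta> by simp
  next
    case False
    hence "A > 0" using A0 by simp
    thus ?thesis using AX ln_le_cancel_iff[of A "exp (1 - \<delta> + X / (16 * pi))"] by simp
  qed
  moreover have "I8pi \<Omega> u g = X / (16 * pi) - ln A"
    unfolding I8pi_def A_def X_def set_lebesgue_integral_def by simp
  ultimately show ?thesis by linarith
qed

lemma test_fun_H10:
  assumes "test_fun \<Omega> \<phi>"
  shows "H10 \<Omega> \<phi> (grad \<phi>)"
  unfolding H10_def
proof (intro conjI exI[of _ "\<lambda>n. \<phi>"] allI)
  show "\<phi> \<in> borel_measurable lebesgue" "grad \<phi> \<in> borel_measurable lebesgue"
    using borel_measurable_continuous_onI[OF test_funD(2)[OF assms]] borel_measurable_continuous_onI[OF test_funD(3)[OF assms]]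
    by (auto intro: measurable_completion)
qed (use assms in simp_all)

section \<open>Concentrating test functions\<close>

text \<open>Derivatives are unique, so a class of functions that contains a partial derivative of
  each member in each direction contains everything \<open>higher_pd\<close> can reach.\<close>

lemma smooth_onI:
  assumes f: "f \<in> C" and c: "\<And>g. g \<in> C \<Longrightarrow> continuous_on UNIV g"
    and d: "\<And>g i. g \<in> C \<Longrightarrow> \<exists>g'\<in>C. \<forall>x. ((\<lambda>t. g (x + t *\<^sub>R axis i 1)) has_real_derivative g' x) (at 0)"
  shows "smooth_on UNIV f"
proof -
  have C: "g \<in> C" if "higher_pd UNIV f' g" "f' \<in> C" for f' g
    using that
  proof (induction rule: higher_pd.induct)
    case (step f g i h)
    from d[OF step.IH[OF step.prems], of i] obtain g' where g': "g' \<in> C" "\<forall>x. ((\<lambda>t. g (x + t *\<^sub>R axis i 1)) has_real_derivative g' x) (at 0)" by blast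
    have "h x = g' x" for x using step.hyps(2) g'(2) DERIV_unique by blast
    hence "h = g'" by (rule ext)
    thus ?case using g'(1) by simp
  qed
  show ?thesis unfolding smooth_on_def
  proof (intro allI impI conjI ballI)
    fix g assume g: "higher_pd UNIV f g"
    show "continuous_on UNIV g" by (rule c[OF C[OF g f]])
    fix i x from d[OF C[OF g f], of i] show "(\<lambda>t. g (x + t *\<^sub>R axis i 1)) differentiable (at 0)"
      by (meson real_differentiable_def)
  qed
qed

lemma test_fun_0: "test_fun \<Omega> (\<lambda>_. 0)"
proof -
  have "smooth_on UNIV (\<lambda>_. 0)"
  proof (rule smooth_onI[where C="{\<lambda>_. 0}"])
    fix g :: "R2 \<Rightarrow> real" and i :: 2 assume "g \<in> {\<lambda>_. 0}"
    thus "\<exists>g'\<in>{\<lambda>_. 0}. \<forall>x. ((\<lambda>t. g (x + t *\<^sub>R axis i 1)) has_real_derivative g' x) (at 0)"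
      by simp
  qed auto
  thus ?thesis by (simp add: test_fun_def)
qed

text \<open>The truncation \<open>t \<mapsto> t exp (- d / t)\<close> (for \<open>t > 0\<close>) has its derivative in \<open>[0, 1]\<close> and differs from \<open>t\<close> by at
  most \<open>d\<close>; the powers of \<open>1 / t\<close> make the family closed under differentiation.\<close>

definition flat :: "real \<Rightarrow> nat \<Rightarrow> real \<Rightarrow> real" where
  "flat d k t = (if t > 0 then (1 / t) ^ k * exp (- d / t) else 0)"

text \<open>The exponential \<open>exp (d / t)\<close> dominates the power \<open>k + 2\<close> of
  \<open>d / t\<close> up to a constant. The two powers beyond \<open>k\<close> give the factor
  \<open>t^2\<close>, which makes \<open>flat\<close> differentiable at 0 with derivative 0.\<close>

lemma flat_bound:
  assumes d: "d > 0"
  obtains B where "\<And>t. \<bar>flat d k t\<bar> \<le> B * t\<^sup>2"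
proof -
  define n where "n = k + 2"
  define B where "B = (real n / d) ^ n"
  have "\<bar>flat d k t\<bar> \<le> B * t\<^sup>2" for t
  proof (cases "t > 0")
    case True
    have n: "n \<ge> 1" by (simp add: n_def)
    have "(1 + (d / t) / real n) ^ n \<le> exp (d / t)"
    proof (rule exp_ge_one_plus_x_over_n_power_n)
      have "0 \<le> d / t" using True d by simp
      thus "- real n \<le> d / t" by linarith
    qed (simp add: n_def)
    moreover have "((d / t) / real n) ^ n \<le> (1 + (d / t) / real n) ^ n"
      using True d by (intro power_mono) auto
    ultimately have e: "((d / t) / real n) ^ n \<le> exp (d / t)" by linarith
    have "(1 / t) ^ n = B * ((d / t) / real n) ^ n"
      using d n unfolding B_def power_mult_distrib[symmetric] by simp
    also have "\<dots> \<le> B * exp (d / t)" using e d by (intro mult_left_mono) (auto simp: B_def)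
    finally have "(1 / t) ^ n * exp (- d / t) \<le> B * exp (d / t) * exp (- d / t)" by (rule mult_right_mono) simp
    also have "\<dots> = B" by (simp add: mult.assoc exp_add[symmetric])
    finally have "((1 / t) ^ n * exp (- d / t)) * t\<^sup>2 \<le> B * t\<^sup>2" by (rule mult_right_mono) simp
    moreover have "(1 / t) ^ n * t\<^sup>2 = (1 / t) ^ k"
      using True by (simp add: n_def power_add power2_eq_square)
    moreover have "((1 / t) ^ n * exp (- d / t)) * t\<^sup>2 = ((1 / t) ^ n * t\<^sup>2) * exp (- d / t)" by (simp only: ac_simps)
    ultimately have "(1 / t) ^ k * exp (- d / t) \<le> B * t\<^sup>2" by (simp only:)
    thus ?thesis using True by (simp add: flat_def abs_mult)
  next
    case False
    have "B \<ge> 0" using d by (simp add: B_def)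
    thus ?thesis using False by (simp add: flat_def)
  qed
  thus ?thesis using that by blast
qed

lemma DERIV_flat:
  assumes d: "d > 0"
  shows "(flat d k has_real_derivative - real k * flat d (k + 1) t + d * flat d (k + 2) t) (at t)"
proof -
  consider "t > 0" | "t = 0" | "t < 0" by linarith
  thus ?thesis
  proof cases
    case 1
    have "((\<lambda>t. (1 / t) ^ k * exp (- d / t)) has_real_derivative
        (real k * (- 1 / t\<^sup>2 * (1 / t) ^ (k - 1))) * exp (- d / t) + (exp (- d / t) * (d / t\<^sup>2)) * (1 / t) ^ k) (at t)"
    proof (rule DERIV_mult)
      have i: "((\<lambda>t. 1 / t) has_real_derivative - 1 / t\<^sup>2) (at t)"
        using 1 by (auto intro!: derivative_eq_intros simp: power2_eq_square)
      show "((\<lambda>t. (1 / t) ^ k) has_real_derivative real k * (- 1 / t\<^sup>2 * (1 / t) ^ (k - 1))) (at t)"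
        using DERIV_power[OF i, of k] by simp
      have "((\<lambda>t. - d / t) has_real_derivative d / t\<^sup>2) (at t)"
        using 1 by (auto intro!: derivative_eq_intros simp: power2_eq_square)
      from DERIV_chain2[OF DERIV_exp this]
      show "((\<lambda>t. exp (- d / t)) has_real_derivative exp (- d / t) * (d / t\<^sup>2)) (at t)" .
    qed
    also have "(real k * (- 1 / t\<^sup>2 * (1 / t) ^ (k - 1))) * exp (- d / t) + (exp (- d / t) * (d / t\<^sup>2)) * (1 / t) ^ k
       = - real k * flat d (k + 1) t + d * flat d (k + 2) t"
    proof -
      have "real k * (- 1 / t\<^sup>2 * (1 / t) ^ (k - 1)) = - real k * (1 / t) ^ (k + 1)"
      proof -
        have "real k * (- (y * y) * y ^ (k - 1)) = - real k * y ^ (k + 1)" for y :: real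
          by (cases k) (simp_all add: algebra_simps)
        from this[of "1 / t"] show ?thesis by (simp add: power2_eq_square)
      qed
      moreover have "(d / t\<^sup>2) * (1 / t) ^ k = d * (1 / t) ^ (k + 2)" by (simp add: power_add power2_eq_square)
      ultimately show ?thesis using 1 by (simp add: flat_def algebra_simps)
    qed
    finally show ?thesis
      by (rule has_field_derivative_transform_within_open[where S="{0<..}"]) (use 1 in \<open>auto simp: flat_def\<close>)
  next
    case 2
    obtain B where B: "\<And>t. \<bar>flat d k t\<bar> \<le> B * t\<^sup>2" using flat_bound[OF d] by blast
    have "(flat d k has_real_derivative 0) (at 0)"
      by (rule DERIV_quadratic_error[where C=B]) (use B in \<open>simp add: flat_def\<close>)
    thus ?thesis using 2 by (simp add: flat_def)
  next
    case 3
    have "((\<lambda>_. 0) has_real_derivative 0) (at t)" by simp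
    hence "(flat d k has_real_derivative 0) (at t)"
      by (rule has_field_derivative_transform_within_open[where S="{..<0}"]) (use 3 in \<open>auto simp: flat_def\<close>)
    thus ?thesis using 3 by (simp add: flat_def)
  qed
qed

lemma dist_sq_R2: "(dist v c)\<^sup>2 = (v $ 1 - c $ 1)\<^sup>2 + (v $ 2 - c $ 2)\<^sup>2" for v c :: R2
  by (simp add: dist_norm norm_R2)

section \<open>Truncated Liouville bubbles as test functions\<close>

locale bubble =
  fixes c :: R2 and e d :: real
  assumes e: "e > 0" and d: "d > 0"
begin

definition den :: "R2 \<Rightarrow> real" where "den v = e + ((v $ 1 - c $ 1)\<^sup>2 + (v $ 2 - c $ 2)\<^sup>2)"
text \<open>Up to a constant \<open>exp (w v)\<close> is \<open>1 / (e + r^2)^2\<close> with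
  \<open>r = dist v c\<close>, the radial solution of Liouville's equation, concentrated at
  \<open>c\<close> for small \<open>e\<close>. The term \<open>2 * ln (1 + e)\<close> makes it 0 on
  the unit circle, and \<open>- d\<close> moves the zero level strictly inside, so that the positive
  part has compact support in the open disc.\<close>

definition w :: "R2 \<Rightarrow> real" where "w v = 2 * ln (1 + e) - 2 * ln (den v) - d"
definition \<phi> :: "R2 \<Rightarrow> real" where "\<phi> v = w v * flat d 0 (w v)"

lemma den_pos: "den v > 0" unfolding den_def using e by (intro add_pos_nonneg) auto

lemma den_eq: "den v = e + (dist v c)\<^sup>2" by (simp add: den_def dist_sq_R2)

lemma axis_nth: "(x + t *\<^sub>R axis i 1) $ j = x $ j + t * (if i = j then 1 else 0)" for x :: R2
  by (simp add: axis_def)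

lemma DERIV_coord: "((\<lambda>t. (x + t *\<^sub>R axis i 1) $ j) has_real_derivative (if i = j then 1 else 0)) (at 0)" for x :: R2
  unfolding axis_nth by (auto intro!: derivative_eq_intros)

lemma DERIV_den: "((\<lambda>t. den (x + t *\<^sub>R axis i 1)) has_real_derivative 2 * (x $ i - c $ i)) (at 0)"
proof -
  have sq: "((\<lambda>t. ((x + t *\<^sub>R axis i 1) $ j - c $ j)\<^sup>2) has_real_derivative 2 * (if i = j then 1 else 0) * (x $ j - c $ j)) (at 0)" for j
  proof -
    have "((\<lambda>y. (y - c $ j)\<^sup>2) has_real_derivative 2 * (y - c $ j)) (at y)" for y
      by (auto intro!: derivative_eq_intros)
    from DERIV_chain2[OF this DERIV_coord[of x i j]]
    have "((\<lambda>t. ((x + t *\<^sub>R axis i 1) $ j - c $ j)\<^sup>2) has_real_derivative 2 * ((x + 0 *\<^sub>R axis i 1) $ j - c $ j) * (if i = j then 1 else 0)) (at 0)" .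
    thus ?thesis by (simp only: scaleR_zero_left add_0_right mult.commute mult.left_commute)
  qed
  have "((\<lambda>t. den (x + t *\<^sub>R axis i 1)) has_real_derivative
      0 + (2 * (if i = 1 then 1 else 0) * (x $ 1 - c $ 1) + 2 * (if i = 2 then 1 else 0) * (x $ 2 - c $ 2))) (at 0)"
    unfolding den_def by (rule DERIV_add[OF DERIV_const DERIV_add[OF sq sq]])
  also have "0 + (2 * (if i = 1 then 1 else 0) * (x $ 1 - c $ 1) + 2 * (if i = 2 then 1 else 0) * (x $ 2 - c $ 2)) = 2 * (x $ i - c $ i)"
    using exhaust_2[of i] by auto
  finally show ?thesis .
qed

lemma DERIV_inv_den: "((\<lambda>t. 1 / den (x + t *\<^sub>R axis i 1)) has_real_derivative (-2) * (x $ i - c $ i) * (1 / den x) * (1 / den x)) (at 0)"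
proof -
  have "den (x + 0 *\<^sub>R axis i 1) \<noteq> 0" using den_pos[of x] by simp
  from DERIV_inverse_fun[OF DERIV_den this]
  have "((\<lambda>t. inverse (den (x + t *\<^sub>R axis i 1))) has_real_derivative - (2 * (x $ i - c $ i) * inverse (den x ^ Suc (Suc 0)))) (at 0)"
    by simp
  also have "- (2 * (x $ i - c $ i) * inverse (den x ^ Suc (Suc 0))) = (-2) * (x $ i - c $ i) * (1 / den x) * (1 / den x)"
  proof -
    have "- (2 * a * inverse (r ^ Suc (Suc 0))) = (-2) * a * (1 / r) * (1 / r)" for a r :: real
      by (simp add: inverse_eq_divide)
    thus ?thesis .
  qed
  finally show ?thesis by (simp only: inverse_eq_divide)
qed

lemma DERIV_w: "((\<lambda>t. w (x + t *\<^sub>R axis i 1)) has_real_derivative (-4) * (x $ i - c $ i) * (1 / den x)) (at 0)"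
proof -
  have "((\<lambda>t. ln (den (x + t *\<^sub>R axis i 1))) has_real_derivative 1 / den x * (2 * (x $ i - c $ i))) (at 0)"
  proof -
    have "(ln has_real_derivative 1 / den x) (at (den (x + 0 *\<^sub>R axis i 1)))"
      using DERIV_ln_divide[OF den_pos[of x]] by simp
    from DERIV_chain2[OF this DERIV_den] show ?thesis .
  qed
  hence "((\<lambda>t. 2 * ln (1 + e) - 2 * ln (den (x + t *\<^sub>R axis i 1)) - d) has_real_derivative 0 - 2 * (1 / den x * (2 * (x $ i - c $ i))) - 0) (at 0)"
    by (intro DERIV_diff DERIV_const DERIV_cmult)
  moreover have "0 - 2 * (1 / r * (2 * a)) - 0 = (-4) * a * (1 / r)" for a r :: real by simp
  ultimately show ?thesis unfolding w_def by (simp only:)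
qed

text \<open>An algebra closed under partial derivatives, as \<open>smooth_onI\<close> demands.
  Differentiation raises the index of \<open>flat\<close>, hence all indices are generators; the
  derivatives of \<open>w\<close> and of \<open>1 / den\<close> are polynomials in the coordinates
  and \<open>1 / den\<close>.\<close>

inductive_set cls :: "(R2 \<Rightarrow> real) set" where
  "(\<lambda>_. a) \<in> cls"
| "(\<lambda>v. v $ i) \<in> cls"
| "(\<lambda>v. 1 / den v) \<in> cls"
| "w \<in> cls"
| "(\<lambda>v. flat d k (w v)) \<in> cls"
| "f \<in> cls \<Longrightarrow> g \<in> cls \<Longrightarrow> (\<lambda>v. f v + g v) \<in> cls"
| "f \<in> cls \<Longrightarrow> g \<in> cls \<Longrightarrow> (\<lambda>v. f v * g v) \<in> cls"

lemma cls_diff: "f \<in> cls \<Longrightarrow> (\<lambda>v. f v - a) \<in> cls"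
  using cls.intros(6)[OF _ cls.intros(1)[of "- a"], of f] by simp

lemma den_cont: "continuous_on UNIV den" unfolding den_def by (intro continuous_intros)

lemma w_cont: "continuous_on UNIV w"
  unfolding w_def using den_pos by (intro continuous_intros den_cont) (auto simp: less_imp_neq[symmetric])

lemma cls_cont: "g \<in> cls \<Longrightarrow> continuous_on UNIV g"
proof (induction rule: cls.induct)
  case 3 show ?case using den_pos by (intro continuous_intros den_cont) (auto simp: less_imp_neq[symmetric])
next
  case 4 show ?case by (rule w_cont)
next
  case (5 k)
  have "continuous_on UNIV (flat d k)"
    using DERIV_isCont[OF DERIV_flat[OF d]] by (intro continuous_at_imp_continuous_on) auto
  thus ?case by (rule continuous_on_compose2[OF _ w_cont]) simp
qed (auto intro!: continuous_intros)

lemma cls_deriv: "g \<in> cls \<Longrightarrow> \<exists>g'\<in>cls. \<forall>x. ((\<lambda>t. g (x + t *\<^sub>R axis i 1)) has_real_derivative g' x) (at 0)"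
proof (induction rule: cls.induct)
  case (1 a) show ?case by (rule bexI[OF _ cls.intros(1)[of 0]]) simp
next
  case (2 j) show ?case by (rule bexI[OF _ cls.intros(1)[of "if i = j then 1 else 0"]]) (intro allI DERIV_coord)
next
  case 3 show ?case
    by (rule bexI[of _ "\<lambda>x. (-2) * (x $ i - c $ i) * (1 / den x) * (1 / den x)"])
       (intro allI DERIV_inv_den, intro cls.intros cls_diff)
next
  case 4 show ?case
    by (rule bexI[of _ "\<lambda>x. (-4) * (x $ i - c $ i) * (1 / den x)"])
       (intro allI DERIV_w, intro cls.intros cls_diff)
next
  case (5 k)
  show ?case
  proof (rule bexI[of _ "\<lambda>x. (- real k * flat d (k + 1) (w x) + d * flat d (k + 2) (w x)) * ((-4) * (x $ i - c $ i) * (1 / den x))"])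
    show "\<forall>x. ((\<lambda>t. flat d k (w (x + t *\<^sub>R axis i 1))) has_real_derivative
      (- real k * flat d (k + 1) (w x) + d * flat d (k + 2) (w x)) * ((-4) * (x $ i - c $ i) * (1 / den x))) (at 0)"
    proof
      fix x show "((\<lambda>t. flat d k (w (x + t *\<^sub>R axis i 1))) has_real_derivative
      (- real k * flat d (k + 1) (w x) + d * flat d (k + 2) (w x)) * ((-4) * (x $ i - c $ i) * (1 / den x))) (at 0)"
        using DERIV_chain2[OF DERIV_flat[OF d] DERIV_w[of x i], of k] by simp
    qed
  qed (intro cls.intros cls_diff)
next
  case (6 f g)
  then obtain f' g' where "f' \<in> cls" "g' \<in> cls" and d: "\<And>x. ((\<lambda>t. f (x + t *\<^sub>R axis i 1)) has_real_derivative f' x) (at 0)"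
    "\<And>x. ((\<lambda>t. g (x + t *\<^sub>R axis i 1)) has_real_derivative g' x) (at 0)" by blast
  show ?case
    by (rule bexI[of _ "\<lambda>x. f' x + g' x"]) (intro allI DERIV_add d, intro cls.intros, fact+)
next
  case (7 f g)
  then obtain f' g' where m: "f' \<in> cls" "g' \<in> cls" and d: "\<And>x. ((\<lambda>t. f (x + t *\<^sub>R axis i 1)) has_real_derivative f' x) (at 0)"
    "\<And>x. ((\<lambda>t. g (x + t *\<^sub>R axis i 1)) has_real_derivative g' x) (at 0)" by blast
  show ?case
  proof (rule bexI[of _ "\<lambda>x. f' x * g x + g' x * f x"])
    show "\<forall>x. ((\<lambda>t. f (x + t *\<^sub>R axis i 1) * g (x + t *\<^sub>R axis i 1)) has_real_derivative f' x * g x + g' x * f x) (at 0)"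
      using DERIV_mult[OF d] by simp
    show "(\<lambda>x. f' x * g x + g' x * f x) \<in> cls" by (intro cls.intros(6) cls.intros(7) m 7)
  qed
qed

lemma phi_smooth: "smooth_on UNIV \<phi>"
proof (rule smooth_onI[where C=cls])
  show "\<phi> \<in> cls" unfolding \<phi>_def by (intro cls.intros)
qed (rule cls_cont cls_deriv; assumption)+

lemma phi_test: "test_fun (ball c 1) \<phi>"
proof -
  let ?S = "{v. 0 \<le> w v}"
  have "closed ?S" by (intro closed_Collect_le continuous_intros w_cont)
  moreover have "{v. \<phi> v \<noteq> 0} \<subseteq> ?S" by (auto simp: \<phi>_def flat_def)
  ultimately have cl: "closure {v. \<phi> v \<noteq> 0} \<subseteq> ?S" by (rule closure_minimal[rotated])
  have S: "?S \<subseteq> ball c 1"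
  proof
    fix v assume "v \<in> ?S"
    hence "2 * ln (den v) < 2 * ln (1 + e)" using d by (simp add: w_def)
    hence "den v < 1 + e" using den_pos[of v] e by simp
    hence "(dist v c)\<^sup>2 < 1" by (simp add: den_eq)
    thus "v \<in> ball c 1" using abs_square_less_1[of "dist v c"] by (simp add: dist_commute)
  qed
  have "bounded (closure {v. \<phi> v \<noteq> 0})" by (rule bounded_subset[OF bounded_ball order_trans[OF cl S]])
  thus ?thesis unfolding test_fun_def using phi_smooth cl S by (auto simp: compact_eq_bounded_closed)
qed

lemma grad_bound: "(norm (grad \<phi> v))\<^sup>2 \<le> 16 * ((dist v c)\<^sup>2 / (e + (dist v c)\<^sup>2)\<^sup>2)"
proof -
  define D where "D = flat d 0 (w v) + w v * (d * flat d 2 (w v))"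
  have g: "grad \<phi> v $ i = D * ((-4) * (v $ i - c $ i) * (1 / den v))" for i
  proof -
    have "((\<lambda>t. \<phi> (v + t *\<^sub>R axis i 1)) has_real_derivative D * ((-4) * (v $ i - c $ i) * (1 / den v))) (at 0)"
    proof -
      have "((\<lambda>t. t * flat d 0 t) has_real_derivative D) (at (w v))"
        using DERIV_mult[OF DERIV_ident DERIV_flat[OF d, of 0 "w v"]] by (simp add: D_def mult.commute numeral_2_eq_2)
      hence "((\<lambda>t. t * flat d 0 t) has_real_derivative D) (at (w (v + 0 *\<^sub>R axis i 1)))" by simp
      from DERIV_chain2[OF this DERIV_w[of v i]] show ?thesis unfolding \<phi>_def .
    qed
    from DERIV_imp_deriv[OF this] show ?thesis by (simp add: grad_def)
  qed
  have D: "0 \<le> D" "D \<le> 1"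
  proof -
    have "0 \<le> D \<and> D \<le> 1"
    proof (cases "w v > 0")
      case True
      have "D = (1 + d / w v) * exp (- (d / w v))"
        using True by (simp add: D_def flat_def power2_eq_square algebra_simps)
      moreover have "1 + d / w v \<le> exp (d / w v)" by (rule exp_ge_add_one_self)
      hence "(1 + d / w v) * exp (- (d / w v)) \<le> exp (d / w v) * exp (- (d / w v))" by (rule mult_right_mono) simp
      moreover have "exp (d / w v) * exp (- (d / w v)) = 1" by (simp add: exp_add[symmetric])
      moreover have "(1 + d / w v) * exp (- (d / w v)) \<ge> 0" using True d by (intro mult_nonneg_nonneg) auto
      ultimately show ?thesis by simp
    next
      case False thus ?thesis by (simp add: D_def flat_def)
    qed
    thus "0 \<le> D" "D \<le> 1" by auto
  qed
  have "(norm (grad \<phi> v))\<^sup>2 = (grad \<phi> v $ 1)\<^sup>2 + (grad \<phi> v $ 2)\<^sup>2" by (simp add: norm_R2)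
  also have "\<dots> = D\<^sup>2 * (16 * ((dist v c)\<^sup>2 / (den v)\<^sup>2))"
  proof -
    have "(D * ((-4) * p * (1 / r)))\<^sup>2 + (D * ((-4) * q * (1 / r)))\<^sup>2 = D\<^sup>2 * (16 * ((p\<^sup>2 + q\<^sup>2) / r\<^sup>2))" for p q r :: real
      by (simp add: power_mult_distrib power_divide add_divide_distrib distrib_left)
    thus ?thesis unfolding g dist_sq_R2 .
  qed
  also have "\<dots> \<le> 1 * (16 * ((dist v c)\<^sup>2 / (den v)\<^sup>2))"
    using D by (intro mult_right_mono) (auto simp: power_le_one)
  finally show ?thesis by (simp add: den_eq)
qed

text \<open>One factor \<open>exp (- d)\<close> is due to the shift in \<open>w\<close>, the other
  to the truncation, which lowers \<open>w\<close> by at most \<open>d\<close>.\<close>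

lemma exp_lower: "exp (\<phi> v) \<ge> exp (- 2 * d) * (1 + e)\<^sup>2 * (1 / (e + (dist v c)\<^sup>2)\<^sup>2)"
proof -
  have "\<phi> v \<ge> w v - d"
  proof (cases "w v > 0")
    case True
    have "1 + - d / w v \<le> exp (- d / w v)" by (rule exp_ge_add_one_self)
    hence "w v * (1 + - d / w v) \<le> w v * exp (- d / w v)" using True by (intro mult_left_mono) auto
    moreover have "w v * (1 + - d / w v) = w v - d" using True by (simp add: algebra_simps)
    moreover have "\<phi> v = w v * exp (- d / w v)" using True by (simp add: \<phi>_def flat_def)
    ultimately show ?thesis by linarith
  next
    case False thus ?thesis using d by (simp add: \<phi>_def flat_def)
  qed
  hence "exp (w v - d) \<le> exp (\<phi> v)" by simp
  moreover have "w v - d = - 2 * d + (ln (1 + e) + ln (1 + e)) - (ln (den v) + ln (den v))" by (simp add: w_def)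
  hence "exp (w v - d) = exp (- 2 * d) * (1 + e)\<^sup>2 * (1 / (den v)\<^sup>2)"
    using den_pos[of v] e by (simp only: exp_diff exp_add) (simp add: power2_eq_square)
  ultimately show ?thesis by (simp add: den_eq)
qed

end

section \<open>The energy of the disc\<close>

text \<open>In the substitution \<open>s = r^2\<close> the area of the disc is carried to \<pi>
  times Lebesgue measure on [0, 1]. The two measures agree because their distribution functions do:
  a disc of radius \<open>sqrt a\<close> has area \<open>pi * a\<close>.\<close>

lemma radial_integral:
  fixes q :: "real \<Rightarrow> real" and c :: R2
  assumes [measurable]: "q \<in> borel_measurable borel"
  shows "(LINT v|lborel. indicator (ball c 1) v * q ((dist v c)\<^sup>2)) = pi * (LINT s|lborel. indicator {0..1} s * q s)"
proof -
  define M0 where "M0 = density lborel (indicator (ball c 1) :: R2 \<Rightarrow> ennreal)"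
  define M1 where "M1 = distr M0 borel (\<lambda>v. (dist v c)\<^sup>2)"
  define M2 where "M2 = density lborel (\<lambda>s. ennreal (pi * indicator {0..1::real} s))"
  have rm [measurable]: "(\<lambda>v. (dist v c)\<^sup>2) \<in> borel_measurable borel" by measurable
  have rm0: "(\<lambda>v. (dist v c)\<^sup>2) \<in> borel_measurable M0" unfolding M0_def by simp
  have e1: "emeasure M1 {..a} = ennreal (pi * (max 0 (min 1 a)))" for a
  proof -
    have vs: "(\<lambda>v. (dist v c)\<^sup>2) -` {..a} \<in> sets lborel" using measurable_sets[OF rm, of "{..a}"] by simp
    have "emeasure M1 {..a} = emeasure M0 ((\<lambda>v. (dist v c)\<^sup>2) -` {..a})"
      unfolding M1_def by (subst emeasure_distr[OF rm0]) (simp_all add: M0_def)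
    also have "\<dots> = emeasure lborel (ball c 1 \<inter> ((\<lambda>v. (dist v c)\<^sup>2) -` {..a}))"
      unfolding M0_def by (rule emeasure_restricted) (use vs in auto)
    also have "\<dots> = ennreal (pi * (max 0 (min 1 a)))"
    proof -
      consider "a < 0" | "0 \<le> a" "a < 1" | "a \<ge> 1" by linarith
      thus ?thesis
      proof cases
        case 1
        have "\<not> (dist v c)\<^sup>2 \<le> a" for v using 1 zero_le_power2[of "dist v c"] by linarith
        hence "(\<lambda>v. (dist v c)\<^sup>2) -` {..a} = {}" by auto
        thus ?thesis using 1 by simp
      next
        case 2
        have "ball c 1 \<inter> ((\<lambda>v. (dist v c)\<^sup>2) -` {..a}) = cball c (sqrt a)"
        proof (rule set_eqI)
          fix v
          have iff: "(dist v c)\<^sup>2 \<le> a \<longleftrightarrow> dist v c \<le> sqrt a"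
          proof
            assume "dist v c \<le> sqrt a"
            hence "(dist v c)\<^sup>2 \<le> (sqrt a)\<^sup>2" by (intro power_mono) auto
            thus "(dist v c)\<^sup>2 \<le> a" using 2 by simp
          qed (rule real_le_rsqrt)
          have lt: "dist v c < 1" if "dist v c \<le> sqrt a"
            by (rule le_less_trans[OF that]) (use 2 in simp)
          have "v \<in> ball c 1 \<inter> ((\<lambda>v. (dist v c)\<^sup>2) -` {..a}) \<longleftrightarrow> dist v c < 1 \<and> dist v c \<le> sqrt a"
            using iff by (simp add: dist_commute)
          also have "\<dots> \<longleftrightarrow> v \<in> cball c (sqrt a)" using lt by (auto simp: dist_commute)
          finally show "v \<in> ball c 1 \<inter> ((\<lambda>v. (dist v c)\<^sup>2) -` {..a}) \<longleftrightarrow> v \<in> cball c (sqrt a)" .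
        qed
        thus ?thesis using 2 by (simp add: emeasure_cball unit_ball_vol_2)
      next
        case 3
        have "ball c 1 \<inter> ((\<lambda>v. (dist v c)\<^sup>2) -` {..a}) = ball c 1"
        proof -
          have "(dist v c)\<^sup>2 \<le> a" if "v \<in> ball c 1" for v
          proof -
            have "(dist v c)\<^sup>2 < 1" using abs_square_less_1[of "dist v c"] that by (simp add: dist_commute)
            thus ?thesis using 3 by linarith
          qed
          thus ?thesis by auto
        qed
        thus ?thesis using 3 by (simp add: emeasure_ball unit_ball_vol_2)
      qed
    qed
    finally show ?thesis .
  qed
  have e2: "emeasure M2 {..a} = ennreal (pi * (max 0 (min 1 a)))" for a
  proof -
    have "emeasure M2 {..a} = (\<integral>\<^sup>+ s. ennreal (pi * indicator {0..1} s) * indicator {..a} s \<partial>lborel)"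
      unfolding M2_def by (rule emeasure_density) auto
    also have "\<dots> = (\<integral>\<^sup>+ s. ennreal pi * indicator {0..min 1 a} s \<partial>lborel)"
      by (intro nn_integral_cong) (auto simp: indicator_def)
    also have "\<dots> = ennreal pi * emeasure lborel {0..min 1 a}" by (rule nn_integral_cmult_indicator) simp
    also have "\<dots> = ennreal (pi * (max 0 (min 1 a)))"
      by (cases "min 1 a \<ge> 0") (simp_all add: ennreal_mult max_def)
    finally show ?thesis .
  qed
  have s1: "sets M1 = sets borel" and s2: "sets M2 = sets borel" by (simp_all add: M1_def M2_def)
  have top: "emeasure M UNIV < \<infinity>" if "\<And>a. emeasure M {..a} = ennreal (pi * (max 0 (min 1 a)))" "sets M = sets borel" for M :: "real measure"
  proof -
    have "(\<lambda>n. emeasure M {..real n}) \<longlonglongrightarrow> emeasure M (\<Union>n. {..real n})"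
      by (intro Lim_emeasure_incseq) (auto simp: that(2) incseq_def)
    moreover have "(\<Union>n. {..real n}) = UNIV" using real_arch_simple by auto
    ultimately have lim: "(\<lambda>n. emeasure M {..real n}) \<longlonglongrightarrow> emeasure M UNIV" by (simp only:)
    have "emeasure M {..real n} \<le> ennreal pi" for n
    proof -
      have "pi * max 0 (min 1 (real n)) \<le> pi * 1" by (intro mult_left_mono) auto
      thus ?thesis unfolding that(1) by (intro ennreal_leI) simp
    qed
    hence "emeasure M UNIV \<le> ennreal pi" by (intro LIMSEQ_le_const2[OF lim]) blast
    thus ?thesis by (rule le_less_trans) simp
  qed
  have fb: "finite_borel_measure M" if "\<And>a. emeasure M {..a} = ennreal (pi * (max 0 (min 1 a)))" "sets M = sets borel" for M :: "real measure"
  proof (intro finite_borel_measure.intro finite_measureI finite_borel_measure_axioms.intro)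
    have "space M = UNIV" using sets_eq_imp_space_eq[OF that(2)] by simp
    thus "emeasure M (space M) \<noteq> \<infinity>" using top[OF that] by simp
    show "sets M = sets borel" by (rule that(2))
  qed
  have "M1 = M2"
    by (rule cdf_unique'[OF fb[OF e1 s1] fb[OF e2 s2]]) (rule ext, simp only: cdf_def measure_def e1 e2)
  have "(LINT s|M1. q s) = (LINT v|M0. q ((dist v c)\<^sup>2))"
    unfolding M1_def by (rule integral_distr[OF rm0]) simp
  also have "M0 = density lborel (\<lambda>v. ennreal (indicator (ball c 1) v))"
    unfolding M0_def by (simp only: ennreal_indicator)
  also have "(LINT v|density lborel (\<lambda>v. ennreal (indicator (ball c 1) v)). q ((dist v c)\<^sup>2)) = (LINT v|lborel. indicator (ball c 1) v *\<^sub>R q ((dist v c)\<^sup>2))"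
  proof (rule integral_density)
    show "(indicator (ball c 1) :: R2 \<Rightarrow> real) \<in> borel_measurable lborel"
      by (rule borel_measurable_indicator) simp
  qed auto
  finally have l: "(LINT s|M1. q s) = (LINT v|lborel. indicator (ball c 1) v * q ((dist v c)\<^sup>2))" by simp
  have "(LINT s|M2. q s) = (LINT s|lborel. (pi * indicator {0..1} s) *\<^sub>R q s)"
    unfolding M2_def by (rule integral_density) auto
  also have "\<dots> = (LINT s|lborel. pi * (indicator {0..1} s * q s))" by (simp add: mult.assoc)
  finally have "(LINT s|M2. q s) = pi * (LINT s|lborel. indicator {0..1} s * q s)" by simp
  thus ?thesis using l \<open>M1 = M2\<close> by simp
qed

lemma bubble_integrals:
  fixes e :: real
  assumes e: "e > 0"
  shows "(LINT s|lborel. indicator {0..1} s * (s / (e + s)\<^sup>2)) = ln ((1 + e) / e) + e / (1 + e) - 1"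
    and "(LINT s|lborel. indicator {0..1} s * (1 / (e + s)\<^sup>2)) = 1 / e - 1 / (1 + e)"
proof -
  have "(LINT s|lborel. indicator {0..1} s *\<^sub>R (s / (e + s)\<^sup>2)) = (ln (e + 1) + e / (e + 1)) - (ln (e + 0) + e / (e + 0))"
  proof (rule integral_FTC_atLeastAtMost)
    fix x :: real assume x: "0 \<le> x" "x \<le> 1"
    have ex: "e + x > 0" using x e by simp
    have S: "((\<lambda>s. e + s) has_real_derivative 1) (at x)" by (auto intro!: derivative_eq_intros)
    have A: "((\<lambda>s. ln (e + s)) has_real_derivative 1 / (e + x)) (at x)"
      using DERIV_chain2[OF DERIV_ln_divide[OF ex] S] by (simp only: mult_1_right)
    have "((\<lambda>s. e * inverse (e + s)) has_real_derivative e * - (1 * inverse ((e + x) ^ Suc (Suc 0)))) (at x)"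
      using ex by (intro DERIV_cmult DERIV_inverse_fun S) simp
    hence B: "((\<lambda>s. e / (e + s)) has_real_derivative - (e / (e + x)\<^sup>2)) (at x)"
      by (simp only: divide_inverse numeral_2_eq_2 mult_1_left mult_minus_right)
    have "((\<lambda>s. ln (e + s) + e / (e + s)) has_real_derivative 1 / (e + x) - e / (e + x)\<^sup>2) (at x)"
      using DERIV_add[OF A B] by simp
    also have "1 / (e + x) - e / (e + x)\<^sup>2 = x / (e + x)\<^sup>2"
    proof -
      have "1 / y - e / y\<^sup>2 = (y - e) / y\<^sup>2" if "y > 0" for y :: real
      proof -
        have "1 / y = y / y\<^sup>2" using that by (simp add: power2_eq_square)
        thus ?thesis by (simp only: diff_divide_distrib)
      qed
      from this[OF ex] show ?thesis by (simp only: add_diff_cancel_left')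
    qed
    finally show "((\<lambda>s. ln (e + s) + e / (e + s)) has_vector_derivative x / (e + x)\<^sup>2) (at x within {0..1})"
      unfolding has_real_derivative_iff_has_vector_derivative by (rule has_vector_derivative_at_within)
  qed (use e in \<open>auto intro!: continuous_intros\<close>)
  also have "\<dots> = ln ((1 + e) / e) + e / (1 + e) - 1" using e by (simp add: ln_div add.commute)
  finally show "(LINT s|lborel. indicator {0..1} s * (s / (e + s)\<^sup>2)) = ln ((1 + e) / e) + e / (1 + e) - 1" by simp
  have "(LINT s|lborel. indicator {0..1} s *\<^sub>R (1 / (e + s)\<^sup>2)) = - (1 / (e + 1)) - (- (1 / (e + 0)))"
  proof (rule integral_FTC_atLeastAtMost)
    fix x :: real assume x: "0 \<le> x" "x \<le> 1"
    have S: "((\<lambda>s. e + s) has_real_derivative 1) (at x)" by (auto intro!: derivative_eq_intros)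
    have "e + x \<noteq> 0" using x e by simp
    from DERIV_minus[OF DERIV_inverse_fun[OF S this]]
    have "((\<lambda>s. - (1 / (e + s))) has_real_derivative 1 / (e + x)\<^sup>2) (at x)"
      by (simp only: inverse_eq_divide numeral_2_eq_2 mult_1_left minus_minus)
    thus "((\<lambda>s. - (1 / (e + s))) has_vector_derivative 1 / (e + x)\<^sup>2) (at x within {0..1})"
      unfolding has_real_derivative_iff_has_vector_derivative by (rule has_vector_derivative_at_within)
  qed (use e in \<open>auto intro!: continuous_intros\<close>)
  also have "\<dots> = 1 / e - 1 / (1 + e)" by (simp add: add.commute)
  finally show "(LINT s|lborel. indicator {0..1} s * (1 / (e + s)\<^sup>2)) = 1 / e - 1 / (1 + e)" by simp
qed

lemma measure_unit_ball: "measure lborel (ball (c :: R2) 1) = pi" "measure lebesgue (ball (c :: R2) 1) = pi"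
  by (simp_all add: content_ball unit_ball_vol_2)

context bubble
begin

text \<open>The scaled energy is at most \<open>ln ((1 + e) / e) + e / (1 + e) - 1\<close>, and the
  mean of the exponential is at least \<open>exp (- 2 * d) * ((1 + e) / e)\<close>. The logarithms,
  which diverge as \<open>e\<close> tends to 0, cancel and -1 remains.\<close>

lemma I8pi_upper: "I8pi (ball c 1) \<phi> (grad \<phi>) \<le> - 1 + e / (1 + e) + 2 * d"
proof -
  interpret level_sets "ball c 1" \<phi>
    by unfold_locales (simp_all add: measure_unit_ball phi_test)
  let ?B = "ball c 1"
  have "(LINT x:?B|lebesgue. (norm (grad \<phi> x))\<^sup>2) = (LINT v|lborel. indicator ?B v * (norm (grad \<phi> v))\<^sup>2)"
    unfolding set_lebesgue_integral_def real_scaleR_def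
    by (rule integral_completion) measurable
  also have "\<dots> \<le> (LINT v|lborel. indicator ?B v * (16 * ((dist v c)\<^sup>2 / (e + (dist v c)\<^sup>2)\<^sup>2)))"
  proof (rule integral_mono)
    show "integrable lborel (\<lambda>v. indicator ?B v * (norm (grad \<phi> v))\<^sup>2)" by (rule int_G) simp
    have "continuous_on UNIV (\<lambda>v. 16 * ((dist v c)\<^sup>2 / (e + (dist v c)\<^sup>2)\<^sup>2))"
    proof (intro continuous_intros ballI)
      fix v show "(e + (dist v c)\<^sup>2)\<^sup>2 \<noteq> 0" using den_pos[of v] by (simp add: den_eq)
    qed
    from borel_integrable_compact[OF compact_cball continuous_on_subset[OF this subset_UNIV]]
    have "integrable lborel (\<lambda>v. indicator (cball c 1) v *\<^sub>R (16 * ((dist v c)\<^sup>2 / (e + (dist v c)\<^sup>2)\<^sup>2)))"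
      by blast
    from integrable_mult_indicator[OF _ this, of ?B]
    show "integrable lborel (\<lambda>v. indicator ?B v * (16 * ((dist v c)\<^sup>2 / (e + (dist v c)\<^sup>2)\<^sup>2)))"
    proof (rule back_subst[of "integrable lborel"])
      show "(\<lambda>x. indicator ?B x *\<^sub>R (indicator (cball c 1) x *\<^sub>R (16 * ((dist x c)\<^sup>2 / (e + (dist x c)\<^sup>2)\<^sup>2)))) =
        (\<lambda>v. indicator ?B v * (16 * ((dist v c)\<^sup>2 / (e + (dist v c)\<^sup>2)\<^sup>2)))"
        by (auto simp: indicator_def fun_eq_iff)
    qed simp
    show "indicator ?B v * (norm (grad \<phi> v))\<^sup>2 \<le> indicator ?B v * (16 * ((dist v c)\<^sup>2 / (e + (dist v c)\<^sup>2)\<^sup>2))" for v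
      by (intro mult_left_mono grad_bound) simp
  qed
  also have "\<dots> = pi * (LINT s|lborel. indicator {0..1} s * (16 * (s / (e + s)\<^sup>2)))"
    by (rule radial_integral) measurable
  also have "(LINT s|lborel. indicator {0..1} s * (16 * (s / (e + s)\<^sup>2))) = (LINT s|lborel. 16 * (indicator {0..1} s * (s / (e + s)\<^sup>2)))"
    by (simp only: mult.left_commute)
  also have "\<dots> = 16 * (ln ((1 + e) / e) + e / (1 + e) - 1)"
    unfolding Bochner_Integration.integral_mult_right_zero bubble_integrals(1)[OF e] ..
  finally have D: "(LINT x:?B|lebesgue. (norm (grad \<phi> x))\<^sup>2) \<le> pi * (16 * (ln ((1 + e) / e) + e / (1 + e) - 1))" .
  have D': "1 / (16 * pi) * (LINT x:?B|lebesgue. (norm (grad \<phi> x))\<^sup>2) \<le> ln ((1 + e) / e) + e / (1 + e) - 1"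
  proof -
    have "1 / (16 * pi) * (LINT x:?B|lebesgue. (norm (grad \<phi> x))\<^sup>2) \<le> 1 / (16 * pi) * (pi * (16 * (ln ((1 + e) / e) + e / (1 + e) - 1)))"
      by (intro mult_left_mono D) simp
    thus ?thesis by simp
  qed
  let ?K = "exp (- 2 * d) * (1 + e)\<^sup>2"
  have "pi * (?K * (1 / e - 1 / (1 + e))) = pi * (LINT s|lborel. indicator {0..1} s * (?K * (1 / (e + s)\<^sup>2)))"
  proof -
    have "(LINT s|lborel. indicator {0..1} s * (?K * (1 / (e + s)\<^sup>2))) = (LINT s|lborel. ?K * (indicator {0..1} s * (1 / (e + s)\<^sup>2)))"
      by (simp only: mult.left_commute)
    also have "\<dots> = ?K * (1 / e - 1 / (1 + e))"
      unfolding Bochner_Integration.integral_mult_right_zero bubble_integrals(2)[OF e] ..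
    finally show ?thesis by simp
  qed
  also have "\<dots> = (LINT v|lborel. indicator ?B v * (?K * (1 / (e + (dist v c)\<^sup>2)\<^sup>2)))"
    by (rule radial_integral[symmetric]) measurable
  also have "\<dots> \<le> (LINT v|lborel. indicator ?B v * exp (\<phi> v))"
  proof (rule integral_mono_AE')
    have "integrable lborel (\<lambda>v. indicator (cball c 1) v *\<^sub>R exp (\<phi> v))"
      by (rule borel_integrable_compact[OF compact_cball continuous_on_subset[OF continuous_on_exp[OF phi_cont] subset_UNIV]])
    from integrable_mult_indicator[OF _ this, of ?B]
    show "integrable lborel (\<lambda>v. indicator ?B v * exp (\<phi> v))"
    proof (rule back_subst[of "integrable lborel"])
      show "(\<lambda>x. indicator ?B x *\<^sub>R (indicator (cball c 1) x *\<^sub>R exp (\<phi> x))) = (\<lambda>v. indicator ?B v * exp (\<phi> v))"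
        by (auto simp: indicator_def fun_eq_iff)
    qed simp
    show "AE v in lborel. indicator ?B v * (?K * (1 / (e + (dist v c)\<^sup>2)\<^sup>2)) \<le> indicator ?B v * exp (\<phi> v)"
      by (intro AE_I2 mult_left_mono exp_lower) simp
    show "AE v in lborel. 0 \<le> indicator ?B v * exp (\<phi> v)" by simp
  qed
  also have "\<dots> = (LINT x:?B|lebesgue. exp (\<phi> x))"
    unfolding set_lebesgue_integral_def real_scaleR_def by (rule integral_completion[symmetric]) measurable
  finally have E: "pi * (?K * (1 / e - 1 / (1 + e))) \<le> (LINT x:?B|lebesgue. exp (\<phi> x))" .
  have Keq: "?K * (1 / e - 1 / (1 + e)) = exp (- 2 * d) * ((1 + e) / e)"
  proof -
    have "1 / e - 1 / (1 + e) = 1 / (e * (1 + e))" using e by (simp add: field_simps)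
    moreover have "y\<^sup>2 * (1 / (e * y)) = y / e" if "y \<noteq> 0" for y using that by (simp add: power2_eq_square)
    moreover have "1 + e \<noteq> 0" using e by simp
    ultimately have "(1 + e)\<^sup>2 * (1 / e - 1 / (1 + e)) = (1 + e) / e" by (simp only:)
    thus ?thesis by (simp add: mult.assoc)
  qed
  have "exp (- 2 * d) * ((1 + e) / e) \<le> 1 / measure lebesgue ?B * (LINT x:?B|lebesgue. exp (\<phi> x))"
    using E unfolding Keq measure_unit_ball by (simp add: pos_le_divide_eq mult.commute)
  moreover have p: "exp (- 2 * d) * ((1 + e) / e) > 0" using e by (intro mult_pos_pos) auto
  ultimately have "ln (exp (- 2 * d) * ((1 + e) / e)) \<le> ln (1 / measure lebesgue ?B * (LINT x:?B|lebesgue. exp (\<phi> x)))"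
    by (subst ln_le_cancel_iff) (auto intro: order.strict_trans2)
  moreover have "ln (exp (- 2 * d) * ((1 + e) / e)) = - 2 * d + ln ((1 + e) / e)"
  proof -
    have "(1 + e) / e > 0" using e by simp
    thus ?thesis by (simp only: ln_mult_pos exp_gt_zero ln_exp)
  qed
  ultimately show ?thesis using D' unfolding I8pi_def by linarith
qed

end

lemma E8pi_ball: "E8pi (ball c 1) = - 1"
proof -
  let ?S = "{I8pi (ball c 1) u g | u g. H10 (ball c 1) u g}"
  have low: "- 1 \<le> x" if x: "x \<in> ?S" for x
  proof -
    obtain u g where ug: "x = I8pi (ball c 1) u g" "H10 (ball c 1) u g" using x by blast
    have "- 1 + 0 \<le> I8pi (ball c 1) u g"
    proof (rule I8pi_lower[OF open_ball measure_unit_ball(2) ug(2)])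
      fix \<phi> assume t: "test_fun (ball c 1) \<phi>"
      show "(\<integral>\<^sup>+ v. ennreal (indicator (ball c 1) v * exp (\<phi> v)) \<partial>lborel) \<le>
         ennreal (pi * exp (1 - 0 + (LINT v|lborel. indicator (ball c 1) v * (norm (grad \<phi> v))\<^sup>2) / (16 * pi)))"
      proof (rule test_fun_exp_bound[OF open_ball measure_unit_ball(1) t])
        fix \<phi> assume t: "test_fun (ball c 1) \<phi>"
        interpret level_sets "ball c 1" \<phi> by unfold_locales (simp_all add: measure_unit_ball t)
        show "ln (F 0 / pi) \<le> 1 - 0 + G 0 / (16 * pi)" using moser_trudinger by simp
      qed
    qed simp
    thus ?thesis using ug by simp
  qed
  have bdd: "bdd_below ?S" using low by (rule bdd_belowI)
  have up: "Inf ?S \<le> - 1 + e / (1 + e) + 2 * d" if "e > 0" "d > 0" for e d :: real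
  proof -
    interpret bubble c e d by unfold_locales (use that in auto)
    have "I8pi (ball c 1) \<phi> (grad \<phi>) \<in> ?S" using test_fun_H10[OF phi_test] by blast
    from cInf_lower[OF this bdd] I8pi_upper show ?thesis by linarith
  qed
  \<comment> \<open>Both parameters of the bubble are set equal and tend to 0 together.\<close>
  have "Inf ?S \<le> - 1 + 0 / (1 + 0) + 2 * 0"
  proof (rule tendsto_lowerbound)
    show "((\<lambda>e. - 1 + e / (1 + e) + 2 * e) \<longlongrightarrow> (- 1 + 0 / (1 + 0) + 2 * 0 :: real)) (at_right 0)"
      by (intro tendsto_intros) simp
    show "\<forall>\<^sub>F e in at_right 0. Inf ?S \<le> - 1 + e / (1 + e) + 2 * e"
      unfolding eventually_at_right_field using up by (intro exI[of _ 1]) auto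
  qed simp
  moreover have "- 1 \<le> Inf ?S"
  proof (rule cInf_greatest)
    show "?S \<noteq> {}" using test_fun_H10[OF test_fun_0] by blast
  qed (rule low)
  ultimately show ?thesis unfolding E8pi_def by simp
qed

section \<open>Domains that are not discs\<close>

text \<open>\<open>smooth_on\<close> speaks of partial derivatives only. At a local maximum they
  vanish, and since they are continuous they are small nearby; the mean value theorem along two
  segments parallel to the axes turns this into a vanishing total derivative, which the definition
  of a smooth domain forbids.\<close>

lemma has_derivative_zero_local_max:
  fixes \<rho> :: "R2 \<Rightarrow> real"
  assumes U: "open U" "p \<in> U" "smooth_on U \<rho>" and N: "open N" "p \<in> N" "N \<subseteq> U" "\<And>v. v \<in> N \<Longrightarrow> \<rho> v \<le> \<rho> p"
  shows "(\<rho> has_derivative (\<lambda>v. 0)) (at p)"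
proof -
  define h where "h i x = deriv (\<lambda>t. \<rho> (x + t *\<^sub>R axis i 1)) 0" for i x
  have so: "continuous_on U g \<and> (\<forall>i. \<forall>x\<in>U. (\<lambda>t. g (x + t *\<^sub>R axis i 1)) differentiable (at 0))" if "higher_pd U \<rho> g" for g
    using U(3) that by (simp add: smooth_on_def)
  have d0: "((\<lambda>t. \<rho> (x + t *\<^sub>R axis i 1)) has_real_derivative h i x) (at 0)" if "x \<in> U" for x i
    using so[OF higher_pd.refl] that by (simp add: h_def DERIV_deriv_iff_real_differentiable)
  have "higher_pd U \<rho> (h i)" for i
    by (rule higher_pd.step[OF higher_pd.refl, of _ _ i]) (intro ballI d0)
  hence hc: "continuous_on U (h i)" for i by (rule conjunct1[OF so])
  have dt: "((\<lambda>t. \<rho> (x + t *\<^sub>R axis i 1)) has_real_derivative h i (x + t *\<^sub>R axis i 1)) (at t)" if "x + t *\<^sub>R axis i 1 \<in> U" for x t i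
  proof -
    have "((\<lambda>s. \<rho> (x + (s + t) *\<^sub>R axis i 1)) has_real_derivative h i (x + t *\<^sub>R axis i 1)) (at 0)"
      using d0[OF that, of i] by (simp add: algebra_simps)
    thus ?thesis using DERIV_shift[of "\<lambda>t. \<rho> (x + t *\<^sub>R axis i 1)" _ 0 t] by simp
  qed
  obtain r where r: "r > 0" "ball p r \<subseteq> N" using N(1,2) openE by blast
  have h0: "h i p = 0" for i
  proof (rule DERIV_local_max[OF d0[OF U(2)] r(1)])
    show "\<forall>y. \<bar>0 - y\<bar> < r \<longrightarrow> \<rho> (p + y *\<^sub>R axis i 1) \<le> \<rho> (p + 0 *\<^sub>R axis i 1)"
    proof (intro allI impI)
      fix y :: real assume y: "\<bar>0 - y\<bar> < r"
      have "dist p (p + y *\<^sub>R axis i 1) = \<bar>y\<bar>" by (simp add: dist_norm norm_axis_1)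
      hence "p + y *\<^sub>R axis i 1 \<in> N" using y r by auto
      thus "\<rho> (p + y *\<^sub>R axis i 1) \<le> \<rho> (p + 0 *\<^sub>R axis i 1)" using N(4) by simp
    qed
  qed
  show ?thesis unfolding has_derivative_at_alt
  proof (intro conjI allI impI)
    show "bounded_linear (\<lambda>v::R2. 0::real)" by (rule bounded_linear_zero)
    fix e :: real assume e: "e > 0"
    have "\<exists>d>0. \<forall>x\<in>U. dist x p < d \<longrightarrow> dist (h i x) (h i p) < e / 2" for i
      using hc[of i] U(2) e unfolding continuous_on_iff by (metis half_gt_zero)
    then obtain dd where dd: "\<And>i. dd i > 0" "\<And>i x. x \<in> U \<Longrightarrow> dist x p < dd i \<Longrightarrow> dist (h i x) (h i p) < e / 2" by metis
    define d where "d = min r (min (dd 1) (dd 2))"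
    have d: "d > 0" "d \<le> r" "\<And>i. d \<le> dd i" using r dd(1) unfolding d_def by (auto, metis exhaust_2 min.cobounded1 min.cobounded2 min.coboundedI2)
    have bd: "x \<in> U \<and> \<bar>h i x\<bar> \<le> e / 2" if "dist p x < d" for x i
    proof -
      have "x \<in> ball p r" using that d(2) by simp
      hence xU: "x \<in> U" using r(2) N(3) by blast
      have "dist x p < dd i" using that d(3)[of i] by (simp add: dist_commute)
      from dd(2)[OF xU this] show ?thesis using xU h0 by (simp add: dist_real_def)
    qed
    have lip: "\<bar>\<rho> (x + t *\<^sub>R axis i 1) - \<rho> x\<bar> \<le> e / 2 * \<bar>t\<bar>"
      if "\<And>s. \<bar>s\<bar> \<le> \<bar>t\<bar> \<Longrightarrow> dist p (x + s *\<^sub>R axis i 1) < d" for x i t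
    proof -
      have "norm (\<rho> (x + t *\<^sub>R axis i 1) - \<rho> (x + 0 *\<^sub>R axis i 1)) \<le> e / 2 * norm (t - 0)"
      proof (rule field_differentiable_bound[where S="{-\<bar>t\<bar>..\<bar>t\<bar>}" and f="\<lambda>t. \<rho> (x + t *\<^sub>R axis i 1)"])
        fix z assume "z \<in> {-\<bar>t\<bar>..\<bar>t\<bar>}"
        hence "dist p (x + z *\<^sub>R axis i 1) < d" by (intro that) auto
        note b = bd[OF this]
        show "((\<lambda>t. \<rho> (x + t *\<^sub>R axis i 1)) has_field_derivative h i (x + z *\<^sub>R axis i 1)) (at z within {-\<bar>t\<bar>..\<bar>t\<bar>})"
          by (rule has_field_derivative_at_within[OF dt]) (use b in blast)
        show "norm (h i (x + z *\<^sub>R axis i 1)) \<le> e / 2" using b by simp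
      qed auto
      thus ?thesis by simp
    qed
    show "\<exists>d>0. \<forall>y. norm (y - p) < d \<longrightarrow> norm (\<rho> y - \<rho> p - 0) \<le> e * norm (y - p)"
    proof (intro exI[of _ d] conjI allI impI d(1))
      fix y assume y: "norm (y - p) < d"
      define v where "v = y - p"
      \<comment> \<open>The corner of the path from \<open>p\<close> to \<open>y\<close> that
        follows first one axis and then the other.\<close>
      define q where "q = p + (v $ 1) *\<^sub>R axis 1 1"
      have y_eq: "y = q + (v $ 2) *\<^sub>R axis 2 1" by (simp add: q_def v_def vec_eq_iff forall_2 axis_def)
      have v12: "\<bar>v $ 1\<bar> \<le> norm v" "\<bar>v $ 2\<bar> \<le> norm v" by (rule component_le_norm_cart)+
      have "\<bar>\<rho> q - \<rho> p\<bar> \<le> e / 2 * \<bar>v $ 1\<bar>" unfolding q_def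
      proof (rule lip)
        fix s assume s: "\<bar>s\<bar> \<le> \<bar>v $ 1\<bar>"
        have "dist p (p + s *\<^sub>R axis 1 1) = \<bar>s\<bar>" by (simp add: dist_norm norm_axis_1)
        thus "dist p (p + s *\<^sub>R axis 1 1) < d" using s v12 y by (simp add: v_def)
      qed
      moreover have "\<bar>\<rho> y - \<rho> q\<bar> \<le> e / 2 * \<bar>v $ 2\<bar>" unfolding y_eq
      proof (rule lip)
        fix s assume s: "\<bar>s\<bar> \<le> \<bar>v $ 2\<bar>"
        have "dist p (q + s *\<^sub>R axis 2 1) = sqrt ((v $ 1)\<^sup>2 + s\<^sup>2)"
          by (simp add: dist_norm norm_R2 q_def axis_def)
        also have "\<dots> \<le> norm v" unfolding norm_R2 using s
          by (intro real_sqrt_le_mono add_left_mono) (simp add: abs_le_square_iff)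
        finally show "dist p (q + s *\<^sub>R axis 2 1) < d" using y by (simp add: v_def)
      qed
      moreover have "e / 2 * \<bar>v $ 1\<bar> + e / 2 * \<bar>v $ 2\<bar> \<le> e / 2 * norm v + e / 2 * norm v"
        using v12 e by (intro add_mono mult_left_mono) auto
      ultimately have "\<bar>\<rho> y - \<rho> p\<bar> \<le> e * norm v" by linarith
      thus "norm (\<rho> y - \<rho> p - 0) \<le> e * norm (y - p)" by (simp add: v_def)
    qed
  qed
qed

lemma AE_open_empty:
  fixes S :: "'a::euclidean_space set"
  assumes "open S" "AE v in lborel. v \<notin> S"
  shows "S = {}"
proof (rule ccontr)
  assume "S \<noteq> {}"
  hence "emeasure lborel S > 0" by (rule emeasure_open_pos[OF assms(1)])
  moreover have "{v \<in> space lborel. \<not> v \<notin> S} = S" by simp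
  hence "emeasure lborel S = 0" using AE_iff_measurable[of S lborel "\<lambda>v. v \<notin> S"] assms by simp
  ultimately show False by simp
qed

text \<open>The regularity of the boundary excludes discs from which a null set has been removed.\<close>

lemma smooth_domain_AE_ball:
  assumes sd: "smooth_bounded_domain \<Omega>"
    and ae: "AE v in lborel. (v \<in> \<Omega> \<longrightarrow> dist v c \<le> 1) \<and> (dist v c < 1 \<longrightarrow> v \<in> \<Omega>)"
  shows "\<Omega> = ball c 1"
proof -
  have o: "open \<Omega>" using sd by (simp add: smooth_bounded_domain_def)
  have "\<Omega> \<inter> - cball c 1 = {}"
    by (rule AE_open_empty[OF open_Int[OF o]]) (use ae in \<open>auto simp: dist_commute\<close>)
  hence sub: "\<Omega> \<subseteq> ball c 1" using interior_maximal[OF _ o, of "cball c 1"] by auto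
  have "ball c 1 \<subseteq> \<Omega>"
  proof (rule subsetI, rule ccontr)
    fix p assume p: "p \<in> ball c 1" "p \<notin> \<Omega>"
    have out: "S = {}" if "open S" "S \<subseteq> ball c 1" "S \<inter> \<Omega> = {}" for S
      by (rule AE_open_empty[OF that(1)], use ae in eventually_elim) (use that in \<open>auto simp: dist_commute\<close>)
    have "p \<in> closure \<Omega>"
    proof (rule ccontr)
      assume "p \<notin> closure \<Omega>"
      moreover have "ball c 1 \<inter> - closure \<Omega> = {}"
        by (rule out) (use closure_subset[of \<Omega>] in auto)
      ultimately show False using p by blast
    qed
    hence "p \<in> frontier \<Omega>" using p o by (simp add: frontier_def interior_open)
    then obtain U \<rho> where U: "open U" "p \<in> U" "smooth_on U \<rho>" "\<Omega> \<inter> U = {x\<in>U. \<rho> x < 0}"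
      and nd: "\<And>x. x \<in> U \<Longrightarrow> \<not> (\<rho> has_derivative (\<lambda>v. 0)) (at x)"
      using sd unfolding smooth_bounded_domain_def by meson
    have rc: "continuous_on U \<rho>" using U(3) higher_pd.refl[of U \<rho>] by (simp add: smooth_on_def)
    let ?N = "U \<inter> ball c 1"
    have oN: "open ?N" using U by auto
    \<comment> \<open>Where \<rho> is positive there are no points of \<Omega>, and an open part of
      the disc without points of \<Omega> is empty. So \<rho> is nowhere positive near
      \<open>p\<close>; as it is not negative at \<open>p\<close>, it has a local maximum
      there.\<close>
    have "?N \<inter> \<rho> -` {0<..} = {}"
    proof (rule out)
      show "open (?N \<inter> \<rho> -` {0<..})"
        by (rule continuous_open_preimage[OF continuous_on_subset[OF rc] oN]) auto
      show "?N \<inter> \<rho> -` {0<..} \<inter> \<Omega> = {}"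
      proof (rule equals0I)
        fix x assume "x \<in> ?N \<inter> \<rho> -` {0<..} \<inter> \<Omega>"
        moreover from this have "x \<in> {x\<in>U. \<rho> x < 0}" unfolding U(4)[symmetric] by blast
        ultimately show False by simp
      qed
    qed blast
    moreover have "\<rho> p \<ge> 0" using U(2,4) p(2) by (metis (mono_tags, lifting) IntD1 mem_Collect_eq not_le)
    ultimately have "\<rho> v \<le> \<rho> p" if "v \<in> ?N" for v using that by (force simp: not_le)
    from has_derivative_zero_local_max[OF U(1-3) oN _ _ this] p U(2) nd[OF U(2)] show False by blast
  qed
  thus ?thesis using sub by blast
qed

lemma E8pi_not_ball:
  assumes sd: "smooth_bounded_domain \<Omega>" and mO: "measure lebesgue \<Omega> = pi" and nb: "\<And>c. \<Omega> \<noteq> ball c 1"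
  shows "E8pi \<Omega> > - 1"
proof -
  have o: "open \<Omega>" "connected \<Omega>" "bounded \<Omega>" using sd by (simp_all add: smooth_bounded_domain_def)
  have mb: "measure lborel \<Omega> = pi" using mO o(1) by simp
  have "\<not> (AE v in lborel. (v \<in> \<Omega> \<longrightarrow> dist v c \<le> 1) \<and> (dist v c < 1 \<longrightarrow> v \<in> \<Omega>))" for c
    using smooth_domain_AE_ball[OF sd, of c] nb[of c] by blast
  from isoperimetric_strict[OF o mb this]
  obtain \<gamma> \<kappa> where gain: "isoperimetric_gain \<Omega> \<gamma> \<kappa>" by blast
  hence gk: "\<gamma> > 1" "0 < \<kappa>" "\<kappa> < pi" by (simp_all add: isoperimetric_gain_def)
  define \<theta> where "\<theta> = \<kappa> / (2 * pi)"
  define \<delta>\<^sub>1 where "\<delta>\<^sub>1 = (1 - 1 / \<gamma>) * (4 * pi * \<gamma> * \<theta>\<^sup>2 * (pi - \<kappa>) / \<kappa>) / (16 * pi)"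
  define \<delta> where "\<delta> = min (1/2) (min \<delta>\<^sub>1 \<theta>)"
  have "\<theta> > 0" using gk by (simp add: \<theta>_def)
  moreover have "\<delta>\<^sub>1 > 0" unfolding \<delta>\<^sub>1_def using gk \<open>\<theta> > 0\<close> by (intro divide_pos_pos mult_pos_pos) auto
  ultimately have \<delta>: "\<delta> > 0" "\<delta> \<le> 1" by (auto simp: \<delta>_def)
  have low: "- 1 + \<delta> \<le> x" if x: "x \<in> {I8pi \<Omega> u g | u g. H10 \<Omega> u g}" for x
  proof -
    obtain u g where ug: "x = I8pi \<Omega> u g" "H10 \<Omega> u g" using x by blast
    show ?thesis unfolding ug(1)
    proof (rule I8pi_lower[OF o(1) mO ug(2) \<delta>(2)])
      fix \<phi> assume t: "test_fun \<Omega> \<phi>"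
      show "(\<integral>\<^sup>+ v. ennreal (indicator \<Omega> v * exp (\<phi> v)) \<partial>lborel) \<le>
         ennreal (pi * exp (1 - \<delta> + (LINT v|lborel. indicator \<Omega> v * (norm (grad \<phi> v))\<^sup>2) / (16 * pi)))"
      proof (rule test_fun_exp_bound[OF o(1) mb t])
        fix \<phi> assume t: "test_fun \<Omega> \<phi>"
        interpret level_sets \<Omega> \<phi> by unfold_locales (simp_all add: o mb t)
        show "ln (F 0 / pi) \<le> 1 - \<delta> + G 0 / (16 * pi)"
          unfolding \<delta>_def \<delta>\<^sub>1_def \<theta>_def by (rule moser_trudinger_gain[OF gain])
      qed
    qed
  qed
  have "- 1 + \<delta> \<le> E8pi \<Omega>" unfolding E8pi_def
  proof (rule cInf_greatest)
    show "{I8pi \<Omega> u g | u g. H10 \<Omega> u g} \<noteq> {}" using test_fun_H10[OF test_fun_0] by blast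
  qed (rule low)
  thus ?thesis using \<delta>(1) by linarith
qed

theorem theorem1:
  fixes \<Omega> :: "(real ^ 2) set"
  assumes "smooth_bounded_domain \<Omega>"
    and "measure lebesgue \<Omega> = pi"
  shows "E8pi \<Omega> \<ge> E8pi (ball 0 1) \<and>
         (E8pi \<Omega> = E8pi (ball 0 1) \<longleftrightarrow> (\<exists>c. \<Omega> = ball c 1))"
proof (cases "\<exists>c. \<Omega> = ball c 1")
  case True
  thus ?thesis by (auto simp: E8pi_ball)
next
  case False
  hence "E8pi \<Omega> > - 1" using E8pi_not_ball[OF assms] by blast
  thus ?thesis using False by (simp add: E8pi_ball)
qed

end
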